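(* $H(e_{\pm 1}, f_{\pm 1}, u, v)$ is a Hopf algebra with the dual Chevalley property of discrete corepresentation type.
   Context: $\Bbbk$ is an algebraically closed field of characteristic $0$. A Hopf algebra $H$ (possibly infinite-dimensional) has the dual Chevalley property if its coradical $H_0$ is a Hopf subalgebra. The dimension vector of a finite-dimensional right $H$-comodule $M$ records the multiplicity of each simple right comodule in a Jordan–Hölder series of $M$. $H$ is of discrete corepresentation type if for any finite dimension vector $\underline{d}$ there are only finitely many non-isomorphic indecomposable right $H$-comodules of dimension vector $\underline{d}$. Definition of $H(e_{\pm 1}, f_{\pm 1}, u, v)$: as a unital $\Bbbk$-algebra it is generated by $u,v$ and $e_i,f_i$ for $i\in\mathbb{Z}$, subject to the following relations for all $i,j\in\mathbb{Z}$: $$1=e_0+f_0,\quad e_ie_j=e_{i+j},\quad f_if_j=f_{i+j},\quad e_if_j=f_je_i=0,$$ $$e_iu=(-1)^iue_i,\quad f_iu=(-1)^iuf_i,\quad e_iv=(-1)^ive_i,\quad f_iv=(-1)^ivf_i,$$ $$u^2=v^2=0,\quad uv=-vu.$$ The comultiplication, counit and antipode are given, for all $i\in\mathbb{Z}$, by $$\Delta(e_i)=e_i\otimes e_i+f_i\otimes f_{-i},\quad \varepsilon(e_i)=1,\quad S(e_i)=e_{-i},$$ $$\Delta(f_i)=e_i\otimes f_i+f_i\otimes e_{-i},\quad \varepsilon(f_i)=0,\quad S(f_i)=f_i,$$ $$\Delta(u)=1\otimes u+u\otimes e_1+v\otimes f_{-1},\quad \varepsilon(u)=0,\quad S(u)=-vf_{-1}-ue_{-1},$$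 $$\Delta(v)=1\otimes v+u\otimes f_1+v\otimes e_{-1},\quad \varepsilon(v)=0,\quad S(v)=-uf_1-ve_1.$$ *)

theory Defs
  imports "HOL-Library.Poly_Mapping" "HOL-Computational_Algebra.Computational_Algebra"
begin

section \<open>Tensor products of vector spaces\<close>

text \<open>A vector space over a field \<^typ>\<open>'k\<close> is a type with a scaling satisfying
  \<^locale>\<open>vector_space\<close>, or a subspace of such a type.  The free vector space on a type
  \<^typ>\<open>'b\<close> is the type of finitely supported functions from \<^typ>\<open>'b\<close> to \<^typ>\<open>'k\<close>.\<close>

definition pm_scale :: "'k::field \<Rightarrow> ('b \<Rightarrow>\<^sub>0 'k) \<Rightarrow> ('b \<Rightarrow>\<^sub>0 'k)" where
  "pm_scale c p = Poly_Mapping.map ((*) c) p"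

lemma lookup_pm_scale: "Poly_Mapping.lookup (pm_scale c p) x = c * Poly_Mapping.lookup p x"
  by (simp add: pm_scale_def Poly_Mapping.map.rep_eq when_def)

lemma vector_space_pm_scale: "vector_space (pm_scale :: 'k::field \<Rightarrow> ('b \<Rightarrow>\<^sub>0 'k) \<Rightarrow> _)"
  by standard (auto intro!: poly_mapping_eqI simp: lookup_pm_scale lookup_add algebra_simps)

definition fbasis :: "'b \<Rightarrow> ('b \<Rightarrow>\<^sub>0 'k::field)" where
  "fbasis x = Poly_Mapping.single x 1"

definition lin_ext :: "('k::field \<Rightarrow> 'a::ab_group_add \<Rightarrow> 'a) \<Rightarrow> ('b \<Rightarrow> 'a) \<Rightarrow> ('b \<Rightarrow>\<^sub>0 'k) \<Rightarrow> 'a" where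
  "lin_ext sa g p = (\<Sum>x\<in>Poly_Mapping.keys p. sa (Poly_Mapping.lookup p x) (g x))"

text \<open>For subspaces \<open>A\<close>, \<open>B\<close>, the space \<open>A \<otimes> B\<close> is the free vector space on \<open>A \<times> B\<close> modulo
  the span of the bilinearity relations.  An element of \<open>A \<otimes> B\<close> is given by a representative
  in the free vector space with support in \<open>A \<times> B\<close> (\<open>fbasis (a, b)\<close> represents the elementary
  tensor of \<open>a\<close> and \<open>b\<close>), and equality in \<open>A \<otimes> B\<close> is the congruence \<open>tensor_eq\<close>.  Maps into a
  tensor product are accordingly maps into representatives, which are required to be linear
  only modulo that congruence.\<close>

definition tensor_rels ::
    "('k::field \<Rightarrow> 'a::ab_group_add \<Rightarrow> 'a) \<Rightarrow> 'a set \<Rightarrow> ('k \<Rightarrow> 'b::ab_group_add \<Rightarrow> 'b) \<Rightarrow> 'b set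
      \<Rightarrow> ('a \<times> 'b \<Rightarrow>\<^sub>0 'k) set" where
  "tensor_rels sa A sb B =
     {fbasis (a + a', b) - fbasis (a, b) - fbasis (a', b) | a a' b. a \<in> A \<and> a' \<in> A \<and> b \<in> B}
   \<union> {fbasis (a, b + b') - fbasis (a, b) - fbasis (a, b') | a b b'. a \<in> A \<and> b \<in> B \<and> b' \<in> B}
   \<union> {fbasis (sa c a, b) - pm_scale c (fbasis (a, b)) | c a b. a \<in> A \<and> b \<in> B}
   \<union> {fbasis (a, sb c b) - pm_scale c (fbasis (a, b)) | c a b. a \<in> A \<and> b \<in> B}"

definition tensor_eq ::
    "('k::field \<Rightarrow> 'a::ab_group_add \<Rightarrow> 'a) \<Rightarrow> 'a set \<Rightarrow> ('k \<Rightarrow> 'b::ab_group_add \<Rightarrow> 'b) \<Rightarrow> 'b set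
      \<Rightarrow> ('a \<times> 'b \<Rightarrow>\<^sub>0 'k) \<Rightarrow> ('a \<times> 'b \<Rightarrow>\<^sub>0 'k) \<Rightarrow> bool" where
  "tensor_eq sa A sb B p q \<longleftrightarrow> p - q \<in> module.span pm_scale (tensor_rels sa A sb B)"

definition tensor3_rels ::
    "('k::field \<Rightarrow> 'a::ab_group_add \<Rightarrow> 'a) \<Rightarrow> 'a set \<Rightarrow> ('k \<Rightarrow> 'b::ab_group_add \<Rightarrow> 'b) \<Rightarrow> 'b set
      \<Rightarrow> ('k \<Rightarrow> 'c::ab_group_add \<Rightarrow> 'c) \<Rightarrow> 'c set \<Rightarrow> ('a \<times> 'b \<times> 'c \<Rightarrow>\<^sub>0 'k) set" where
  "tensor3_rels sa A sb B sc C =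
     {fbasis (a + a', b, c) - fbasis (a, b, c) - fbasis (a', b, c) | a a' b c.
        a \<in> A \<and> a' \<in> A \<and> b \<in> B \<and> c \<in> C}
   \<union> {fbasis (a, b + b', c) - fbasis (a, b, c) - fbasis (a, b', c) | a b b' c.
        a \<in> A \<and> b \<in> B \<and> b' \<in> B \<and> c \<in> C}
   \<union> {fbasis (a, b, c + c') - fbasis (a, b, c) - fbasis (a, b, c') | a b c c'.
        a \<in> A \<and> b \<in> B \<and> c \<in> C \<and> c' \<in> C}
   \<union> {fbasis (sa r a, b, c) - pm_scale r (fbasis (a, b, c)) | r a b c. a \<in> A \<and> b \<in> B \<and> c \<in> C}
   \<union> {fbasis (a, sb r b, c) - pm_scale r (fbasis (a, b, c)) | r a b c. a \<in> A \<and> b \<in> B \<and> c \<in> C}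
   \<union> {fbasis (a, b, sc r c) - pm_scale r (fbasis (a, b, c)) | r a b c. a \<in> A \<and> b \<in> B \<and> c \<in> C}"

definition tensor3_eq ::
    "('k::field \<Rightarrow> 'a::ab_group_add \<Rightarrow> 'a) \<Rightarrow> 'a set \<Rightarrow> ('k \<Rightarrow> 'b::ab_group_add \<Rightarrow> 'b) \<Rightarrow> 'b set
      \<Rightarrow> ('k \<Rightarrow> 'c::ab_group_add \<Rightarrow> 'c) \<Rightarrow> 'c set
      \<Rightarrow> ('a \<times> 'b \<times> 'c \<Rightarrow>\<^sub>0 'k) \<Rightarrow> ('a \<times> 'b \<times> 'c \<Rightarrow>\<^sub>0 'k) \<Rightarrow> bool" where
  "tensor3_eq sa A sb B sc C p q \<longleftrightarrow> p - q \<in> module.span pm_scale (tensor3_rels sa A sb B sc C)"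

definition map_left :: "('a \<Rightarrow> ('a' \<times> 'b \<Rightarrow>\<^sub>0 'k)) \<Rightarrow> ('a \<times> 'c \<Rightarrow>\<^sub>0 'k) \<Rightarrow> ('a' \<times> 'b \<times> 'c \<Rightarrow>\<^sub>0 'k::field)" where
  "map_left \<rho> = lin_ext pm_scale (\<lambda>(a, c). lin_ext pm_scale (\<lambda>(a', b). fbasis (a', b, c)) (\<rho> a))"

definition map_right :: "('c \<Rightarrow> ('b \<times> 'c' \<Rightarrow>\<^sub>0 'k)) \<Rightarrow> ('a \<times> 'c \<Rightarrow>\<^sub>0 'k) \<Rightarrow> ('a \<times> 'b \<times> 'c' \<Rightarrow>\<^sub>0 'k::field)" where
  "map_right \<Delta> = lin_ext pm_scale (\<lambda>(a, c). lin_ext pm_scale (\<lambda>(b, c'). fbasis (a, b, c')) (\<Delta> c))"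

definition tensor_mult ::
    "('a \<times> 'a \<Rightarrow>\<^sub>0 'k) \<Rightarrow> ('a \<times> 'a \<Rightarrow>\<^sub>0 'k) \<Rightarrow> ('a::times \<times> 'a \<Rightarrow>\<^sub>0 'k::field)" where
  "tensor_mult p q =
     lin_ext pm_scale (\<lambda>(a, b). lin_ext pm_scale (\<lambda>(a', b'). fbasis (a * a', b * b')) q) p"

section \<open>Coalgebras and Hopf algebras\<close>

locale coalgebra = vector_space scale
  for scale :: "'k::field \<Rightarrow> 'h::ab_group_add \<Rightarrow> 'h" +
  fixes \<Delta> :: "'h \<Rightarrow> ('h \<times> 'h \<Rightarrow>\<^sub>0 'k)" and \<epsilon> :: "'h \<Rightarrow> 'k"
  assumes comult_add: "tensor_eq scale UNIV scale UNIV (\<Delta> (x + y)) (\<Delta> x + \<Delta> y)"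
    and comult_scale: "tensor_eq scale UNIV scale UNIV (\<Delta> (scale c x)) (pm_scale c (\<Delta> x))"
    and counit_linear: "Vector_Spaces.linear scale (*) \<epsilon>"
    and coassoc: "tensor3_eq scale UNIV scale UNIV scale UNIV
                    (map_left \<Delta> (\<Delta> x)) (map_right \<Delta> (\<Delta> x))"
    and counit_left: "lin_ext scale (\<lambda>(a, b). scale (\<epsilon> a) b) (\<Delta> x) = x"
    and counit_right: "lin_ext scale (\<lambda>(a, b). scale (\<epsilon> b) a) (\<Delta> x) = x"

locale hopf_algebra = coalgebra scale \<Delta> \<epsilon>
  for scale :: "'k::field \<Rightarrow> 'h::{ring, monoid_mult} \<Rightarrow> 'h" and \<Delta> \<epsilon> +
  fixes S :: "'h \<Rightarrow> 'h"
  assumes scale_mult_left: "scale c x * y = scale c (x * y)"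
    and scale_mult_right: "x * scale c y = scale c (x * y)"
    and comult_mult: "tensor_eq scale UNIV scale UNIV (\<Delta> (x * y)) (tensor_mult (\<Delta> x) (\<Delta> y))"
    and comult_one: "tensor_eq scale UNIV scale UNIV (\<Delta> 1) (fbasis (1, 1))"
    and counit_mult: "\<epsilon> (x * y) = \<epsilon> x * \<epsilon> y"
    and counit_one: "\<epsilon> 1 = 1"
    and antipode_linear: "Vector_Spaces.linear scale scale S"
    and antipode_left: "lin_ext scale (\<lambda>(a, b). S a * b) (\<Delta> x) = scale (\<epsilon> x) 1"
    and antipode_right: "lin_ext scale (\<lambda>(a, b). a * S b) (\<Delta> x) = scale (\<epsilon> x) 1"

definition subcoalgebra ::
    "('k::field \<Rightarrow> 'h::ab_group_add \<Rightarrow> 'h) \<Rightarrow> ('h \<Rightarrow> ('h \<times> 'h \<Rightarrow>\<^sub>0 'k)) \<Rightarrow> 'h set \<Rightarrow> bool" where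
  "subcoalgebra sh \<Delta> C \<longleftrightarrow> module.subspace sh C \<and>
     (\<forall>x\<in>C. \<exists>y. Poly_Mapping.keys y \<subseteq> C \<times> C \<and> tensor_eq sh UNIV sh UNIV y (\<Delta> x))"

definition simple_subcoalgebra ::
    "('k::field \<Rightarrow> 'h::ab_group_add \<Rightarrow> 'h) \<Rightarrow> ('h \<Rightarrow> ('h \<times> 'h \<Rightarrow>\<^sub>0 'k)) \<Rightarrow> 'h set \<Rightarrow> bool" where
  "simple_subcoalgebra sh \<Delta> C \<longleftrightarrow> subcoalgebra sh \<Delta> C \<and> C \<noteq> {0} \<and>
     (\<forall>D. subcoalgebra sh \<Delta> D \<and> D \<subseteq> C \<longrightarrow> D = {0} \<or> D = C)"

definition coradical ::
    "('k::field \<Rightarrow> 'h::ab_group_add \<Rightarrow> 'h) \<Rightarrow> ('h \<Rightarrow> ('h \<times> 'h \<Rightarrow>\<^sub>0 'k)) \<Rightarrow> 'h set" where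
  "coradical sh \<Delta> = module.span sh (\<Union>{C. simple_subcoalgebra sh \<Delta> C})"

definition hopf_subalgebra ::
    "('k::field \<Rightarrow> 'h::{ring, monoid_mult} \<Rightarrow> 'h) \<Rightarrow> ('h \<Rightarrow> ('h \<times> 'h \<Rightarrow>\<^sub>0 'k)) \<Rightarrow> ('h \<Rightarrow> 'h)
      \<Rightarrow> 'h set \<Rightarrow> bool" where
  "hopf_subalgebra sh \<Delta> S A \<longleftrightarrow> subcoalgebra sh \<Delta> A \<and> 1 \<in> A \<and>
     (\<forall>x\<in>A. \<forall>y\<in>A. x * y \<in> A) \<and> (\<forall>x\<in>A. S x \<in> A)"

definition dual_chevalley_property ::
    "('k::field \<Rightarrow> 'h::{ring, monoid_mult} \<Rightarrow> 'h) \<Rightarrow> ('h \<Rightarrow> ('h \<times> 'h \<Rightarrow>\<^sub>0 'k)) \<Rightarrow> ('h \<Rightarrow> 'h) \<Rightarrow> bool"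
  where "dual_chevalley_property sh \<Delta> S \<longleftrightarrow> hopf_subalgebra sh \<Delta> S (coradical sh \<Delta>)"

section \<open>Right comodules\<close>

text \<open>A comodule consists of a subspace \<open>V\<close> of an ambient vector space \<^typ>\<open>'m\<close> and a coaction
  \<open>V \<rightarrow> V \<otimes> H\<close>; the values of the coaction function outside \<open>V\<close> are irrelevant.\<close>

type_synonym ('k, 'h, 'm) comod = "'m set \<times> ('m \<Rightarrow> ('m \<times> 'h \<Rightarrow>\<^sub>0 'k))"

definition comodule ::
    "('k::field \<Rightarrow> 'h::ab_group_add \<Rightarrow> 'h) \<Rightarrow> ('h \<Rightarrow> ('h \<times> 'h \<Rightarrow>\<^sub>0 'k)) \<Rightarrow> ('h \<Rightarrow> 'k)
      \<Rightarrow> ('k \<Rightarrow> 'm::ab_group_add \<Rightarrow> 'm) \<Rightarrow> ('k, 'h, 'm) comod \<Rightarrow> bool" where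
  "comodule sh \<Delta> \<epsilon> sm M \<longleftrightarrow> (case M of (V, \<rho>) \<Rightarrow>
     module.subspace sm V \<and>
     (\<forall>x\<in>V. Poly_Mapping.keys (\<rho> x) \<subseteq> V \<times> UNIV) \<and>
     (\<forall>x\<in>V. \<forall>y\<in>V. tensor_eq sm V sh UNIV (\<rho> (x + y)) (\<rho> x + \<rho> y)) \<and>
     (\<forall>c. \<forall>x\<in>V. tensor_eq sm V sh UNIV (\<rho> (sm c x)) (pm_scale c (\<rho> x))) \<and>
     (\<forall>x\<in>V. tensor3_eq sm V sh UNIV sh UNIV (map_left \<rho> (\<rho> x)) (map_right \<Delta> (\<rho> x))) \<and>
     (\<forall>x\<in>V. lin_ext sm (\<lambda>(m, h). sm (\<epsilon> h) m) (\<rho> x) = x))"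

definition comodule_hom ::
    "('k::field \<Rightarrow> 'h::ab_group_add \<Rightarrow> 'h) \<Rightarrow> ('k \<Rightarrow> 'm::ab_group_add \<Rightarrow> 'm)
      \<Rightarrow> ('k, 'h, 'm) comod \<Rightarrow> ('k, 'h, 'm) comod \<Rightarrow> ('m \<Rightarrow> 'm) \<Rightarrow> bool" where
  "comodule_hom sh sm M N f \<longleftrightarrow> (case M of (V, \<rho>) \<Rightarrow> case N of (W, \<sigma>) \<Rightarrow>
     f ` V \<subseteq> W \<and>
     (\<forall>x\<in>V. \<forall>y\<in>V. f (x + y) = f x + f y) \<and>
     (\<forall>c. \<forall>x\<in>V. f (sm c x) = sm c (f x)) \<and>
     (\<forall>x\<in>V. tensor_eq sm W sh UNIV
        (\<sigma> (f x)) (lin_ext pm_scale (\<lambda>(m, h). fbasis (f m, h)) (\<rho> x))))"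

definition comodule_iso ::
    "('k::field \<Rightarrow> 'h::ab_group_add \<Rightarrow> 'h) \<Rightarrow> ('k \<Rightarrow> 'm::ab_group_add \<Rightarrow> 'm)
      \<Rightarrow> ('k, 'h, 'm) comod \<Rightarrow> ('k, 'h, 'm) comod \<Rightarrow> bool" where
  "comodule_iso sh sm M N \<longleftrightarrow> (\<exists>f. comodule_hom sh sm M N f \<and> bij_betw f (fst M) (fst N))"

definition subcomodule ::
    "('k::field \<Rightarrow> 'h::ab_group_add \<Rightarrow> 'h) \<Rightarrow> ('k \<Rightarrow> 'm::ab_group_add \<Rightarrow> 'm)
      \<Rightarrow> ('k, 'h, 'm) comod \<Rightarrow> 'm set \<Rightarrow> bool" where
  "subcomodule sh sm M N \<longleftrightarrow> (case M of (V, \<rho>) \<Rightarrow>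
     module.subspace sm N \<and> N \<subseteq> V \<and>
     (\<forall>x\<in>N. \<exists>y. Poly_Mapping.keys y \<subseteq> N \<times> UNIV \<and> tensor_eq sm V sh UNIV y (\<rho> x)))"

text \<open>The coaction of a subcomodule \<open>N\<close>: a representative of \<open>\<rho> x\<close> supported in \<open>N \<times> H\<close>
  is chosen (it is unique as an element of \<open>N \<otimes> H\<close>, which embeds into \<open>V \<otimes> H\<close>).\<close>

definition restrict_comodule ::
    "('k::field \<Rightarrow> 'h::ab_group_add \<Rightarrow> 'h) \<Rightarrow> ('k \<Rightarrow> 'm::ab_group_add \<Rightarrow> 'm)
      \<Rightarrow> ('k, 'h, 'm) comod \<Rightarrow> 'm set \<Rightarrow> ('k, 'h, 'm) comod" where
  "restrict_comodule sh sm M N = (case M of (V, \<rho>) \<Rightarrow>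
     (N, \<lambda>x. SOME y. Poly_Mapping.keys y \<subseteq> N \<times> UNIV \<and> tensor_eq sm V sh UNIV y (\<rho> x)))"

definition simple_comodule ::
    "('k::field \<Rightarrow> 'h::ab_group_add \<Rightarrow> 'h) \<Rightarrow> ('h \<Rightarrow> ('h \<times> 'h \<Rightarrow>\<^sub>0 'k)) \<Rightarrow> ('h \<Rightarrow> 'k)
      \<Rightarrow> ('k \<Rightarrow> 'm::ab_group_add \<Rightarrow> 'm) \<Rightarrow> ('k, 'h, 'm) comod \<Rightarrow> bool" where
  "simple_comodule sh \<Delta> \<epsilon> sm M \<longleftrightarrow> comodule sh \<Delta> \<epsilon> sm M \<and> fst M \<noteq> {0} \<and>
     (\<forall>N. subcomodule sh sm M N \<longrightarrow> N = {0} \<or> N = fst M)"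

definition indecomposable_comodule ::
    "('k::field \<Rightarrow> 'h::ab_group_add \<Rightarrow> 'h) \<Rightarrow> ('h \<Rightarrow> ('h \<times> 'h \<Rightarrow>\<^sub>0 'k)) \<Rightarrow> ('h \<Rightarrow> 'k)
      \<Rightarrow> ('k \<Rightarrow> 'm::ab_group_add \<Rightarrow> 'm) \<Rightarrow> ('k, 'h, 'm) comod \<Rightarrow> bool" where
  "indecomposable_comodule sh \<Delta> \<epsilon> sm M \<longleftrightarrow> comodule sh \<Delta> \<epsilon> sm M \<and> fst M \<noteq> {0} \<and>
     (\<forall>N N'. subcomodule sh sm M N \<and> subcomodule sh sm M N' \<and>
        N \<inter> N' = {0} \<and> {x + y | x y. x \<in> N \<and> y \<in> N'} = fst M \<longrightarrow> N = {0} \<or> N' = {0})"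

definition finite_dim_comodule ::
    "('k::field \<Rightarrow> 'm::ab_group_add \<Rightarrow> 'm) \<Rightarrow> ('k, 'h, 'm) comod \<Rightarrow> bool" where
  "finite_dim_comodule sm M \<longleftrightarrow> (\<exists>B. finite B \<and> fst M = module.span sm B)"

text \<open>\<open>N / N' \<cong> T\<close> for subcomodules \<open>N' \<subseteq> N\<close> of \<open>M\<close>: there is an exact sequence
  \<open>0 \<rightarrow> N' \<rightarrow> N \<rightarrow> T \<rightarrow> 0\<close> of comodules.\<close>

definition factor_iso ::
    "('k::field \<Rightarrow> 'h::ab_group_add \<Rightarrow> 'h) \<Rightarrow> ('k \<Rightarrow> 'm::ab_group_add \<Rightarrow> 'm)
      \<Rightarrow> ('k, 'h, 'm) comod \<Rightarrow> 'm set \<Rightarrow> 'm set \<Rightarrow> ('k, 'h, 'm) comod \<Rightarrow> bool" where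
  "factor_iso sh sm M N N' T \<longleftrightarrow>
     (\<exists>f. comodule_hom sh sm (restrict_comodule sh sm M N) T f \<and>
          f ` N = fst T \<and> {x \<in> N. f x = 0} = N')"

definition jordan_hoelder_series ::
    "('k::field \<Rightarrow> 'h::ab_group_add \<Rightarrow> 'h) \<Rightarrow> ('h \<Rightarrow> ('h \<times> 'h \<Rightarrow>\<^sub>0 'k)) \<Rightarrow> ('h \<Rightarrow> 'k)
      \<Rightarrow> ('k \<Rightarrow> 'm::ab_group_add \<Rightarrow> 'm) \<Rightarrow> ('k, 'h, 'm) comod \<Rightarrow> nat \<Rightarrow> (nat \<Rightarrow> 'm set) \<Rightarrow> bool" where
  "jordan_hoelder_series sh \<Delta> \<epsilon> sm M n N \<longleftrightarrow>
     N 0 = {0} \<and> N n = fst M \<and> (\<forall>i\<le>n. subcomodule sh sm M (N i)) \<and>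
     (\<forall>i<n. N i \<subseteq> N (Suc i) \<and>
        (\<exists>T. simple_comodule sh \<Delta> \<epsilon> sm T \<and> factor_iso sh sm M (N (Suc i)) (N i) T))"

text \<open>Dimension vectors are indexed by the simple comodules inside the same ambient space; every
  composition factor of a comodule in \<^typ>\<open>'m\<close> is isomorphic to one of these.  Only the values
  of \<open>d\<close> at simple comodules matter.\<close>

definition has_dimension_vector ::
    "('k::field \<Rightarrow> 'h::ab_group_add \<Rightarrow> 'h) \<Rightarrow> ('h \<Rightarrow> ('h \<times> 'h \<Rightarrow>\<^sub>0 'k)) \<Rightarrow> ('h \<Rightarrow> 'k)
      \<Rightarrow> ('k \<Rightarrow> 'm::ab_group_add \<Rightarrow> 'm) \<Rightarrow> ('k, 'h, 'm) comod \<Rightarrow> (('k, 'h, 'm) comod \<Rightarrow> nat) \<Rightarrow> bool" where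
  "has_dimension_vector sh \<Delta> \<epsilon> sm M d \<longleftrightarrow> finite_dim_comodule sm M \<and>
     (\<exists>n N. jordan_hoelder_series sh \<Delta> \<epsilon> sm M n N \<and>
        (\<forall>T. simple_comodule sh \<Delta> \<epsilon> sm T \<longrightarrow>
           d T = card {i. i < n \<and> factor_iso sh sm M (N (Suc i)) (N i) T}))"

definition indecomposables_of_dimension_vector ::
    "('k::field \<Rightarrow> 'h::ab_group_add \<Rightarrow> 'h) \<Rightarrow> ('h \<Rightarrow> ('h \<times> 'h \<Rightarrow>\<^sub>0 'k)) \<Rightarrow> ('h \<Rightarrow> 'k)
      \<Rightarrow> ('k \<Rightarrow> 'm::ab_group_add \<Rightarrow> 'm) \<Rightarrow> (('k, 'h, 'm) comod \<Rightarrow> nat) \<Rightarrow> ('k, 'h, 'm) comod set" where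
  "indecomposables_of_dimension_vector sh \<Delta> \<epsilon> sm d =
     {M. indecomposable_comodule sh \<Delta> \<epsilon> sm M \<and> has_dimension_vector sh \<Delta> \<epsilon> sm M d}"

text \<open>Discrete corepresentation type, for comodules inside the ambient vector space \<open>sm\<close>.
  To cover all comodules, \<open>sm\<close> has to range over all vector spaces, or at least over one of
  infinite dimension.\<close>

definition discrete_corepresentation_type ::
    "('k::field \<Rightarrow> 'h::ab_group_add \<Rightarrow> 'h) \<Rightarrow> ('h \<Rightarrow> ('h \<times> 'h \<Rightarrow>\<^sub>0 'k)) \<Rightarrow> ('h \<Rightarrow> 'k)
      \<Rightarrow> ('k \<Rightarrow> 'm::ab_group_add \<Rightarrow> 'm) \<Rightarrow> bool" where
  "discrete_corepresentation_type sh \<Delta> \<epsilon> sm \<longleftrightarrow>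
     (\<forall>d. let X = indecomposables_of_dimension_vector sh \<Delta> \<epsilon> sm d in
        finite (X // {(M, M'). M \<in> X \<and> M' \<in> X \<and> comodule_iso sh sm M M'}))"

section \<open>The algebra \<open>H(e\<^sub>\<plusminus>\<^sub>1, f\<^sub>\<plusminus>\<^sub>1, u, v)\<close>\<close>

instantiation list :: (type) monoid_add
begin
definition "0 = []"
definition "xs + ys = xs @ ys"
instance by standard (simp_all add: zero_list_def plus_list_def)
end

text \<open>With concatenation as addition of words, the convolution product on \<^typ>\<open>'g list \<Rightarrow>\<^sub>0 'k\<close>
  makes it the free unital algebra on \<^typ>\<open>'g\<close>.\<close>

datatype generator = Gen_e int | Gen_f int | Gen_u | Gen_v

type_synonym 'k free_alg = "generator list \<Rightarrow>\<^sub>0 'k"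

definition free_e :: "int \<Rightarrow> 'k::field free_alg" where "free_e i = fbasis [Gen_e i]"
definition free_f :: "int \<Rightarrow> 'k::field free_alg" where "free_f i = fbasis [Gen_f i]"
definition free_u :: "'k::field free_alg" where "free_u = fbasis [Gen_u]"
definition free_v :: "'k::field free_alg" where "free_v = fbasis [Gen_v]"

definition H_relations :: "('k::field free_alg \<times> 'k free_alg) set" where
  "H_relations =
     {(1, free_e 0 + free_f 0)}
   \<union> (\<Union>i j. {(free_e i * free_e j, free_e (i + j)), (free_f i * free_f j, free_f (i + j)),
              (free_e i * free_f j, 0), (free_f j * free_e i, 0)})
   \<union> (\<Union>i. {(free_e i * free_u, pm_scale ((-1) powi i) (free_u * free_e i)),
            (free_f i * free_u, pm_scale ((-1) powi i) (free_u * free_f i)),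
            (free_e i * free_v, pm_scale ((-1) powi i) (free_v * free_e i)),
            (free_f i * free_v, pm_scale ((-1) powi i) (free_v * free_f i))})
   \<union> {(free_u ^ 2, 0), (free_v ^ 2, 0), (free_u * free_v, - (free_v * free_u))}"

inductive_set two_sided_ideal :: "'a::ring_1 set \<Rightarrow> 'a set" for R where
  zero: "0 \<in> two_sided_ideal R"
| gen: "r \<in> R \<Longrightarrow> r \<in> two_sided_ideal R"
| add: "x \<in> two_sided_ideal R \<Longrightarrow> y \<in> two_sided_ideal R \<Longrightarrow> x + y \<in> two_sided_ideal R"
| mult: "x \<in> two_sided_ideal R \<Longrightarrow> a * x * b \<in> two_sided_ideal R"

lemma two_sided_ideal_left: "x \<in> two_sided_ideal R \<Longrightarrow> a * x \<in> two_sided_ideal R"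
  using two_sided_ideal.mult[of x R a 1] by simp

lemma two_sided_ideal_right: "x \<in> two_sided_ideal R \<Longrightarrow> x * a \<in> two_sided_ideal R"
  using two_sided_ideal.mult[of x R 1 a] by simp

lemma two_sided_ideal_uminus: "x \<in> two_sided_ideal R \<Longrightarrow> - x \<in> two_sided_ideal R"
  using two_sided_ideal_left[of x R "-1"] by simp

lemma two_sided_ideal_diff:
  "x \<in> two_sided_ideal R \<Longrightarrow> y \<in> two_sided_ideal R \<Longrightarrow> x - y \<in> two_sided_ideal R"
  using two_sided_ideal.add[of x R "- y"] two_sided_ideal_uminus[of y R] by simp

definition H_ideal :: "'k::field free_alg set" where
  "H_ideal = two_sided_ideal {l - r | l r. (l, r) \<in> H_relations}"

definition H_cong :: "'k::field free_alg \<Rightarrow> 'k free_alg \<Rightarrow> bool" where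
  "H_cong x y \<longleftrightarrow> x - y \<in> H_ideal"

lemma equivp_H_cong: "equivp (H_cong :: 'k::field free_alg \<Rightarrow> _)"
proof (rule equivpI)
  show "reflp (H_cong :: 'k free_alg \<Rightarrow> _)"
    by (rule reflpI) (simp add: H_cong_def H_ideal_def two_sided_ideal.zero)
  show "symp (H_cong :: 'k free_alg \<Rightarrow> _)"
  proof (rule sympI)
    fix x y :: "'k free_alg" assume "H_cong x y"
    then have "- (x - y) \<in> H_ideal" unfolding H_cong_def H_ideal_def by (rule two_sided_ideal_uminus)
    then show "H_cong y x" by (simp add: H_cong_def)
  qed
  show "transp (H_cong :: 'k free_alg \<Rightarrow> _)"
  proof (rule transpI)
    fix x y z :: "'k free_alg" assume "H_cong x y" "H_cong y z"
    then have "(x - y) + (y - z) \<in> H_ideal"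
      unfolding H_cong_def H_ideal_def by (rule two_sided_ideal.add)
    then show "H_cong x z" by (simp add: H_cong_def)
  qed
qed

quotient_type (overloaded) 'k hopf_efuv = "'k::field free_alg" / H_cong
  by (rule equivp_H_cong)

instantiation hopf_efuv :: (field) "{ring, monoid_mult}"
begin

lift_definition zero_hopf_efuv :: "'a hopf_efuv" is 0 .
lift_definition one_hopf_efuv :: "'a hopf_efuv" is 1 .
lift_definition plus_hopf_efuv :: "'a hopf_efuv \<Rightarrow> 'a hopf_efuv \<Rightarrow> 'a hopf_efuv" is "(+)"
  unfolding H_cong_def H_ideal_def by (drule (1) two_sided_ideal.add) (simp add: algebra_simps)
lift_definition uminus_hopf_efuv :: "'a hopf_efuv \<Rightarrow> 'a hopf_efuv" is uminus
  unfolding H_cong_def H_ideal_def by (drule two_sided_ideal_uminus) (simp add: algebra_simps)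
lift_definition minus_hopf_efuv :: "'a hopf_efuv \<Rightarrow> 'a hopf_efuv \<Rightarrow> 'a hopf_efuv" is "(-)"
  unfolding H_cong_def H_ideal_def by (drule (1) two_sided_ideal_diff) (simp add: algebra_simps)
lift_definition times_hopf_efuv :: "'a hopf_efuv \<Rightarrow> 'a hopf_efuv \<Rightarrow> 'a hopf_efuv" is "(*)"
proof -
  fix a b c d :: "'a free_alg"
  assume "H_cong a b" "H_cong c d"
  then have "(a - b) * c + b * (c - d) \<in> H_ideal"
    unfolding H_cong_def H_ideal_def
    by (intro two_sided_ideal.add two_sided_ideal_left two_sided_ideal_right)
  then show "H_cong (a * c) (b * d)"
    by (simp add: H_cong_def algebra_simps)
qed

instance
  by standard (transfer, simp add: H_cong_def H_ideal_def two_sided_ideal.zero algebra_simps)+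

end

lemma pm_scale_free: "pm_scale c p = Poly_Mapping.single 0 c * (p :: 'k::field free_alg)"
  by (simp add: pm_scale_def mult_map_scale_conv_mult)

lift_definition H_scale :: "'k::field \<Rightarrow> 'k hopf_efuv \<Rightarrow> 'k hopf_efuv" is pm_scale
proof -
  fix c :: 'k and x y :: "'k free_alg"
  assume "H_cong x y"
  then have "Poly_Mapping.single 0 c * (x - y) \<in> H_ideal"
    unfolding H_cong_def H_ideal_def by (rule two_sided_ideal_left)
  then show "H_cong (pm_scale c x) (pm_scale c y)"
    by (simp add: H_cong_def pm_scale_free algebra_simps)
qed

lemma vector_space_H_scale: "vector_space (H_scale :: 'k::field \<Rightarrow> 'k hopf_efuv \<Rightarrow> _)"
proof -
  interpret pm: vector_space "pm_scale :: 'k \<Rightarrow> 'k free_alg \<Rightarrow> _"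
    by (rule vector_space_pm_scale)
  show ?thesis
    by standard (transfer, simp add: H_cong_def H_ideal_def two_sided_ideal.zero
        pm.scale_right_distrib pm.scale_left_distrib)+
qed

lift_definition H_e :: "int \<Rightarrow> 'k::field hopf_efuv" is free_e .
lift_definition H_f :: "int \<Rightarrow> 'k::field hopf_efuv" is free_f .
lift_definition H_u :: "'k::field hopf_efuv" is free_u .
lift_definition H_v :: "'k::field hopf_efuv" is free_v .

abbreviation H_tensor_eq (infix "\<approx>\<^sub>\<otimes>" 50) where
  "p \<approx>\<^sub>\<otimes> q \<equiv> tensor_eq H_scale UNIV H_scale UNIV p q"

text \<open>\<open>\<Delta>\<close> and \<open>\<epsilon>\<close> are algebra maps and \<open>S\<close> is an anti-algebra map, so there is at most one Hopf
  algebra structure with the following values on the generators.\<close>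

definition H_hopf_structure ::
    "('k::field hopf_efuv \<Rightarrow> ('k hopf_efuv \<times> 'k hopf_efuv \<Rightarrow>\<^sub>0 'k)) \<Rightarrow> ('k hopf_efuv \<Rightarrow> 'k)
      \<Rightarrow> ('k hopf_efuv \<Rightarrow> 'k hopf_efuv) \<Rightarrow> bool" where
  "H_hopf_structure \<Delta> \<epsilon> S \<longleftrightarrow> hopf_algebra H_scale \<Delta> \<epsilon> S \<and>
     (\<forall>i. \<Delta> (H_e i) \<approx>\<^sub>\<otimes> fbasis (H_e i, H_e i) + fbasis (H_f i, H_f (- i)) \<and> \<epsilon> (H_e i) = 1 \<and> S (H_e i) = H_e (- i)) \<and>
     (\<forall>i. \<Delta> (H_f i) \<approx>\<^sub>\<otimes> fbasis (H_e i, H_f i) + fbasis (H_f i, H_e (- i)) \<and> \<epsilon> (H_f i) = 0 \<and> S (H_f i) = H_f i) \<and>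
     \<Delta> H_u \<approx>\<^sub>\<otimes> fbasis (1, H_u) + fbasis (H_u, H_e 1) + fbasis (H_v, H_f (- 1)) \<and> \<epsilon> H_u = 0 \<and>
       S H_u = - (H_v * H_f (- 1)) - H_u * H_e (- 1) \<and>
     \<Delta> H_v \<approx>\<^sub>\<otimes> fbasis (1, H_v) + fbasis (H_u, H_f 1) + fbasis (H_v, H_e (- 1)) \<and> \<epsilon> H_v = 0 \<and>
       S H_v = - (H_u * H_f 1) - H_v * H_e 1"

end

theory Submission
  imports Defs
begin

text \<open>The monomials \<open>\<lambda> h\<close> with \<open>\<lambda> \<in> {1, u, v, uv}\<close> and \<open>h \<in> {e\<^sub>i, f\<^sub>i}\<close> span \<open>H\<close>, and they are independent
  because the expected formula for right multiplication on them does satisfy the relations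
  (\<open>free_act_ideal\<close>).  So every function on their indices is a linear functional on \<open>H\<close>, and all
  identities between tensors are tested on functionals (\<open>tensor_eqI_eval\<close>).  Dually, the
  comultiplication becomes an explicit product \<open>conv\<close> of functions on the indices: coassociativity
  is its associativity, multiplicativity is its compatibility with right translation by the
  generators (\<open>gen_act_conv\<close>).  The same compatibility forces every comultiplication with the
  prescribed values on the generators to be dual to \<open>conv\<close> (\<open>H_eval_comult\<close>), so that the two
  remaining claims can be checked for an arbitrary structure.

  Dual Chevalley property.  The \<open>e\<^sub>i\<close>, \<open>f\<^sub>i\<close> span the coordinate ring \<open>H0\<close> of \<open>O(2)\<close>.  The functionals
  dual to \<open>u\<close> and \<open>v\<close> contract \<open>H\<close> towards \<open>H0\<close>, so every nonzero subcoalgebra meets \<open>H0\<close>; there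
  it contains one of the blocks, which are the lines through the group-likes \<open>1\<close> and \<open>e\<^sub>0 - f\<^sub>0\<close> and the
  comatrix coalgebras on \<open>e\<^sub>i, f\<^sub>i, f\<^sub>-\<^sub>i, e\<^sub>-\<^sub>i\<close> (\<open>subcoalgebra_contains_block\<close>).  Hence the blocks are the
  simple subcoalgebras and the coradical is \<open>H0\<close>, a Hopf subalgebra.

  Discrete corepresentation type.  A comodule is a space graded by integral weights with an
  involution \<open>s\<close> that reverses the grading and operators \<open>X\<close> and \<open>Y\<close> that lower and raise weights
  by one, where \<open>X\<^sup>2 = Y\<^sup>2 = 0\<close>, \<open>XY = - YX\<close> and \<open>Xs = sY\<close>: a representation of \<open>O(2)\<close> together with an
  exterior algebra in two variables.  The composition factors determine the weights
  (\<open>weights_dimension_vector\<close>), so it suffices to find finitely many indecomposable representations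
  with weights in a given interval.  Each of these has a basis of bounded size on which
  \<open>s\<close>, \<open>X\<close>, \<open>Y\<close> act by matrices with entries \<open>0, \<plusminus>1\<close> (\<open>indecomposable_monomial_basis\<close>), and the matrices
  determine the representation.

  To find the basis, let \<open>V\<close> be indecomposable.  If \<open>XYm \<noteq> 0\<close> for a weight vector \<open>m\<close>, then \<open>m\<close> and \<open>s m\<close>
  generate a direct summand, because the exterior algebra is a Frobenius algebra.  If \<open>XY = 0\<close>, then
  \<open>V\<close> splits so that \<open>X\<close> and \<open>Y\<close> vanish on the weight spaces of one parity.  The nonnegative weight spaces
  then form a zigzag of type \<open>A\<close>, with arrows leaving the spaces of the other parity.  Read from its
  far end, the zigzag induces a flag \<open>F\<close> in each weight space \<open>V\<^sub>a\<close>, and a vector at a step of the flag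
  extends along the zigzag to a strand whose length depends on the step only (\<open>flag_exists\<close>).  If
  \<open>V\<^sub>0 = 0\<close>, a strand starting at the least positive weight and its mirror image under \<open>s\<close> form a
  summand.  If \<open>V\<^sub>0 \<noteq> 0\<close>, the two flags \<open>F\<close> and \<open>s F\<close> in \<open>V\<^sub>0\<close> are compared, and a vector that is lowest with
  respect to both yields either one strand starting at an eigenvector of \<open>s\<close> or two strands
  exchanged by \<open>s\<close> (\<open>string_case\<close>).\<close>

section \<open>Linear extension and congruences modulo a span\<close>

interpretation pm: vector_space "pm_scale :: 'k::field \<Rightarrow> ('b \<Rightarrow>\<^sub>0 'k) \<Rightarrow> _"
  by (rule vector_space_pm_scale)

interpretation fld: vector_space "(*) :: 'k::field \<Rightarrow> 'k \<Rightarrow> 'k"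
  by standard (simp_all add: algebra_simps)

(* As a simp rule this is the reverse of mult.assoc. *)
declare fld.scale_scale [simp del]

lemma poly_mapping_sum_fbasis:
  assumes "finite F" "Poly_Mapping.keys p \<subseteq> F"
  shows "p = (\<Sum>x\<in>F. pm_scale (Poly_Mapping.lookup p x) (fbasis x))"
proof (rule poly_mapping_eqI)
  fix y
  have "Poly_Mapping.lookup (\<Sum>x\<in>F. pm_scale (Poly_Mapping.lookup p x) (fbasis x)) y
      = (\<Sum>x\<in>F. if x = y then Poly_Mapping.lookup p x else 0)"
    unfolding lookup_sum
    by (rule sum.cong) (auto simp: lookup_pm_scale fbasis_def lookup_single when_def)
  also have "\<dots> = Poly_Mapping.lookup p y"
    using assms by (auto simp: in_keys_iff)
  finally show "Poly_Mapping.lookup p y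
      = Poly_Mapping.lookup (\<Sum>x\<in>F. pm_scale (Poly_Mapping.lookup p x) (fbasis x)) y" ..
qed

context vector_space
begin

lemma lin_ext_superset:
  assumes "finite F" "Poly_Mapping.keys p \<subseteq> F"
  shows "lin_ext scale g p = (\<Sum>x\<in>F. scale (Poly_Mapping.lookup p x) (g x))"
  unfolding lin_ext_def
  by (rule sum.mono_neutral_left) (use assms in \<open>auto simp: in_keys_iff\<close>)

lemma lin_ext_add: "lin_ext scale g (p + q) = lin_ext scale g p + lin_ext scale g q"
proof -
  let ?F = "Poly_Mapping.keys p \<union> Poly_Mapping.keys q"
  have "Poly_Mapping.keys (p + q) \<subseteq> ?F" by (rule Poly_Mapping.keys_add)
  then show ?thesis
    by (simp add: lin_ext_superset[of ?F] lookup_add scale_left_distrib sum.distrib)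
qed

lemma lin_ext_scale: "lin_ext scale g (pm_scale c p) = scale c (lin_ext scale g p)"
proof -
  have "Poly_Mapping.keys (pm_scale c p) \<subseteq> Poly_Mapping.keys p"
    by (auto simp: in_keys_iff lookup_pm_scale)
  then show ?thesis
    by (simp add: lin_ext_superset[of "Poly_Mapping.keys p"] lookup_pm_scale scale_sum_right)
qed

lemma lin_ext_zero [simp]: "lin_ext scale g 0 = 0"
  by (simp add: lin_ext_def)

lemma lin_ext_uminus: "lin_ext scale g (- p) = - lin_ext scale g p"
  using lin_ext_add[of g p "- p"] by (simp add: eq_neg_iff_add_eq_0 add.commute)

lemma lin_ext_diff: "lin_ext scale g (p - q) = lin_ext scale g p - lin_ext scale g q"
  using lin_ext_add[of g p "- q"] by (simp add: lin_ext_uminus)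

lemma lin_ext_sum: "lin_ext scale g (sum f F) = (\<Sum>x\<in>F. lin_ext scale g (f x))"
  by (induction F rule: infinite_finite_induct) (simp_all add: lin_ext_add)

lemma lin_ext_fbasis [simp]: "lin_ext scale g (fbasis x) = g x"
  by (simp add: lin_ext_def fbasis_def)

lemmas lin_ext_simps = lin_ext_add lin_ext_scale lin_ext_uminus lin_ext_diff lin_ext_sum

lemma lin_ext_cong:
  "(\<And>x. x \<in> Poly_Mapping.keys p \<Longrightarrow> g x = h x) \<Longrightarrow> lin_ext scale g p = lin_ext scale h p"
  unfolding lin_ext_def by (rule sum.cong) simp_all

lemma lin_ext_fun_add:
  "lin_ext scale (\<lambda>x. g x + h x) p = lin_ext scale g p + lin_ext scale h p"
  by (simp add: lin_ext_def scale_right_distrib sum.distrib)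

lemma lin_ext_fun_scale:
  "lin_ext scale (\<lambda>x. scale c (g x)) p = scale c (lin_ext scale g p)"
  by (simp add: lin_ext_def scale_sum_right mult.commute)

lemma lin_ext_fun_zero [simp]: "lin_ext scale (\<lambda>x. 0) p = 0"
  by (simp add: lin_ext_def)

lemma lin_ext_fun_sum:
  "lin_ext scale (\<lambda>x. \<Sum>i\<in>I. g i x) p = (\<Sum>i\<in>I. lin_ext scale (g i) p)"
  by (induction I rule: infinite_finite_induct) (simp_all add: lin_ext_fun_add)

lemma lin_ext_in_subspace:
  assumes "subspace W" "\<And>x. x \<in> Poly_Mapping.keys p \<Longrightarrow> g x \<in> W"
  shows "lin_ext scale g p \<in> W"
  unfolding lin_ext_def using assms by (intro subspace_sum subspace_scale)

lemma lin_ext_lin_ext: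
  "lin_ext scale g (lin_ext pm_scale h p) = lin_ext scale (\<lambda>x. lin_ext scale g (h x)) p"
proof -
  have "lin_ext scale g (lin_ext pm_scale h p)
      = (\<Sum>x\<in>Poly_Mapping.keys p. scale (Poly_Mapping.lookup p x) (lin_ext scale g (h x)))"
    unfolding lin_ext_def[of pm_scale h p] by (simp add: lin_ext_sum lin_ext_scale)
  then show ?thesis by (simp add: lin_ext_def[of scale _ p])
qed

lemma lin_ext_in_subspace_of_span:
  assumes "subspace W" "\<And>r. r \<in> R \<Longrightarrow> lin_ext scale g r \<in> W" "p \<in> pm.span R"
  shows "lin_ext scale g p \<in> W"
  using assms(3)
proof (induction rule: pm.span_induct_alt)
  case base
  show ?case using assms(1) by (simp add: subspace_0)
next
  case (step c x y)
  then show ?case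
    using assms by (simp add: lin_ext_add lin_ext_scale subspace_add subspace_scale)
qed

end

lemma linear_lin_ext:
  assumes "vector_space sa" "vector_space sb"
    and "\<And>x y. L (x + y) = L x + L y" "\<And>c x. L (sa c x) = sb c (L x)"
  shows "L (lin_ext sa g p) = lin_ext sb (\<lambda>x. L (g x)) p"
proof -
  interpret A: vector_space sa by fact
  interpret B: vector_space sb by fact
  have "L 0 = 0" using assms(3)[of 0 0] by simp
  then have "L (sum f F) = (\<Sum>x\<in>F. L (f x))" for f and F :: "'d set"
    by (induction F rule: infinite_finite_induct) (simp_all add: assms(3))
  then show ?thesis by (simp add: lin_ext_def assms(4))
qed

lemma lin_ext_field_mult_left: "lin_ext (*) (\<lambda>x. c * g x) p = c * lin_ext (*) g p"
  for c :: "'k::field"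
  by (simp add: fld.lin_ext_fun_scale)

lemma lin_ext_field_mult_right: "lin_ext (*) (\<lambda>x. g x * c) p = lin_ext (*) g p * c"
  for c :: "'k::field"
  using fld.lin_ext_fun_scale[of c g p] by (simp add: mult.commute)

section \<open>Tensor products\<close>

lemma cong_span_lin_ext:
  assumes "\<And>x. x \<in> Poly_Mapping.keys p \<Longrightarrow> g x - h x \<in> pm.span R"
  shows "lin_ext pm_scale g p - lin_ext pm_scale h p \<in> pm.span R"
  unfolding lin_ext_def sum_subtractf[symmetric] pm.scale_right_diff_distrib[symmetric]
  using assms by (intro pm.span_sum pm.span_scale)

lemma lin_ext_fbasis_id: "lin_ext pm_scale fbasis p = (p :: 'b \<Rightarrow>\<^sub>0 'k::field)"
  using poly_mapping_sum_fbasis[of "Poly_Mapping.keys p" p] by (simp add: lin_ext_def)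

context
  fixes sa :: "'k::field \<Rightarrow> 'a::ab_group_add \<Rightarrow> 'a" and A :: "'a set"
    and sb :: "'k \<Rightarrow> 'b::ab_group_add \<Rightarrow> 'b" and B :: "'b set"
begin

lemma tensor_eq_refl [simp]: "tensor_eq sa A sb B p p"
  by (simp add: tensor_eq_def pm.span_zero)

lemma tensor_eq_sym: "tensor_eq sa A sb B p q \<Longrightarrow> tensor_eq sa A sb B q p"
  unfolding tensor_eq_def by (drule pm.span_neg) simp

lemma tensor_eq_trans [trans]:
  "tensor_eq sa A sb B p q \<Longrightarrow> tensor_eq sa A sb B q r \<Longrightarrow> tensor_eq sa A sb B p r"
  unfolding tensor_eq_def by (drule (1) pm.span_add) simp

lemma tensor_eq_add:
  "tensor_eq sa A sb B p q \<Longrightarrow> tensor_eq sa A sb B p' q' \<Longrightarrow> tensor_eq sa A sb B (p + p') (q + q')"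
  unfolding tensor_eq_def by (drule (1) pm.span_add) (simp add: algebra_simps)

lemma tensor_eq_scale:
  "tensor_eq sa A sb B p q \<Longrightarrow> tensor_eq sa A sb B (pm_scale c p) (pm_scale c q)"
  unfolding tensor_eq_def pm.scale_right_diff_distrib[symmetric] by (rule pm.span_scale)

lemma tensor_eq_sum:
  "(\<And>x. x \<in> F \<Longrightarrow> tensor_eq sa A sb B (f x) (g x)) \<Longrightarrow> tensor_eq sa A sb B (sum f F) (sum g F)"
  unfolding tensor_eq_def sum_subtractf[symmetric] by (rule pm.span_sum)

lemma tensor_eq_add_left:
  "a \<in> A \<Longrightarrow> a' \<in> A \<Longrightarrow> b \<in> B \<Longrightarrow>
    tensor_eq sa A sb B (fbasis (a + a', b)) (fbasis (a, b) + fbasis (a', b))"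
  unfolding tensor_eq_def diff_diff_eq[symmetric]
  by (rule pm.span_base) (auto simp: tensor_rels_def)

lemma tensor_eq_add_right:
  "a \<in> A \<Longrightarrow> b \<in> B \<Longrightarrow> b' \<in> B \<Longrightarrow>
    tensor_eq sa A sb B (fbasis (a, b + b')) (fbasis (a, b) + fbasis (a, b'))"
  unfolding tensor_eq_def diff_diff_eq[symmetric]
  by (rule pm.span_base) (auto simp: tensor_rels_def)

lemma tensor_eq_scale_left:
  "a \<in> A \<Longrightarrow> b \<in> B \<Longrightarrow> tensor_eq sa A sb B (fbasis (sa c a, b)) (pm_scale c (fbasis (a, b)))"
  unfolding tensor_eq_def by (rule pm.span_base) (auto simp: tensor_rels_def)

lemma tensor_eq_scale_right:
  "a \<in> A \<Longrightarrow> b \<in> B \<Longrightarrow> tensor_eq sa A sb B (fbasis (a, sb c b)) (pm_scale c (fbasis (a, b)))"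
  unfolding tensor_eq_def by (rule pm.span_base) (auto simp: tensor_rels_def)

text \<open>The universal property of the tensor product, through which equalities of tensors are used.\<close>

lemma tensor_eq_lin_ext:
  assumes "vector_space sc"
    and "\<And>a a' b. a \<in> A \<Longrightarrow> a' \<in> A \<Longrightarrow> b \<in> B \<Longrightarrow> g (a + a', b) = g (a, b) + g (a', b)"
    and "\<And>a b b'. a \<in> A \<Longrightarrow> b \<in> B \<Longrightarrow> b' \<in> B \<Longrightarrow> g (a, b + b') = g (a, b) + g (a, b')"
    and "\<And>c a b. a \<in> A \<Longrightarrow> b \<in> B \<Longrightarrow> g (sa c a, b) = sc c (g (a, b))"
    and "\<And>c a b. a \<in> A \<Longrightarrow> b \<in> B \<Longrightarrow> g (a, sb c b) = sc c (g (a, b))"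
    and "tensor_eq sa A sb B p q"
  shows "lin_ext sc g p = lin_ext sc g q"
proof -
  interpret C: vector_space sc by fact
  have "lin_ext sc g r \<in> {0}" if "r \<in> tensor_rels sa A sb B" for r
    using that unfolding tensor_rels_def Un_iff
    by (elim disjE; clarsimp simp: assms(2-5) C.lin_ext_diff C.lin_ext_scale)
  then have "lin_ext sc g (p - q) \<in> {0}"
    using assms(6) unfolding tensor_eq_def
    by (rule C.lin_ext_in_subspace_of_span[OF C.subspace_single_0])
  then show ?thesis by (simp add: C.lin_ext_diff)
qed

end

lemma tensor_eq_sum_left:
  assumes "vector_space sa" "module.subspace sa A" "b \<in> B"
    and "finite F" "\<And>x. x \<in> F \<Longrightarrow> a x \<in> A" "0 \<in> B"
  shows "tensor_eq sa A sb B (fbasis (\<Sum>x\<in>F. sa (c x) (a x), b)) (\<Sum>x\<in>F. pm_scale (c x) (fbasis (a x, b)))"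
  using assms(4,5)
proof (induction F rule: finite_induct)
  interpret A: vector_space sa by fact
  case empty
  have "tensor_eq sa A sb B (fbasis (sa 0 0, b)) (pm_scale 0 (fbasis (0, b)))"
    by (rule tensor_eq_scale_left) (use assms A.subspace_0 in auto)
  then show ?case by simp
next
  interpret A: vector_space sa by fact
  case (insert x F)
  have "tensor_eq sa A sb B (fbasis (sa (c x) (a x) + (\<Sum>x\<in>F. sa (c x) (a x)), b))
      (fbasis (sa (c x) (a x), b) + fbasis (\<Sum>x\<in>F. sa (c x) (a x), b))"
    using insert.prems assms(2,3)
    by (intro tensor_eq_add_left) (auto intro!: A.subspace_sum A.subspace_scale)
  also have "tensor_eq sa A sb B \<dots> (pm_scale (c x) (fbasis (a x, b)) + (\<Sum>x\<in>F. pm_scale (c x) (fbasis (a x, b))))"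
    using insert assms(3) by (intro tensor_eq_add tensor_eq_scale_left) auto
  finally show ?case using insert.hyps by simp
qed

lemma tensor_eq_sum_right:
  assumes "vector_space sb" "module.subspace sb B" "a \<in> A"
    and "finite F" "\<And>x. x \<in> F \<Longrightarrow> b x \<in> B" "0 \<in> A"
  shows "tensor_eq sa A sb B (fbasis (a, \<Sum>x\<in>F. sb (c x) (b x))) (\<Sum>x\<in>F. pm_scale (c x) (fbasis (a, b x)))"
  using assms(4,5)
proof (induction F rule: finite_induct)
  interpret B: vector_space sb by fact
  case empty
  have "tensor_eq sa A sb B (fbasis (a, sb 0 0)) (pm_scale 0 (fbasis (a, 0)))"
    by (rule tensor_eq_scale_right) (use assms B.subspace_0 in auto)
  then show ?case by simp
next
  interpret B: vector_space sb by fact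
  case (insert x F)
  have "tensor_eq sa A sb B (fbasis (a, sb (c x) (b x) + (\<Sum>x\<in>F. sb (c x) (b x))))
      (fbasis (a, sb (c x) (b x)) + fbasis (a, \<Sum>x\<in>F. sb (c x) (b x)))"
    using insert.prems assms(2,3)
    by (intro tensor_eq_add_right) (auto intro!: B.subspace_sum B.subspace_scale)
  also have "tensor_eq sa A sb B \<dots> (pm_scale (c x) (fbasis (a, b x)) + (\<Sum>x\<in>F. pm_scale (c x) (fbasis (a, b x))))"
    using insert assms(3) by (intro tensor_eq_add tensor_eq_scale_right) auto
  finally show ?case using insert.hyps by simp
qed

text \<open>Expand the second factors in a basis and collect terms: the component at a basis vector \<open>b\<close>
  arises by applying the coordinate functional \<open>\<phi> b\<close> to the second factors.\<close>

lemma tensor_eq_coordinates: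
  fixes sa :: "'k::field \<Rightarrow> 'a::ab_group_add \<Rightarrow> 'a" and sb :: "'k \<Rightarrow> 'b::ab_group_add \<Rightarrow> 'b"
  assumes "vector_space sa" "vector_space sb" "module.subspace sa A"
    and keys: "Poly_Mapping.keys p \<subseteq> A \<times> UNIV" and "finite F"
    and coords: "\<And>m h. (m, h) \<in> Poly_Mapping.keys p \<Longrightarrow> h = (\<Sum>b\<in>F. sb (\<phi> b h) (basis b))"
  shows "tensor_eq sa A sb UNIV p
           (\<Sum>b\<in>F. fbasis (lin_ext sa (\<lambda>(m, h). sa (\<phi> b h) m) p, basis b))"
proof -
  interpret A: vector_space sa by fact
  interpret B: vector_space sb by fact
  let ?K = "Poly_Mapping.keys p" and ?c = "Poly_Mapping.lookup p"
  have "0 \<in> A" using assms(3) by (rule A.subspace_0)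
  have *: "tensor_eq sa A sb UNIV (fbasis x) (\<Sum>b\<in>F. pm_scale (\<phi> b (snd x)) (fbasis (fst x, basis b)))"
    if "x \<in> ?K" for x
  proof -
    obtain m h where x: "x = (m, h)" by (cases x)
    have "tensor_eq sa A sb UNIV (fbasis (m, \<Sum>b\<in>F. sb (\<phi> b h) (basis b)))
       (\<Sum>b\<in>F. pm_scale (\<phi> b h) (fbasis (m, basis b)))"
      using that keys \<open>0 \<in> A\<close> \<open>finite F\<close> x
      by (intro tensor_eq_sum_right B.vector_space_axioms) auto
    then show ?thesis using coords[of m h] that x by simp
  qed
  have "p = (\<Sum>x\<in>?K. pm_scale (?c x) (fbasis x))"
    by (rule poly_mapping_sum_fbasis) auto
  also have "tensor_eq sa A sb UNIV \<dots>
      (\<Sum>x\<in>?K. pm_scale (?c x) (\<Sum>b\<in>F. pm_scale (\<phi> b (snd x)) (fbasis (fst x, basis b))))"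
    by (intro tensor_eq_sum tensor_eq_scale *)
  also have "\<dots> = (\<Sum>b\<in>F. \<Sum>x\<in>?K. pm_scale (?c x * \<phi> b (snd x)) (fbasis (fst x, basis b)))"
    by (simp add: pm.scale_sum_right sum.swap[of _ F])
  also have "tensor_eq sa A sb UNIV \<dots>
      (\<Sum>b\<in>F. fbasis (\<Sum>x\<in>?K. sa (?c x * \<phi> b (snd x)) (fst x), basis b))"
    using assms(1,3) keys by (intro tensor_eq_sum tensor_eq_sum_left[THEN tensor_eq_sym]) auto
  also have "\<dots> = (\<Sum>b\<in>F. fbasis (lin_ext sa (\<lambda>(m, h). sa (\<phi> b h) m) p, basis b))"
    by (simp add: lin_ext_def case_prod_beta)
  finally show ?thesis .
qed

lemma tensor3_eq_lin_ext:
  assumes "vector_space sd"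
    and "\<And>a a' b c. a \<in> A \<Longrightarrow> a' \<in> A \<Longrightarrow> b \<in> B \<Longrightarrow> c \<in> C \<Longrightarrow> g (a + a', b, c) = g (a, b, c) + g (a', b, c)"
    and "\<And>a b b' c. a \<in> A \<Longrightarrow> b \<in> B \<Longrightarrow> b' \<in> B \<Longrightarrow> c \<in> C \<Longrightarrow> g (a, b + b', c) = g (a, b, c) + g (a, b', c)"
    and "\<And>a b c c'. a \<in> A \<Longrightarrow> b \<in> B \<Longrightarrow> c \<in> C \<Longrightarrow> c' \<in> C \<Longrightarrow> g (a, b, c + c') = g (a, b, c) + g (a, b, c')"
    and "\<And>r a b c. a \<in> A \<Longrightarrow> b \<in> B \<Longrightarrow> c \<in> C \<Longrightarrow> g (sa r a, b, c) = sd r (g (a, b, c))"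
    and "\<And>r a b c. a \<in> A \<Longrightarrow> b \<in> B \<Longrightarrow> c \<in> C \<Longrightarrow> g (a, sb r b, c) = sd r (g (a, b, c))"
    and "\<And>r a b c. a \<in> A \<Longrightarrow> b \<in> B \<Longrightarrow> c \<in> C \<Longrightarrow> g (a, b, sc r c) = sd r (g (a, b, c))"
    and "tensor3_eq sa A sb B sc C p q"
  shows "lin_ext sd g p = lin_ext sd g q"
proof -
  interpret D: vector_space sd by fact
  have "lin_ext sd g r \<in> {0}" if "r \<in> tensor3_rels sa A sb B sc C" for r
    using that unfolding tensor3_rels_def Un_iff
    by (elim disjE; clarsimp simp: assms(2-7) D.lin_ext_diff D.lin_ext_scale)
  then have "lin_ext sd g (p - q) \<in> {0}"
    using assms(8) unfolding tensor3_eq_def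
    by (rule D.lin_ext_in_subspace_of_span[OF D.subspace_single_0])
  then show ?thesis by (simp add: D.lin_ext_diff)
qed

section \<open>A basis of \<open>H\<close>\<close>

interpretation H: vector_space "H_scale :: 'k::field \<Rightarrow> 'k hopf_efuv \<Rightarrow> _"
  by (rule vector_space_H_scale)

lemma H_scale_mult_left: "H_scale c x * y = H_scale c (x * y)"
proof (transfer fixing: c)
  fix x y :: "'a free_alg"
  have "pm_scale c x * y = pm_scale c (x * y)" by (simp add: pm_scale_free mult.assoc)
  then show "H_cong (pm_scale c x * y) (pm_scale c (x * y))"
    by (simp add: H_cong_def H_ideal_def two_sided_ideal.zero)
qed

text \<open>Scalars are central in the free algebra because the empty word is neutral on both sides.\<close>

lemma single_0_commute:
  fixes x :: "'k::field free_alg"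
  shows "Poly_Mapping.single 0 c * x = x * Poly_Mapping.single 0 c"
proof -
  have *: "Poly_Mapping.single 0 c * fbasis w = fbasis w * Poly_Mapping.single (0 :: generator list) c" for w
    by (simp add: fbasis_def mult_single)
  obtain F d where x: "x = (\<Sum>w\<in>F. Poly_Mapping.single 0 (d w) * fbasis w)"
    using poly_mapping_sum_fbasis[of "Poly_Mapping.keys x" x] by (auto simp: pm_scale_free)
  have "Poly_Mapping.single 0 c * (\<Sum>w\<in>F. Poly_Mapping.single 0 (d w) * fbasis w)
      = (\<Sum>w\<in>F. Poly_Mapping.single 0 (d w) * fbasis w) * Poly_Mapping.single 0 c"
    for F and d :: "generator list \<Rightarrow> 'k"
  proof -
    have "Poly_Mapping.single 0 c * (Poly_Mapping.single 0 (d w) * fbasis w)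
        = Poly_Mapping.single 0 (d w) * fbasis w * Poly_Mapping.single 0 c" for w
      by (simp add: fbasis_def mult_single mult.commute)
    then show ?thesis by (simp add: sum_distrib_left sum_distrib_right)
  qed
  then show ?thesis unfolding x .
qed

lemma H_scale_mult_right: "x * H_scale c y = H_scale c (x * y)"
proof (transfer fixing: c)
  fix x y :: "'a free_alg"
  have "x * pm_scale c y = pm_scale c (x * y)"
    by (metis pm_scale_free single_0_commute mult.assoc)
  then show "H_cong (x * pm_scale c y) (pm_scale c (x * y))"
    by (simp add: H_cong_def H_ideal_def two_sided_ideal.zero)
qed

lemma H_rel: "(l, r) \<in> H_relations \<Longrightarrow> abs_hopf_efuv l = abs_hopf_efuv r"
  unfolding hopf_efuv.abs_eq_iff H_cong_def H_ideal_def by (rule two_sided_ideal.gen) blast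

definition alt :: "int \<Rightarrow> 'k::field" where "alt i = (if even i then 1 else - 1)"

lemma powi_eq_alt: "(- 1) powi i = (alt i :: 'k::field)"
  by (simp add: alt_def)

lemma alt_add: "alt (i + j) = (alt i * alt j :: 'k::field)"
  and alt_diff: "alt (i - j) = (alt i * alt j :: 'k::field)"
  and alt_minus [simp]: "alt (- i) = (alt i :: 'k::field)"
  and alt_0 [simp]: "alt 0 = (1 :: 'k::field)"
  and alt_1 [simp]: "alt 1 = (- 1 :: 'k::field)"
  and alt_sq [simp]: "alt i * alt i = (1 :: 'k::field)"
  and alt_sq' [simp]: "alt i * (alt i * c) = (c :: 'k::field)"
  by (auto simp: alt_def)

lemma H_one: "(1 :: 'k::field hopf_efuv) = H_e 0 + H_f 0"
  unfolding one_hopf_efuv_def H_e.abs_eq H_f.abs_eq plus_hopf_efuv.abs_eq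
  by (rule H_rel) (simp add: H_relations_def)

lemma H_ee [simp]: "H_e i * H_e j = (H_e (i + j) :: 'k::field hopf_efuv)"
  and H_ff [simp]: "H_f i * H_f j = (H_f (i + j) :: 'k hopf_efuv)"
  and H_ef [simp]: "H_e i * H_f j = (0 :: 'k hopf_efuv)"
  and H_fe [simp]: "H_f i * H_e j = (0 :: 'k hopf_efuv)"
  unfolding zero_hopf_efuv_def H_e.abs_eq H_f.abs_eq times_hopf_efuv.abs_eq
  by (rule H_rel; force simp: H_relations_def)+

lemma H_eu: "H_e i * H_u = H_scale (alt i) (H_u * H_e i :: 'k::field hopf_efuv)"
  and H_fu: "H_f i * H_u = H_scale (alt i) (H_u * H_f i :: 'k hopf_efuv)"
  and H_ev: "H_e i * H_v = H_scale (alt i) (H_v * H_e i :: 'k hopf_efuv)"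
  and H_fv: "H_f i * H_v = H_scale (alt i) (H_v * H_f i :: 'k hopf_efuv)"
  unfolding H_e.abs_eq H_f.abs_eq H_u_def H_v_def times_hopf_efuv.abs_eq H_scale.abs_eq powi_eq_alt[symmetric]
  by (rule H_rel; force simp: H_relations_def)+

lemma H_uu: "H_u * H_u = (0 :: 'k::field hopf_efuv)"
  and H_vv: "H_v * H_v = (0 :: 'k hopf_efuv)"
  and H_vu: "H_v * H_u = - (H_u * H_v :: 'k hopf_efuv)"
proof -
  have "abs_hopf_efuv (free_u * free_v) = abs_hopf_efuv (- (free_v * free_u) :: 'k free_alg)"
    by (rule H_rel) (simp add: H_relations_def)
  then have "H_u * H_v = - (H_v * H_u :: 'k hopf_efuv)"
    unfolding H_u_def H_v_def times_hopf_efuv.abs_eq uminus_hopf_efuv.abs_eq .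
  then show "H_v * H_u = - (H_u * H_v :: 'k hopf_efuv)" by simp
  show "H_u * H_u = (0 :: 'k hopf_efuv)" "H_v * H_v = (0 :: 'k hopf_efuv)"
    unfolding H_u_def H_v_def times_hopf_efuv.abs_eq zero_hopf_efuv_def
    by (rule H_rel; simp add: H_relations_def power2_eq_square)+
qed

subsection \<open>Monomials\<close>

datatype lam = L1 | Lu | Lv | Luv

text \<open>The basis is indexed by an exterior monomial, a colour (\<open>True\<close> for \<open>e\<close>, \<open>False\<close> for \<open>f\<close>)
  and a degree.\<close>

type_synonym idx = "lam \<times> bool \<times> int"

fun H_lam :: "lam \<Rightarrow> 'k::field hopf_efuv" where
  "H_lam L1 = 1" | "H_lam Lu = H_u" | "H_lam Lv = H_v" | "H_lam Luv = H_u * H_v"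

definition H_col :: "bool \<Rightarrow> int \<Rightarrow> 'k::field hopf_efuv" where
  "H_col c i = (if c then H_e i else H_f i)"

fun H_basis :: "idx \<Rightarrow> 'k::field hopf_efuv" where
  "H_basis (l, c, i) = H_lam l * H_col c i"

fun H_gen :: "generator \<Rightarrow> 'k::field hopf_efuv" where
  "H_gen (Gen_e i) = H_e i" | "H_gen (Gen_f i) = H_f i" | "H_gen Gen_u = H_u" | "H_gen Gen_v = H_v"

lemma H_gen_abs: "H_gen g = abs_hopf_efuv (fbasis [g])"
  by (cases g) (simp_all add: H_e.abs_eq H_f.abs_eq H_u_def H_v_def free_e_def free_f_def free_u_def free_v_def)

text \<open>The right regular representation, written down on the indices alone: the independence of the
  monomials is deduced from it.\<close>

fun lam_u :: "lam \<Rightarrow> 'k::field \<times> lam" where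
  "lam_u L1 = (1, Lu)" | "lam_u Lv = (- 1, Luv)" | "lam_u l = (0, l)"

fun lam_v :: "lam \<Rightarrow> 'k::field \<times> lam" where
  "lam_v L1 = (1, Lv)" | "lam_v Lu = (1, Luv)" | "lam_v l = (0, l)"

fun gen_step :: "generator \<Rightarrow> idx \<Rightarrow> 'k::field \<times> idx" where
  "gen_step (Gen_e j) (l, c, i) = (if c then 1 else 0, l, c, i + j)"
| "gen_step (Gen_f j) (l, c, i) = (if c then 0 else 1, l, c, i + j)"
| "gen_step Gen_u (l, c, i) = (alt i * fst (lam_u l), snd (lam_u l :: 'k \<times> lam), c, i)"
| "gen_step Gen_v (l, c, i) = (alt i * fst (lam_v l), snd (lam_v l :: 'k \<times> lam), c, i)"

lemma H_basis_mult_gen: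
  "H_basis b * H_gen g
    = H_scale (fst (gen_step g b)) (H_basis (snd (gen_step g b :: 'k \<times> idx)) :: 'k::field hopf_efuv)"
proof -
  obtain l c i where b: "b = (l, c, i)" by (cases b)
  have uuz: "H_u * (H_u * z) = 0" "H_v * (H_v * z) = 0" "H_v * (H_u * z) = - (H_u * (H_v * z))"
    "H_u * (H_v * (H_u * z)) = 0" for z :: "'k hopf_efuv"
    using arg_cong[OF H_uu, of "\<lambda>x. x * z"] arg_cong[OF H_vv, of "\<lambda>x. x * z"]
      arg_cong[OF H_vu, of "\<lambda>x. x * z"] by (simp_all add: mult.assoc, metis minus_zero mult_minus_right mult_zero_left mult.assoc H_uu)
  show ?thesis
    unfolding b
    by (cases g; cases l)
      (auto simp: H_col_def mult.assoc H_eu H_fu H_ev H_fv H_scale_mult_right uuz)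
qed

text \<open>Generators act on functions on the indices, which are the prospective functionals; no finiteness
  condition is needed there.\<close>

definition gen_act :: "generator \<Rightarrow> (idx \<Rightarrow> 'k::field) \<Rightarrow> idx \<Rightarrow> 'k" where
  "gen_act g c b = fst (gen_step g b) * c (snd (gen_step g b :: 'k \<times> idx))"

lemma gen_act_fun: "gen_act g c = (\<lambda>b. fst (gen_step g b) * c (snd (gen_step g b :: 'k \<times> idx)))"
  for c :: "idx \<Rightarrow> 'k::field"
  by (rule ext) (simp add: gen_act_def)

fun word_act :: "generator list \<Rightarrow> (idx \<Rightarrow> 'k::field) \<Rightarrow> idx \<Rightarrow> 'k" where
  "word_act [] c = c" | "word_act (g # w) c = gen_act g (word_act w c)"

lemma word_act_append: "word_act (w @ w') c = word_act w (word_act w' c)"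
  by (induction w) simp_all

lemma word_act_lin_ext:
  "word_act w (\<lambda>b. lin_ext (*) (\<lambda>x. f x b) p) = (\<lambda>b. lin_ext (*) (\<lambda>x. word_act w (f x) b) p)"
  by (induction w) (simp_all add: gen_act_fun lin_ext_field_mult_left)

definition free_act :: "'k::field free_alg \<Rightarrow> (idx \<Rightarrow> 'k) \<Rightarrow> idx \<Rightarrow> 'k" where
  "free_act p c b = lin_ext (*) (\<lambda>w. word_act w c b) p"

lemma free_act_simps:
  "free_act (p + q) c b = free_act p c b + free_act q c b"
  "free_act (p - q) c b = free_act p c b - free_act q c b"
  "free_act (- p) c b = - free_act p c b"
  "free_act (pm_scale r p) c b = r * free_act p c b"
  "free_act 0 c b = 0"
  "free_act (fbasis w) c b = word_act w c b"
  by (simp_all add: free_act_def fld.lin_ext_simps)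

lemma fbasis_mult: "fbasis w * fbasis w' = (fbasis (w @ w') :: 'k::field free_alg)"
  by (simp add: fbasis_def mult_single plus_list_def)

lemma free_alg_mult_lin_ext:
  "p * q = lin_ext pm_scale (\<lambda>w. lin_ext pm_scale (\<lambda>w'. fbasis (w @ w')) q) (p :: 'k::field free_alg)"
proof -
  have m: "pm_scale r x * y = pm_scale r (x * y)" "x * pm_scale r y = pm_scale r (x * y)"
    for r and x y :: "'k free_alg"
    by (simp add: pm_scale_free mult.assoc) (metis pm_scale_free single_0_commute mult.assoc)
  have "p * q = lin_ext pm_scale fbasis p * q" by (simp add: lin_ext_fbasis_id)
  also have "\<dots> = lin_ext pm_scale (\<lambda>w. fbasis w * q) p"
    by (rule linear_lin_ext) (simp_all add: vector_space_pm_scale distrib_right m)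
  also have "(\<lambda>w. fbasis w * q) = (\<lambda>w. lin_ext pm_scale (\<lambda>w'. fbasis (w @ w')) q)"
  proof
    fix w
    have "fbasis w * q = fbasis w * lin_ext pm_scale fbasis q" by (simp add: lin_ext_fbasis_id)
    also have "\<dots> = lin_ext pm_scale (\<lambda>w'. fbasis w * fbasis w') q"
      by (rule linear_lin_ext) (simp_all add: vector_space_pm_scale distrib_left m)
    finally show "fbasis w * q = lin_ext pm_scale (\<lambda>w'. fbasis (w @ w')) q"
      by (simp add: fbasis_mult)
  qed
  finally show ?thesis .
qed

lemma free_act_mult: "free_act (p * q) c = free_act p (free_act q c)"
proof
  fix b
  have "free_act (p * q) c b = lin_ext (*) (\<lambda>w. lin_ext (*) (\<lambda>w'. word_act w (word_act w' c) b) q) p"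
    unfolding free_act_def free_alg_mult_lin_ext[of p q] by (simp add: fld.lin_ext_lin_ext word_act_append)
  also have "\<dots> = free_act p (free_act q c) b"
    unfolding free_act_def by (simp add: word_act_lin_ext)
  finally show "free_act (p * q) c b = free_act p (free_act q c) b" .
qed

lemma free_act_one: "free_act 1 c = c"
  for c :: "idx \<Rightarrow> 'k::field"
proof -
  have "(1 :: 'k free_alg) = fbasis []" by (simp add: fbasis_def zero_list_def[symmetric])
  then have "free_act 1 c = free_act (fbasis []) c" by (rule arg_cong)
  also have "\<dots> = c" by (rule ext) (simp add: free_act_simps)
  finally show ?thesis .
qed

text \<open>The relations can be verified on the indices.  For \<open>1 = e\<^sub>0 + f\<^sub>0\<close> the reason is that one of
  \<open>e\<^sub>0\<close>, \<open>f\<^sub>0\<close> fixes the monomials of a given colour and the other one kills them.\<close>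

lemma free_act_ideal: "p \<in> H_ideal \<Longrightarrow> free_act p c b = 0"
  for p :: "'k::field free_alg"
  unfolding H_ideal_def
proof (induction arbitrary: c b rule: two_sided_ideal.induct)
  case zero
  then show ?case by (simp add: free_act_simps)
next
  case (gen r)
  obtain l col i where b: "b = (l, col, i)" by (cases b)
  have "free_act x c b = free_act y c b" if "(x, y) \<in> H_relations" for x y
    using that unfolding H_relations_def powi_eq_alt b power2_eq_square
    by (cases l)
      (auto simp: free_e_def free_f_def free_u_def free_v_def free_act_mult free_act_simps free_act_one
         gen_act_def alt_add add.assoc)
  then show ?case using gen by (auto simp: free_act_simps)
next
  case (add x y)
  then show ?case by (simp add: free_act_simps)
next
  case (mult x a d)
  have "free_act x (free_act d c) = (\<lambda>b. 0)" using mult.IH by auto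
  moreover have "free_act a (\<lambda>b. 0) b = 0"
  proof -
    have "word_act w (\<lambda>b. 0 :: 'k) = (\<lambda>b. 0)" for w
      by (induction w) (simp_all add: gen_act_fun)
    then show ?thesis by (simp add: free_act_def)
  qed
  ultimately show ?case by (simp add: free_act_mult)
qed

lift_definition H_act :: "'k::field hopf_efuv \<Rightarrow> (idx \<Rightarrow> 'k) \<Rightarrow> idx \<Rightarrow> 'k" is free_act
  unfolding H_cong_def by (intro ext) (metis free_act_ideal free_act_simps(2) right_minus_eq)

lemma H_act_add: "H_act (x + y) c b = H_act x c b + H_act y c b"
  and H_act_scale: "H_act (H_scale r x) c b = r * H_act x c b"
  by (transfer, simp add: free_act_simps)+

lemma H_act_mult: "H_act (x * y) c = H_act x (H_act y c)"
  by transfer (rule free_act_mult)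

lemma H_act_one: "H_act 1 c = c"
  by transfer (rule free_act_one)

lemma H_act_gen: "H_act (H_gen g) c = gen_act g c"
  unfolding H_gen_abs H_act.abs_eq by (simp add: free_act_simps fun_eq_iff)

lemma H_act_efuv:
  "H_act (H_e i) c = gen_act (Gen_e i) c" "H_act (H_f i) c = gen_act (Gen_f i) c"
  "H_act H_u c = gen_act Gen_u c" "H_act H_v c = gen_act Gen_v c"
  using H_act_gen[of "Gen_e i" c] H_act_gen[of "Gen_f i" c] H_act_gen[of Gen_u c] H_act_gen[of Gen_v c]
  by simp_all

text \<open>Acting on \<open>c\<close> and evaluating at \<open>1 = e\<^sub>0 + f\<^sub>0\<close> gives the functional that takes the values \<open>c\<close> on
  the monomials.\<close>

definition H_fun :: "(idx \<Rightarrow> 'k) \<Rightarrow> 'k::field hopf_efuv \<Rightarrow> 'k" where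
  "H_fun c x = H_act x c (L1, True, 0) + H_act x c (L1, False, 0)"

lemma H_fun_add [simp]: "H_fun c (x + y) = H_fun c x + H_fun c y"
  and H_fun_scale [simp]: "H_fun c (H_scale r x) = r * H_fun c x"
  by (simp_all add: H_fun_def H_act_add H_act_scale algebra_simps)

lemma H_fun_zero [simp]: "H_fun c 0 = 0"
  using H_fun_scale[of c 0 0] by simp

lemma H_fun_minus [simp]: "H_fun c (- x) = - H_fun c x"
  using H_fun_add[of c x "- x"] by (simp add: eq_neg_iff_add_eq_0 add.commute)

lemma H_fun_diff [simp]: "H_fun c (x - y) = H_fun c x - H_fun c y"
  using H_fun_add[of c x "- y"] by simp

lemma H_fun_sum: "H_fun c (sum f F) = (\<Sum>x\<in>F. H_fun c (f x))"
  by (induction F rule: infinite_finite_induct) simp_all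

lemma H_fun_basis [simp]: "H_fun c (H_basis b) = c b"
proof -
  obtain l col i where b: "b = (l, col, i)" by (cases b)
  show ?thesis unfolding b
    by (cases l; cases col) (simp_all add: H_fun_def H_col_def H_act_mult H_act_one H_act_efuv gen_act_def)
qed

declare H_basis.simps [simp del]

lemma H_fun_mult_gen: "H_fun c (x * H_gen g) = H_fun (gen_act g c) x"
  by (simp add: H_fun_def H_act_mult H_act_gen)

lemma H_fun_one: "H_fun c 1 = c (L1, True, 0) + c (L1, False, 0)"
  by (simp add: H_fun_def H_act_one)

lemma H_one_basis: "1 = H_basis (L1, True, 0) + (H_basis (L1, False, 0) :: 'k::field hopf_efuv)"
  by (simp add: H_basis.simps H_col_def H_one[symmetric])

subsection \<open>Spanning\<close>

text \<open>Right multiplication by generators reaches all of \<open>H\<close> from \<open>1\<close>; this is the induction that fits the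
  recursive behaviour of functionals in \<open>H_fun_mult_gen\<close>.\<close>

lemma H_induct [consumes 0, case_names add scale one gen]:
  fixes P :: "'k::field hopf_efuv \<Rightarrow> bool"
  assumes add: "\<And>x y. P x \<Longrightarrow> P y \<Longrightarrow> P (x + y)" and scale: "\<And>c x. P x \<Longrightarrow> P (H_scale c x)"
    and one: "P 1" and gen: "\<And>x g. P x \<Longrightarrow> P (x * H_gen g)"
  shows "P x"
proof -
  have w: "P (abs_hopf_efuv (fbasis w))" for w
  proof (induction w rule: rev_induct)
    case Nil
    have "(1 :: 'k free_alg) = fbasis []" by (simp add: fbasis_def zero_list_def[symmetric])
    then show ?case using one by (simp add: one_hopf_efuv_def)
  next
    case (snoc g w)
    then have "P (abs_hopf_efuv (fbasis w) * H_gen g)" by (rule gen)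
    then show ?case by (simp add: H_gen_abs times_hopf_efuv.abs_eq fbasis_mult)
  qed
  have zero: "P 0" using scale[OF one, of 0] by simp
  have "P (abs_hopf_efuv (\<Sum>w\<in>F. pm_scale (c w) (fbasis w)))" if "finite F" for F and c :: "_ \<Rightarrow> 'k"
    using that
  proof (induction F rule: finite_induct)
    case empty
    then show ?case using zero by (simp add: zero_hopf_efuv_def)
  next
    case (insert v F)
    have "P (H_scale (c v) (abs_hopf_efuv (fbasis v)) + abs_hopf_efuv (\<Sum>w\<in>F. pm_scale (c w) (fbasis w)))"
      by (intro add scale w insert.IH)
    then show ?case using insert.hyps by (simp add: H_scale.abs_eq plus_hopf_efuv.abs_eq)
  qed
  moreover have "x = abs_hopf_efuv (rep_hopf_efuv x)"
    by (simp add: Quotient3_abs_rep[OF Quotient3_hopf_efuv])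
  moreover have "P (abs_hopf_efuv (rep_hopf_efuv x))"
    by (subst poly_mapping_sum_fbasis[of "Poly_Mapping.keys (rep_hopf_efuv x)"]) (simp_all add: calculation(1))
  ultimately show ?thesis by simp
qed

definition H_coord :: "idx \<Rightarrow> 'k::field hopf_efuv \<Rightarrow> 'k" where
  "H_coord b = H_fun (\<lambda>b'. if b' = b then 1 else 0)"

lemma H_coord_simps [simp]:
  "H_coord b (x + y) = H_coord b x + H_coord b y" "H_coord b (H_scale c x) = c * H_coord b x"
  "H_coord b 0 = 0" "H_coord b (H_basis b') = (if b' = b then 1 else 0)"
  by (simp_all add: H_coord_def)

definition H_supp :: "'k::field hopf_efuv \<Rightarrow> idx set" where
  "H_supp x = {b. H_coord b x \<noteq> 0}"

text \<open>The span of the monomials contains \<open>1\<close> and is stable under right multiplication by generators.\<close>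

lemma H_expand_aux: "\<exists>F c. finite F \<and> x = (\<Sum>b\<in>F. H_scale (c b) (H_basis b :: 'k::field hopf_efuv))"
proof -
  let ?B = "range (H_basis :: idx \<Rightarrow> 'k hopf_efuv)"
  have gen: "x * H_gen g \<in> H.span ?B" if "x \<in> H.span ?B" for x g
    using that
  proof (induction rule: H.span_induct_alt)
    case base
    then show ?case by (simp add: H.span_zero)
  next
    case (step c y z)
    then show ?case
      by (auto simp: distrib_right H_scale_mult_left H_basis_mult_gen H.span_base intro!: H.span_add H.span_scale)
  qed
  have "x \<in> H.span ?B"
  proof (induction x rule: H_induct)
    case one
    show ?case unfolding H_one_basis by (intro H.span_add H.span_base) auto
  qed (auto intro: H.span_add H.span_scale gen)
  then obtain t r where t: "finite t" "t \<subseteq> ?B" "x = (\<Sum>a\<in>t. H_scale (r a) a)"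
    by (auto simp: H.span_explicit)
  obtain F where F: "finite F" "t = H_basis ` F" "inj_on (H_basis :: idx \<Rightarrow> 'k hopf_efuv) F"
    using t(1,2) by (auto simp: subset_image_inj dest: finite_imageD)
  have "x = (\<Sum>b\<in>F. H_scale (r (H_basis b)) (H_basis b))"
    unfolding t(3) F(2) by (simp add: sum.reindex[OF F(3)])
  then show ?thesis using F(1) by (intro exI[of _ F] exI[of _ "\<lambda>b. r (H_basis b)"]) simp
qed

lemma finite_H_supp [simp]: "finite (H_supp x)"
  and H_expand: "finite F \<Longrightarrow> H_supp x \<subseteq> F \<Longrightarrow> x = (\<Sum>b\<in>F. H_scale (H_coord b x) (H_basis b))"
proof -
  obtain G c where G: "finite G" "x = (\<Sum>b\<in>G. H_scale (c b) (H_basis b))"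
    using H_expand_aux by blast
  have c: "H_coord b x = (if b \<in> G then c b else 0)" for b
    unfolding G(2) H_coord_def H_fun_sum using G(1) by (simp add: if_distrib sum.delta cong: if_cong)
  have sub: "H_supp x \<subseteq> G" by (auto simp: H_supp_def c)
  then show "finite (H_supp x)" using G(1) finite_subset by blast
  have "x = (\<Sum>b\<in>G. H_scale (H_coord b x) (H_basis b))"
    by (subst G(2), rule sum.cong) (simp_all add: c)
  also have "\<dots> = (\<Sum>b\<in>H_supp x. H_scale (H_coord b x) (H_basis b))"
    using G(1) sub by (intro sum.mono_neutral_right) (auto simp: H_supp_def)
  finally have "x = (\<Sum>b\<in>H_supp x. H_scale (H_coord b x) (H_basis b))" .
  moreover assume "finite F" "H_supp x \<subseteq> F"
  then have "(\<Sum>b\<in>F. H_scale (H_coord b x) (H_basis b)) = (\<Sum>b\<in>H_supp x. H_scale (H_coord b x) (H_basis b))"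
    by (intro sum.mono_neutral_right) (auto simp: H_supp_def)
  ultimately show "x = (\<Sum>b\<in>F. H_scale (H_coord b x) (H_basis b))" by simp
qed

lemma H_linear_eqI:
  assumes "vector_space sc"
    and "\<And>x y. f (x + y) = f x + f y" "\<And>c x. f (H_scale c x) = sc c (f x)"
    and "\<And>x y. g (x + y) = g x + g y" "\<And>c x. g (H_scale c x) = sc c (g x)"
    and "\<And>b. f (H_basis b) = g (H_basis b)"
  shows "f (x :: 'k::field hopf_efuv) = g x"
proof -
  interpret C: vector_space sc by fact
  have "f 0 = 0" "g 0 = 0" using assms(3)[of 0 0] assms(5)[of 0 0] by simp_all
  then have "f (sum h F) = (\<Sum>b\<in>F. f (h b))" "g (sum h F) = (\<Sum>b\<in>F. g (h b))" for h and F :: "idx set"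
    by (induction F rule: infinite_finite_induct) (simp_all add: assms(2,4))
  then have "f (\<Sum>b\<in>H_supp x. H_scale (H_coord b x) (H_basis b)) = g (\<Sum>b\<in>H_supp x. H_scale (H_coord b x) (H_basis b))"
    by (simp add: assms(3,5,6))
  then show ?thesis using H_expand[of "H_supp x" x] by simp
qed

text \<open>The functionals defined by functions on the indices separate points and, by
  \<open>H_functional_eq\<close> below, exhaust the dual space.\<close>

lemma H_fun_eqI: "(\<And>c. H_fun c x = H_fun c y) \<Longrightarrow> x = y"
  using H_expand[of "H_supp x \<union> H_supp y" x] H_expand[of "H_supp x \<union> H_supp y" y]
  by (simp add: H_coord_def)

definition H_functional :: "('k::field hopf_efuv \<Rightarrow> 'k) \<Rightarrow> bool" where
  "H_functional \<psi> \<longleftrightarrow> (\<forall>x y. \<psi> (x + y) = \<psi> x + \<psi> y) \<and> (\<forall>c x. \<psi> (H_scale c x) = c * \<psi> x)"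

lemma H_functional_H_fun [simp]: "H_functional (H_fun c)"
  by (simp add: H_functional_def)

lemma H_functional_eq: "H_functional \<psi> \<Longrightarrow> \<psi> = H_fun (\<lambda>b. \<psi> (H_basis b))"
  by (rule ext, rule H_linear_eqI[OF fld.vector_space_axioms]) (simp_all add: H_functional_def)

section \<open>Evaluating tensors on functionals\<close>

text \<open>As the monomials are a basis of the second factor, equality in \<open>V \<otimes> H\<close> can be tested on
  coordinates.  The ambient space \<open>V\<close> stays arbitrary, so the criterion applies to comodules, too.\<close>

lemma tensor_eq_coordI:
  fixes sm :: "'k::field \<Rightarrow> 'm::ab_group_add \<Rightarrow> 'm"
  assumes "vector_space sm" "module.subspace sm V"
    and "Poly_Mapping.keys p \<subseteq> V \<times> UNIV" "Poly_Mapping.keys q \<subseteq> V \<times> UNIV"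
    and "\<And>b. lin_ext sm (\<lambda>(m, h). sm (H_coord b h) m) p = lin_ext sm (\<lambda>(m, h). sm (H_coord b h) m) q"
  shows "tensor_eq sm V H_scale UNIV p q"
proof -
  define F where "F = (\<Union>(m, h)\<in>Poly_Mapping.keys p \<union> Poly_Mapping.keys q. H_supp h)"
  have F: "finite F" by (auto simp: F_def)
  have sub: "h = (\<Sum>b\<in>F. H_scale (H_coord b h) (H_basis b))"
    if "(m, h) \<in> Poly_Mapping.keys p \<union> Poly_Mapping.keys q" for m h
    using F that by (intro H_expand) (auto simp: F_def)
  have "tensor_eq sm V H_scale UNIV p
      (\<Sum>b\<in>F. fbasis (lin_ext sm (\<lambda>(m, h). sm (H_coord b h) m) p, H_basis b))"
    by (rule tensor_eq_coordinates[OF assms(1) H.vector_space_axioms assms(2,3) F]) (erule sub[OF UnI1])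
  moreover have "tensor_eq sm V H_scale UNIV q
      (\<Sum>b\<in>F. fbasis (lin_ext sm (\<lambda>(m, h). sm (H_coord b h) m) q, H_basis b))"
    by (rule tensor_eq_coordinates[OF assms(1) H.vector_space_axioms assms(2,4) F]) (erule sub[OF UnI2])
  ultimately show ?thesis
    using assms(5) by (metis (no_types, lifting) sum.cong tensor_eq_sym tensor_eq_trans)
qed

definition H_eval :: "('k::field hopf_efuv \<Rightarrow> 'k) \<Rightarrow> ('k hopf_efuv \<Rightarrow> 'k)
    \<Rightarrow> ('k hopf_efuv \<times> 'k hopf_efuv \<Rightarrow>\<^sub>0 'k) \<Rightarrow> 'k" where
  "H_eval \<psi> \<psi>' = lin_ext (*) (\<lambda>(a, b). \<psi> a * \<psi>' b)"

lemma H_eval_simps [simp]: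
  "H_eval \<psi> \<psi>' (p + q) = H_eval \<psi> \<psi>' p + H_eval \<psi> \<psi>' q"
  "H_eval \<psi> \<psi>' (pm_scale c p) = c * H_eval \<psi> \<psi>' p"
  "H_eval \<psi> \<psi>' (fbasis (a, b)) = \<psi> a * \<psi>' b"
  "H_eval \<psi> \<psi>' 0 = 0"
  "H_eval \<psi> \<psi>' (sum f F) = (\<Sum>x\<in>F. H_eval \<psi> \<psi>' (f x))"
  by (simp_all add: H_eval_def fld.lin_ext_simps)

lemma H_functionalD:
  assumes "H_functional \<psi>" shows "\<psi> (x + y) = \<psi> x + \<psi> y" "\<psi> (H_scale c x) = c * \<psi> x"
  using assms by (simp_all add: H_functional_def)

lemma H_functional_mult_left: "H_functional \<psi> \<Longrightarrow> H_functional (\<lambda>x. \<psi> (a * x))"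
  by (simp add: H_functional_def distrib_left H_scale_mult_right)

lemma H_eval_cong:
  assumes "p \<approx>\<^sub>\<otimes> q" "H_functional \<psi>" "H_functional \<psi>'"
  shows "H_eval \<psi> \<psi>' p = H_eval \<psi> \<psi>' q"
  unfolding H_eval_def
  by (rule tensor_eq_lin_ext[OF fld.vector_space_axioms _ _ _ _ assms(1)])
    (simp_all add: H_functionalD[OF assms(2)] H_functionalD[OF assms(3)] distrib_left distrib_right)

text \<open>Pairs of functionals separate the elements of \<open>H \<otimes> H\<close>, so identities between tensors reduce to
  identities in the field.\<close>

lemma tensor_eqI_eval:
  assumes "\<And>c c'. H_eval (H_fun c) (H_fun c') p = H_eval (H_fun c) (H_fun c') q"
  shows "p \<approx>\<^sub>\<otimes> q"
proof (rule tensor_eq_coordI)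
  fix b :: idx
  have *: "H_fun c (lin_ext H_scale (\<lambda>(m, h). H_scale (H_coord b h) m) p) = H_eval (H_fun c) (H_coord b) p"
    for c and p :: "'a hopf_efuv \<times> 'a hopf_efuv \<Rightarrow>\<^sub>0 'a"
    unfolding H_eval_def
    by (subst linear_lin_ext[where L = "H_fun c", OF H.vector_space_axioms fld.vector_space_axioms H_fun_add H_fun_scale])
      (simp add: case_prod_unfold mult.commute)
  show "lin_ext H_scale (\<lambda>(m, h). H_scale (H_coord b h) m) p = lin_ext H_scale (\<lambda>(m, h). H_scale (H_coord b h) m) q"
    using assms by (intro H_fun_eqI) (simp add: *, simp add: H_coord_def)
qed (auto simp: H.vector_space_axioms)

section \<open>Convolution of functionals\<close>

text \<open>The terms (coefficient, left factor, right factor) of the comultiplication of a monomial, which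
  result from multiplying out the values on the generators and moving \<open>u\<close>, \<open>v\<close> to the left.\<close>

fun comult_terms :: "idx \<Rightarrow> ('k::field \<times> idx \<times> idx) list" where
  "comult_terms (L1, c, k) = [(1, (L1, True, k), (L1, c, k)), (1, (L1, False, k), (L1, \<not> c, - k))]"
| "comult_terms (Lu, True, k) = [(1, (L1, True, k), (Lu, True, k)), (1, (L1, False, k), (Lu, False, - k)),
    (1, (Lu, True, k), (L1, True, k + 1)), (1, (Lv, False, k), (L1, False, - k - 1))]"
| "comult_terms (Lu, False, k) = [(1, (L1, True, k), (Lu, False, k)), (1, (L1, False, k), (Lu, True, - k)),
    (1, (Lu, False, k), (L1, True, 1 - k)), (1, (Lv, True, k), (L1, False, k - 1))]"
| "comult_terms (Lv, True, k) = [(1, (L1, True, k), (Lv, True, k)), (1, (L1, False, k), (Lv, False, - k)),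
    (1, (Lu, False, k), (L1, False, 1 - k)), (1, (Lv, True, k), (L1, True, k - 1))]"
| "comult_terms (Lv, False, k) = [(1, (L1, True, k), (Lv, False, k)), (1, (L1, False, k), (Lv, True, - k)),
    (1, (Lu, True, k), (L1, False, k + 1)), (1, (Lv, False, k), (L1, True, - k - 1))]"
| "comult_terms (Luv, True, k) = [(1, (L1, True, k), (Luv, True, k)), (1, (L1, False, k), (Luv, False, - k)),
    (1, (Lu, False, k), (Lu, False, 1 - k)), (1, (Lv, True, k), (Lu, True, k - 1)),
    (- 1, (Lu, True, k), (Lv, True, k + 1)), (- 1, (Lv, False, k), (Lv, False, - k - 1)),
    (1, (Luv, True, k), (L1, True, k)), (- 1, (Luv, False, k), (L1, False, - k))]"
| "comult_terms (Luv, False, k) = [(1, (L1, True, k), (Luv, False, k)), (1, (L1, False, k), (Luv, True, - k)),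
    (1, (Lu, True, k), (Lu, False, k + 1)), (1, (Lv, False, k), (Lu, True, - k - 1)),
    (- 1, (Lu, False, k), (Lv, True, 1 - k)), (- 1, (Lv, True, k), (Lv, False, k - 1)),
    (1, (Luv, False, k), (L1, True, - k)), (- 1, (Luv, True, k), (L1, False, k))]"

text \<open>The product of the dual algebra of \<open>H\<close>.\<close>

definition conv :: "(idx \<Rightarrow> 'k) \<Rightarrow> (idx \<Rightarrow> 'k) \<Rightarrow> idx \<Rightarrow> 'k::field" where
  "conv c c' b = (\<Sum>(s, i, j)\<leftarrow>comult_terms b. s * (c i * c' j))"

lemma conv_simps:
  "conv c c' (L1, col, k) = c (L1, True, k) * c' (L1, col, k) + c (L1, False, k) * c' (L1, \<not> col, - k)"
  "conv c c' (Lu, True, k) = c (L1, True, k) * c' (Lu, True, k) + c (L1, False, k) * c' (Lu, False, - k)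
    + c (Lu, True, k) * c' (L1, True, k + 1) + c (Lv, False, k) * c' (L1, False, - k - 1)"
  "conv c c' (Lu, False, k) = c (L1, True, k) * c' (Lu, False, k) + c (L1, False, k) * c' (Lu, True, - k)
    + c (Lu, False, k) * c' (L1, True, 1 - k) + c (Lv, True, k) * c' (L1, False, k - 1)"
  "conv c c' (Lv, True, k) = c (L1, True, k) * c' (Lv, True, k) + c (L1, False, k) * c' (Lv, False, - k)
    + c (Lu, False, k) * c' (L1, False, 1 - k) + c (Lv, True, k) * c' (L1, True, k - 1)"
  "conv c c' (Lv, False, k) = c (L1, True, k) * c' (Lv, False, k) + c (L1, False, k) * c' (Lv, True, - k)
    + c (Lu, True, k) * c' (L1, False, k + 1) + c (Lv, False, k) * c' (L1, True, - k - 1)"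
  "conv c c' (Luv, True, k) = c (L1, True, k) * c' (Luv, True, k) + c (L1, False, k) * c' (Luv, False, - k)
    + c (Lu, False, k) * c' (Lu, False, 1 - k) + c (Lv, True, k) * c' (Lu, True, k - 1)
    - c (Lu, True, k) * c' (Lv, True, k + 1) - c (Lv, False, k) * c' (Lv, False, - k - 1)
    + c (Luv, True, k) * c' (L1, True, k) - c (Luv, False, k) * c' (L1, False, - k)"
  "conv c c' (Luv, False, k) = c (L1, True, k) * c' (Luv, False, k) + c (L1, False, k) * c' (Luv, True, - k)
    + c (Lu, True, k) * c' (Lu, False, k + 1) + c (Lv, False, k) * c' (Lu, True, - k - 1)
    - c (Lu, False, k) * c' (Lv, True, 1 - k) - c (Lv, True, k) * c' (Lv, False, k - 1)
    + c (Luv, False, k) * c' (L1, True, - k) - c (Luv, True, k) * c' (L1, False, k)"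
  by (simp_all add: conv_def)

lemma idx_cases:
  obtains k col where "b = (L1, col, k)" | k where "b = (Lu, True, k)" | k where "b = (Lu, False, k)"
  | k where "b = (Lv, True, k)" | k where "b = (Lv, False, k)"
  | k where "b = (Luv, True, k)" | k where "b = (Luv, False, k :: int)"
  by (metis (full_types) lam.exhaust prod_cases3)

text \<open>Coassociativity, in its dual form.\<close>

lemma conv_assoc: "conv (conv c c') c'' = conv c (conv c' c'')"
proof
  fix b show "conv (conv c c') c'' b = conv c (conv c' c'') b"
    by (cases b rule: idx_cases) (simp_all add: conv_simps algebra_simps)
qed

definition conv_unit :: "idx \<Rightarrow> 'k::field" where
  "conv_unit = (\<lambda>(l, c, k). if l = L1 \<and> c then 1 else 0)"

lemma conv_unit_left: "conv conv_unit c = c" and conv_unit_right: "conv c conv_unit = c"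
proof -
  show "conv conv_unit c = c"
    by (rule ext, case_tac x rule: idx_cases) (simp_all add: conv_simps conv_unit_def)
  show "conv c conv_unit = c"
    by (rule ext, case_tac x rule: idx_cases) (auto simp: conv_simps conv_unit_def)
qed

text \<open>Pairs of words, not of generators, because the tensor factor \<open>1\<close> occurs.\<close>

fun gen_terms :: "generator \<Rightarrow> (generator list \<times> generator list) list" where
  "gen_terms (Gen_e i) = [([Gen_e i], [Gen_e i]), ([Gen_f i], [Gen_f (- i)])]"
| "gen_terms (Gen_f i) = [([Gen_e i], [Gen_f i]), ([Gen_f i], [Gen_e (- i)])]"
| "gen_terms Gen_u = [([], [Gen_u]), ([Gen_u], [Gen_e 1]), ([Gen_v], [Gen_f (- 1)])]"
| "gen_terms Gen_v = [([], [Gen_v]), ([Gen_u], [Gen_f 1]), ([Gen_v], [Gen_e (- 1)])]"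

text \<open>Multiplicativity of the comultiplication, in its dual form: right translation by a generator
  acts on a convolution product through the comultiplication of the generator.\<close>

lemma gen_act_conv:
  "gen_act g (conv c c') b = (\<Sum>(w, w')\<leftarrow>gen_terms g. conv (word_act w c) (word_act w' c') b)"
  by (cases b rule: idx_cases; cases g)
    (auto simp: gen_act_def conv_simps alt_add alt_diff algebra_simps)

definition H_word :: "generator list \<Rightarrow> 'k::field hopf_efuv" where
  "H_word w = prod_list (map H_gen w)"

lemma H_fun_mult_word: "H_fun c (x * H_word w) = H_fun (word_act w c) x"
  by (induction w arbitrary: x) (simp_all add: H_word_def H_fun_mult_gen mult.assoc[symmetric])

definition H_delta :: "generator \<Rightarrow> ('k::field hopf_efuv \<times> 'k hopf_efuv \<Rightarrow>\<^sub>0 'k)" where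
  "H_delta g = (\<Sum>(w, w')\<leftarrow>gen_terms g. fbasis (H_word w, H_word w'))"

lemma H_eval_sum_list: "H_eval \<psi> \<psi>' (sum_list ps) = (\<Sum>p\<leftarrow>ps. H_eval \<psi> \<psi>' p)"
  by (induction ps) simp_all

lemma H_eval_tensor_mult:
  "H_eval \<psi> \<psi>' (tensor_mult p q) = lin_ext (*) (\<lambda>(a, b). H_eval (\<lambda>x. \<psi> (a * x)) (\<lambda>x. \<psi>' (b * x)) q) p"
  unfolding H_eval_def tensor_mult_def fld.lin_ext_lin_ext
  by (rule fld.lin_ext_cong) (simp add: fld.lin_ext_lin_ext case_prod_unfold)

lemma H_eval_tensor_mult_right:
  assumes "q \<approx>\<^sub>\<otimes> q'" "H_functional \<psi>" "H_functional \<psi>'"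
  shows "H_eval \<psi> \<psi>' (tensor_mult p q) = H_eval \<psi> \<psi>' (tensor_mult p q')"
  unfolding H_eval_tensor_mult
  by (intro fld.lin_ext_cong) (auto intro!: H_eval_cong[OF assms(1)] H_functional_mult_left assms(2,3))

lemma H_eval_mult_delta:
  "H_eval (H_fun c) (H_fun c') (tensor_mult p (H_delta g))
    = (\<Sum>(w, w')\<leftarrow>gen_terms g. H_eval (H_fun (word_act w c)) (H_fun (word_act w' c')) p)"
proof -
  have *: "lin_ext (*) (\<lambda>x. \<Sum>t\<leftarrow>ts. f t x) p = (\<Sum>t\<leftarrow>ts. lin_ext (*) (f t) p)"
    for ts :: "(generator list \<times> generator list) list" and f :: "_ \<Rightarrow> _ \<Rightarrow> 'a"
    by (induction ts) (simp_all add: fld.lin_ext_fun_add)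
  show ?thesis
    unfolding H_eval_tensor_mult H_delta_def
    by (simp add: H_eval_sum_list case_prod_unfold o_def H_fun_mult_word *)
      (simp add: H_eval_def case_prod_unfold)
qed

lemma H_fun_sum_fun: "H_fun (\<lambda>b. \<Sum>t\<leftarrow>ts. f t b) x = (\<Sum>t\<leftarrow>ts. H_fun (f t) x)"
proof (rule H_linear_eqI[OF fld.vector_space_axioms, of "\<lambda>x. H_fun (\<lambda>b. \<Sum>t\<leftarrow>ts. f t b) x"])
  show "(\<Sum>t\<leftarrow>ts. H_fun (f t) (x + y)) = (\<Sum>t\<leftarrow>ts. H_fun (f t) x) + (\<Sum>t\<leftarrow>ts. H_fun (f t) y)" for x y
    by (simp add: sum_list_addf)
  show "(\<Sum>t\<leftarrow>ts. H_fun (f t) (H_scale c x)) = c * (\<Sum>t\<leftarrow>ts. H_fun (f t) x)" for c x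
    by (simp add: sum_list_const_mult)
qed simp_all

lemma H_fun_conv_gen:
  "H_fun (conv c c') (x * H_gen g)
    = (\<Sum>(w, w')\<leftarrow>gen_terms g. H_fun (conv (word_act w c) (word_act w' c')) x)"
proof -
  have "gen_act g (conv c c') = (\<lambda>b. \<Sum>t\<leftarrow>gen_terms g. conv (word_act (fst t) c) (word_act (snd t) c') b)"
    by (rule ext) (simp add: gen_act_conv case_prod_unfold)
  then show ?thesis by (simp add: H_fun_mult_gen H_fun_sum_fun case_prod_unfold)
qed

lemma H_fun_conv_one: "H_fun (conv c c') 1 = H_fun c 1 * H_fun c' 1"
  by (simp add: H_fun_one conv_simps algebra_simps)

text \<open>Both sides obey the same recursion under right multiplication by a generator, so the values on
  the generators leave no freedom.\<close>

lemma H_eval_comult: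
  fixes \<Delta> :: "'k::field hopf_efuv \<Rightarrow> ('k hopf_efuv \<times> 'k hopf_efuv \<Rightarrow>\<^sub>0 'k)"
  assumes "\<And>x y. \<Delta> (x + y) \<approx>\<^sub>\<otimes> \<Delta> x + \<Delta> y" "\<And>c x. \<Delta> (H_scale c x) \<approx>\<^sub>\<otimes> pm_scale c (\<Delta> x)"
    and "\<And>x y. \<Delta> (x * y) \<approx>\<^sub>\<otimes> tensor_mult (\<Delta> x) (\<Delta> y)" "\<Delta> 1 \<approx>\<^sub>\<otimes> fbasis (1, 1)"
    and "\<And>g. \<Delta> (H_gen g) \<approx>\<^sub>\<otimes> H_delta g"
  shows "H_eval (H_fun c) (H_fun c') (\<Delta> x) = H_fun (conv c c') x"
proof (induction x arbitrary: c c' rule: H_induct)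
  case (add x y)
  then show ?case by (simp add: H_eval_cong[OF assms(1)])
next
  case (scale r x)
  then show ?case by (simp add: H_eval_cong[OF assms(2)])
next
  case one
  then show ?case by (simp add: H_eval_cong[OF assms(4)] H_fun_conv_one)
next
  case (gen x g)
  have "H_eval (H_fun c) (H_fun c') (\<Delta> (x * H_gen g)) = H_eval (H_fun c) (H_fun c') (tensor_mult (\<Delta> x) (H_delta g))"
    by (simp add: H_eval_cong[OF assms(3)] H_eval_tensor_mult_right[OF assms(5)])
  then show ?case by (simp add: H_eval_mult_delta H_fun_conv_gen gen.IH)
qed

section \<open>The Hopf algebra structure\<close>

definition lin_H :: "('k::field \<Rightarrow> 'w::ab_group_add \<Rightarrow> 'w) \<Rightarrow> (idx \<Rightarrow> 'w) \<Rightarrow> 'k hopf_efuv \<Rightarrow> 'w" where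
  "lin_H sc f x = (\<Sum>b\<in>H_supp x. sc (H_coord b x) (f b))"

context vector_space
begin

lemma lin_H_superset: "finite F \<Longrightarrow> H_supp x \<subseteq> F \<Longrightarrow> lin_H scale f x = (\<Sum>b\<in>F. scale (H_coord b x) (f b))"
  unfolding lin_H_def by (rule sum.mono_neutral_left) (auto simp: H_supp_def)

lemma lin_H_add: "lin_H scale f (x + y) = lin_H scale f x + lin_H scale f y"
proof -
  have "H_supp (x + y) \<subseteq> H_supp x \<union> H_supp y" by (auto simp: H_supp_def)
  then show ?thesis
    by (simp add: lin_H_superset[of "H_supp x \<union> H_supp y"] scale_left_distrib sum.distrib)
qed

lemma lin_H_scale: "lin_H scale f (H_scale c x) = scale c (lin_H scale f x)"
proof -
  have "H_supp (H_scale c x) \<subseteq> H_supp x" by (auto simp: H_supp_def)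
  then show ?thesis
    by (simp add: lin_H_superset[of "H_supp x"] scale_sum_right)
qed

lemma lin_H_basis [simp]: "lin_H scale f (H_basis b) = f b"
  by (simp add: lin_H_superset[of "{b}"] H_supp_def)

end

definition H_comult :: "'k::field hopf_efuv \<Rightarrow> ('k hopf_efuv \<times> 'k hopf_efuv \<Rightarrow>\<^sub>0 'k)" where
  "H_comult = lin_H pm_scale (\<lambda>b. \<Sum>(s, i, j)\<leftarrow>comult_terms b. pm_scale s (fbasis (H_basis i, H_basis j)))"

definition H_counit :: "'k::field hopf_efuv \<Rightarrow> 'k" where
  "H_counit = H_fun conv_unit"

lemma H_eval_H_comult: "H_eval (H_fun c) (H_fun c') (H_comult x) = H_fun (conv c c') x"
proof (rule H_linear_eqI[OF fld.vector_space_axioms, of "\<lambda>x. H_eval (H_fun c) (H_fun c') (H_comult x)"])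
  show "H_eval (H_fun c) (H_fun c') (H_comult (H_basis b)) = H_fun (conv c c') (H_basis b)" for b
    by (simp add: H_comult_def H_eval_sum_list conv_def o_def case_prod_unfold)
qed (simp_all add: H_comult_def pm.lin_H_add pm.lin_H_scale)

lemma H_comult_gen: "H_comult (H_gen g) \<approx>\<^sub>\<otimes> H_delta g"
proof (rule tensor_eqI_eval)
  fix c c' :: "idx \<Rightarrow> 'a"
  have "H_fun (conv c c') (H_gen g) = (\<Sum>(w, w')\<leftarrow>gen_terms g. H_fun c (H_word w) * H_fun c' (H_word w'))"
    using H_fun_conv_gen[of c c' 1 g] H_fun_mult_word[of _ "1 :: 'a hopf_efuv"]
    by (simp add: H_fun_conv_one case_prod_unfold)
  then show "H_eval (H_fun c) (H_fun c') (H_comult (H_gen g)) = H_eval (H_fun c) (H_fun c') (H_delta g)"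
    by (simp add: H_eval_H_comult H_delta_def H_eval_sum_list case_prod_unfold o_def)
qed

text \<open>Induction on \<open>y\<close> along right multiplication by generators.  For fixed \<open>x\<close>, both sides are functions
  of \<open>y\<close> that transform according to \<open>gen_act_conv\<close>, since left multiplications commute with right
  translations.\<close>

lemma H_comult_mult: "H_comult (x * y) \<approx>\<^sub>\<otimes> tensor_mult (H_comult x) (H_comult y)"
proof (rule tensor_eqI_eval)
  fix c c' :: "idx \<Rightarrow> 'a"
  have ev: "H_eval \<psi> \<psi>' (H_comult y) = H_fun (conv (\<lambda>b. \<psi> (H_basis b)) (\<lambda>b. \<psi>' (H_basis b))) y"
    if "H_functional \<psi>" "H_functional \<psi>'" for \<psi> \<psi>' :: "'a hopf_efuv \<Rightarrow> 'a" and y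
    using that H_functional_eq[OF that(1)] H_functional_eq[OF that(2)] H_eval_H_comult by metis
  let ?L = "\<lambda>c a b. H_fun c (a * H_basis b)"
  have tm: "H_eval (H_fun c) (H_fun c') (tensor_mult p (H_comult y))
      = lin_ext (*) (\<lambda>(a, b). H_fun (conv (?L c a) (?L c' b)) y) p"
    for c c' :: "idx \<Rightarrow> 'a" and p y
    unfolding H_eval_tensor_mult
    by (intro fld.lin_ext_cong) (auto intro!: ev H_functional_mult_left)
  have L: "word_act w (?L c a) = ?L (word_act w c) a" for w c a
  proof
    fix b
    have "H_fun (?L c a) (x * H_word w) = H_fun c (a * (x * H_word w))" for x
      using H_functional_eq[OF H_functional_mult_left[OF H_functional_H_fun, of c a]] by metis
    from this[of "H_basis b"] show "word_act w (?L c a) b = ?L (word_act w c) a b"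
      by (simp add: H_fun_mult_word mult.assoc[symmetric])
  qed
  show "H_eval (H_fun c) (H_fun c') (H_comult (x * y))
      = H_eval (H_fun c) (H_fun c') (tensor_mult (H_comult x) (H_comult y))"
  proof (induction y arbitrary: c c' rule: H_induct)
    case (add y z)
    then show ?case
      by (simp add: H_eval_H_comult tm distrib_left case_prod_unfold fld.lin_ext_fun_add)
  next
    case (scale r y)
    then show ?case
      by (simp add: H_eval_H_comult tm H_scale_mult_right case_prod_unfold fld.lin_ext_fun_scale)
  next
    case one
    have "H_fun (?L c a) 1 = H_fun c a" for c and a :: "'a hopf_efuv"
      using H_functional_eq[OF H_functional_mult_left[OF H_functional_H_fun, of c a]]
      by (metis mult_1_right)
    then have "H_eval (H_fun c) (H_fun c') (tensor_mult (H_comult x) (H_comult 1))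
        = H_eval (H_fun c) (H_fun c') (H_comult x)"
      unfolding tm by (simp add: H_fun_conv_one H_eval_def)
    then show ?case by simp
  next
    case (gen y g)
    have *: "lin_ext (*) (\<lambda>x. \<Sum>t\<leftarrow>ts. f t x) p = (\<Sum>t\<leftarrow>ts. lin_ext (*) (f t) p)"
      for ts :: "(generator list \<times> generator list) list" and f :: "_ \<Rightarrow> 'a hopf_efuv \<times> 'a hopf_efuv \<Rightarrow> 'a" and p
      by (induction ts) (simp_all add: fld.lin_ext_fun_add)
    have "H_eval (H_fun c) (H_fun c') (H_comult (x * (y * H_gen g)))
        = (\<Sum>(w, w')\<leftarrow>gen_terms g. H_eval (H_fun (word_act w c)) (H_fun (word_act w' c')) (H_comult (x * y)))"
      by (simp add: H_eval_H_comult mult.assoc[symmetric] H_fun_conv_gen)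
    also have "\<dots> = (\<Sum>(w, w')\<leftarrow>gen_terms g. H_eval (H_fun (word_act w c)) (H_fun (word_act w' c'))
          (tensor_mult (H_comult x) (H_comult y)))"
      by (simp add: gen.IH)
    also have "\<dots> = H_eval (H_fun c) (H_fun c') (tensor_mult (H_comult x) (H_comult (y * H_gen g)))"
      by (simp add: tm H_fun_conv_gen L * case_prod_unfold)
    finally show ?case .
  qed
qed

lemma H_counit_mult:
  fixes x y :: "'k::field hopf_efuv"
  shows "H_counit (x * y) = H_counit x * H_counit y"
proof (induction y rule: H_induct)
  case one
  show ?case by (simp add: H_counit_def H_fun_one conv_unit_def)
next
  case (gen y g)
  (* Right translation by a generator multiplies the counit by a scalar. *)
  have "\<exists>r :: 'k. \<forall>b. gen_act g conv_unit b = r * conv_unit b"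
    by (cases g) (auto simp: gen_act_def conv_unit_def split: lam.splits
      intro!: exI[of _ "case g of Gen_e _ \<Rightarrow> 1 | _ \<Rightarrow> 0"] elim: lam_u.elims lam_v.elims, (case_tac a; simp)+)
  then obtain r :: 'k where "gen_act g conv_unit = (\<lambda>b. r * conv_unit b)" by (auto simp: fun_eq_iff)
  moreover have "H_fun (\<lambda>b. r * conv_unit b) x = r * H_counit x" for x :: "'k hopf_efuv"
    unfolding H_counit_def by (rule H_linear_eqI[OF fld.vector_space_axioms]) (simp_all add: algebra_simps)
  ultimately show ?case
    using gen.IH by (simp add: H_counit_def mult.assoc[symmetric] H_fun_mult_gen)
qed (simp_all add: H_counit_def distrib_left H_scale_mult_right algebra_simps)

subsection \<open>Coassociativity\<close>

lemma cong_span_linear_sum: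
  fixes f :: "'a::ab_group_add \<Rightarrow> ('b \<Rightarrow>\<^sub>0 'k::field)"
  assumes "\<And>x y. f (x + y) - (f x + f y) \<in> pm.span R" "\<And>c x. f (sa c x) - pm_scale c (f x) \<in> pm.span R"
  shows "f (\<Sum>x\<in>F. sa (c x) (g x)) - (\<Sum>x\<in>F. pm_scale (c x) (f (g x))) \<in> pm.span R"
proof -
  have 0: "f 0 \<in> pm.span R" using pm.span_neg[OF assms(1)[of 0 0]] by simp
  show ?thesis
  proof (induction F rule: infinite_finite_induct)
    case (insert x F)
    from pm.span_add[OF pm.span_add[OF assms(1)[of "sa (c x) (g x)" "\<Sum>x\<in>F. sa (c x) (g x)"]
      assms(2)[of "c x" "g x"]] insert.IH] insert.hyps
    show ?case by (simp add: algebra_simps)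
  qed (simp_all add: 0)
qed

text \<open>Triples of functionals separate the elements of \<open>H \<otimes> H \<otimes> H\<close>: all three factors are expanded in
  monomials.\<close>

lemma tensor3_eqI_eval:
  fixes p q :: "('k::field hopf_efuv \<times> 'k hopf_efuv \<times> 'k hopf_efuv \<Rightarrow>\<^sub>0 'k)"
  defines "ev \<equiv> (\<lambda>c c' c''. lin_ext (*) (\<lambda>(x, y, z). H_fun c x * (H_fun c' y * H_fun c'' z)))"
  assumes "\<And>c c' c''. ev c c' c'' p = ev c c' c'' q"
  shows "tensor3_eq H_scale UNIV H_scale UNIV H_scale UNIV p q"
proof -
  let ?R = "tensor3_rels H_scale UNIV H_scale UNIV H_scale (UNIV :: 'k hopf_efuv set)"
  define r where "r = p - q"
  define F where "F = (\<Union>(x, y, z)\<in>Poly_Mapping.keys r. H_supp x \<union> H_supp y \<union> H_supp z)"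
  have F: "finite F" by (auto simp: F_def)
  let ?d = "\<lambda>b b'. if b' = b then 1 else (0 :: 'k)"
  have rels: "fbasis (x + x', y, z) - (fbasis (x, y, z) + fbasis (x', y, z)) \<in> ?R"
    "fbasis (x, y + y', z) - (fbasis (x, y, z) + fbasis (x, y', z)) \<in> ?R"
    "fbasis (x, y, z + z') - (fbasis (x, y, z) + fbasis (x, y, z')) \<in> ?R"
    "fbasis (H_scale r x, y, z) - pm_scale r (fbasis (x, y, z)) \<in> ?R"
    "fbasis (x, H_scale r y, z) - pm_scale r (fbasis (x, y, z)) \<in> ?R"
    "fbasis (x, y, H_scale r z) - pm_scale r (fbasis (x, y, z)) \<in> ?R" for x x' y y' z z' r
    unfolding tensor3_rels_def diff_diff_eq[symmetric]
    by (rule UnI1, rule UnI1, rule UnI1, rule UnI1, rule UnI1, blast,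
        rule UnI1, rule UnI1, rule UnI1, rule UnI1, rule UnI2, blast,
        rule UnI1, rule UnI1, rule UnI1, rule UnI2, blast,
        rule UnI1, rule UnI1, rule UnI2, blast,
        rule UnI1, rule UnI2, blast,
        rule UnI2, blast)
  define ex :: "_ \<Rightarrow> _ \<Rightarrow> _ \<Rightarrow> ('k hopf_efuv \<times> 'k hopf_efuv \<times> 'k hopf_efuv \<Rightarrow>\<^sub>0 'k)"
    where "ex x y z = (\<Sum>i\<in>F. pm_scale (H_coord i x) (\<Sum>j\<in>F. pm_scale (H_coord j y)
       (\<Sum>l\<in>F. pm_scale (H_coord l z) (fbasis (H_basis i, H_basis j, H_basis l)))))"
    for x y z :: "'k hopf_efuv"
  have 1: "fbasis (\<Sum>i\<in>F. H_scale (c i) (H_basis i), y, z) - (\<Sum>i\<in>F. pm_scale (c i) (fbasis (H_basis i, y, z))) \<in> pm.span ?R"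
    for c y z
    by (rule cong_span_linear_sum[where f = "\<lambda>x. fbasis (x, y, z)"];
        rule pm.span_base; rule rels)
  have 2: "fbasis (x, \<Sum>i\<in>F. H_scale (c i) (H_basis i), z) - (\<Sum>i\<in>F. pm_scale (c i) (fbasis (x, H_basis i, z))) \<in> pm.span ?R"
    for c x z
    by (rule cong_span_linear_sum[where f = "\<lambda>y. fbasis (x, y, z)"];
        rule pm.span_base; rule rels)
  have 3: "fbasis (x, y, \<Sum>i\<in>F. H_scale (c i) (H_basis i)) - (\<Sum>i\<in>F. pm_scale (c i) (fbasis (x, y, H_basis i))) \<in> pm.span ?R"
    for c x y
    by (rule cong_span_linear_sum[where f = "\<lambda>z. fbasis (x, y, z)"];
        rule pm.span_base; rule rels)
  have expand: "t - (\<Sum>i\<in>F. pm_scale (c i) (g i)) \<in> pm.span ?R"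
    if "t - (\<Sum>i\<in>F. pm_scale (c i) (f i)) \<in> pm.span ?R" "\<And>i. f i - g i \<in> pm.span ?R"
    for t c and f g :: "idx \<Rightarrow> _"
  proof -
    have "(\<Sum>i\<in>F. pm_scale (c i) (f i)) - (\<Sum>i\<in>F. pm_scale (c i) (g i)) \<in> pm.span ?R"
      unfolding sum_subtractf[symmetric] pm.scale_right_diff_distrib[symmetric]
      using that(2) by (intro pm.span_sum pm.span_scale)
    from pm.span_add[OF that(1) this] show ?thesis by simp
  qed
  have "fbasis (x, y, z) - ex x y z \<in> pm.span ?R" if "(x, y, z) \<in> Poly_Mapping.keys r" for x y z
  proof -
    have exp: "x = (\<Sum>i\<in>F. H_scale (H_coord i x) (H_basis i))" "y = (\<Sum>i\<in>F. H_scale (H_coord i y) (H_basis i))"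
      "z = (\<Sum>i\<in>F. H_scale (H_coord i z) (H_basis i))"
      by (intro H_expand F; use that in \<open>force simp: F_def\<close>)+
    have a: "fbasis (H_basis i, H_basis j, z) - (\<Sum>l\<in>F. pm_scale (H_coord l z) (fbasis (H_basis i, H_basis j, H_basis l))) \<in> pm.span ?R" for i j
      using 3[of "H_basis i" "H_basis j" "\<lambda>i. H_coord i z"] exp(3) by simp
    have b: "fbasis (H_basis i, y, z) - (\<Sum>j\<in>F. pm_scale (H_coord j y) (fbasis (H_basis i, H_basis j, z))) \<in> pm.span ?R" for i
      using 2[of "H_basis i" "\<lambda>i. H_coord i y" z] exp(2) by simp
    have c: "fbasis (x, y, z) - (\<Sum>j\<in>F. pm_scale (H_coord j x) (fbasis (H_basis j, y, z))) \<in> pm.span ?R"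
      using 1[of "\<lambda>i. H_coord i x" y z] exp(1) by simp
    have b': "fbasis (H_basis i, y, z) - (\<Sum>j\<in>F. pm_scale (H_coord j y)
       (\<Sum>l\<in>F. pm_scale (H_coord l z) (fbasis (H_basis i, H_basis j, H_basis l)))) \<in> pm.span ?R" for i
      by (rule expand[OF b a])
    show ?thesis unfolding ex_def by (rule expand[OF c b'])
  qed
  then have "lin_ext pm_scale fbasis r - lin_ext pm_scale (\<lambda>(x, y, z). ex x y z) r \<in> pm.span ?R"
    by (intro cong_span_lin_ext) auto
  moreover have "lin_ext pm_scale (\<lambda>(x, y, z). ex x y z) r = 0"
  proof -
    have "lin_ext pm_scale (\<lambda>(x, y, z). ex x y z) r
      = (\<Sum>i\<in>F. \<Sum>j\<in>F. \<Sum>l\<in>F. pm_scale (ev (?d i) (?d j) (?d l) r) (fbasis (H_basis i, H_basis j, H_basis l)))"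
      unfolding ex_def ev_def lin_ext_def case_prod_unfold pm.scale_sum_right pm.scale_sum_left H_coord_def
      by (simp add: sum.swap[of _ F "Poly_Mapping.keys r"] mult.assoc)
    also have "\<dots> = 0" using assms(2) by (simp add: r_def ev_def fld.lin_ext_diff)
    finally show ?thesis .
  qed
  ultimately show ?thesis by (simp add: lin_ext_fbasis_id tensor3_eq_def r_def)
qed

lemma H_comult_coassoc:
  "tensor3_eq H_scale UNIV H_scale UNIV H_scale UNIV
     (map_left H_comult (H_comult x)) (map_right H_comult (H_comult x))"
proof (rule tensor3_eqI_eval)
  fix c c' c'' :: "idx \<Rightarrow> 'a"
  let ?g = "\<lambda>(x, y, z). H_fun c x * (H_fun c' y * H_fun c'' z)"
  have "lin_ext (*) ?g (map_left H_comult (H_comult x))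
      = lin_ext (*) (\<lambda>(a, d). H_eval (H_fun c) (H_fun c') (H_comult a) * H_fun c'' d) (H_comult x)"
    unfolding map_left_def fld.lin_ext_lin_ext H_eval_def case_prod_unfold
    by (simp add: fld.lin_ext_lin_ext case_prod_unfold lin_ext_field_mult_right[symmetric] mult.assoc)
  also have "\<dots> = H_eval (H_fun (conv c c')) (H_fun c'') (H_comult x)"
    unfolding H_eval_H_comult[of c c'] by (simp add: H_eval_def)
  also have "\<dots> = H_eval (H_fun c) (H_fun (conv c' c'')) (H_comult x)"
    by (simp add: H_eval_H_comult conv_assoc)
  also have "\<dots> = lin_ext (*) (\<lambda>(a, d). H_fun c a * H_eval (H_fun c') (H_fun c'') (H_comult d)) (H_comult x)"
    unfolding H_eval_H_comult[of c' c''] by (simp add: H_eval_def)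
  also have "\<dots> = lin_ext (*) ?g (map_right H_comult (H_comult x))"
    unfolding map_right_def fld.lin_ext_lin_ext H_eval_def case_prod_unfold
    by (simp add: fld.lin_ext_lin_ext case_prod_unfold lin_ext_field_mult_left[symmetric])
  finally show "lin_ext (*) ?g (map_left H_comult (H_comult x)) = lin_ext (*) ?g (map_right H_comult (H_comult x))" .
qed

subsection \<open>Antipode\<close>

text \<open>An antipode reverses products, which forces its value on \<open>uv\<close>.\<close>

fun antipode_lam :: "lam \<Rightarrow> 'k::field hopf_efuv" where
  "antipode_lam L1 = 1"
| "antipode_lam Lu = - (H_v * H_f (- 1)) - H_u * H_e (- 1)"
| "antipode_lam Lv = - (H_u * H_f 1) - H_v * H_e 1"
| "antipode_lam Luv = (- (H_u * H_f 1) - H_v * H_e 1) * (- (H_v * H_f (- 1)) - H_u * H_e (- 1))"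

definition H_antipode :: "'k::field hopf_efuv \<Rightarrow> 'k hopf_efuv" where
  "H_antipode = lin_H H_scale (\<lambda>(l, c, k). (if c then H_e (- k) else H_f k) * antipode_lam l)"

lemma H_mult_rules:
  fixes z :: "'k::field hopf_efuv"
  shows "H_e i * (H_e j * z) = H_e (i + j) * z" "H_f i * (H_f j * z) = H_f (i + j) * z"
    "H_e i * (H_f j * z) = 0" "H_f i * (H_e j * z) = 0"
    "H_e i * (H_u * z) = H_scale (alt i) (H_u * (H_e i * z))"
    "H_f i * (H_u * z) = H_scale (alt i) (H_u * (H_f i * z))"
    "H_e i * (H_v * z) = H_scale (alt i) (H_v * (H_e i * z))"
    "H_f i * (H_v * z) = H_scale (alt i) (H_v * (H_f i * z))"
    "H_u * (H_u * z) = 0" "H_v * (H_v * z) = 0" "H_v * (H_u * z) = - (H_u * (H_v * z))"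
proof -
  have r: "x * (y * z) = w * z" if "x * y = w" for x y w :: "'k hopf_efuv"
    by (simp add: that[symmetric] mult.assoc)
  show "H_e i * (H_e j * z) = H_e (i + j) * z" "H_f i * (H_f j * z) = H_f (i + j) * z"
    by (simp_all add: r)
  show "H_e i * (H_f j * z) = 0" "H_f i * (H_e j * z) = 0"
    "H_u * (H_u * z) = 0" "H_v * (H_v * z) = 0" "H_v * (H_u * z) = - (H_u * (H_v * z))"
    by (simp_all add: r[OF H_ef] r[OF H_fe] r[OF H_uu] r[OF H_vv] r[OF H_vu] mult.assoc)
  show "H_e i * (H_u * z) = H_scale (alt i) (H_u * (H_e i * z))"
    "H_f i * (H_u * z) = H_scale (alt i) (H_u * (H_f i * z))"
    "H_e i * (H_v * z) = H_scale (alt i) (H_v * (H_e i * z))"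
    "H_f i * (H_v * z) = H_scale (alt i) (H_v * (H_f i * z))"
    by (simp_all add: r[OF H_eu] r[OF H_fu] r[OF H_ev] r[OF H_fv] H_scale_mult_left mult.assoc)
qed

lemmas H_normalise = H_mult_rules H_eu H_fu H_ev H_fv H_uu H_vv H_vu H_scale_mult_left H_scale_mult_right
  mult.assoc distrib_left distrib_right left_diff_distrib right_diff_distrib alt_add alt_diff

lemma lin_ext_sum_list:
  assumes "vector_space sc"
  shows "lin_ext sc g (sum_list ps) = (\<Sum>p\<leftarrow>ps. lin_ext sc g p)"
proof -
  interpret C: vector_space sc by fact
  show ?thesis by (induction ps) (simp_all add: C.lin_ext_add)
qed

lemma H_lin_ext_comult_basis:
  "lin_ext H_scale g (H_comult (H_basis b))
    = (\<Sum>(s, i, j)\<leftarrow>comult_terms b. H_scale s (g (H_basis i, H_basis j)))"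
  by (simp add: H_comult_def lin_ext_sum_list[OF H.vector_space_axioms] o_def case_prod_unfold H.lin_ext_scale)

lemma H_antipode_basis:
  "H_antipode (H_basis (l, c, k)) = (if c then H_e (- k) else H_f k) * antipode_lam l"
  by (simp add: H_antipode_def H.lin_H_basis)

lemma H_antipode_linear: "H_antipode (x + y) = H_antipode x + H_antipode y"
    "H_antipode (H_scale r x) = H_scale r (H_antipode x)"
  by (simp_all add: H_antipode_def H.lin_H_add H.lin_H_scale)

lemma H_counit_basis: "H_counit (H_basis b) = conv_unit b"
  by (simp add: H_counit_def)

text \<open>On a monomial, normal ordering of the finitely many terms makes the sum collapse.\<close>

lemma H_antipode_left: "lin_ext H_scale (\<lambda>(a, b). H_antipode a * b) (H_comult x) = H_scale (H_counit x) 1"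
proof (rule H_linear_eqI[OF H.vector_space_axioms,
    of "\<lambda>x. lin_ext H_scale (\<lambda>(a, b). H_antipode a * b) (H_comult x)"])
  fix b :: idx
  show "lin_ext H_scale (\<lambda>(a, b). H_antipode a * b) (H_comult (H_basis b)) = H_scale (H_counit (H_basis b)) (1 :: 'a hopf_efuv)"
    unfolding H_lin_ext_comult_basis H_counit_basis
    by (cases b rule: idx_cases)
      (simp_all add: H_antipode_basis conv_unit_def, simp_all add: H_basis.simps H_col_def H_normalise, auto simp: H_one)
qed (simp_all add: H_comult_def H_counit_def pm.lin_H_add pm.lin_H_scale H.lin_ext_simps H.scale_left_distrib)

lemma H_antipode_right: "lin_ext H_scale (\<lambda>(a, b). a * H_antipode b) (H_comult x) = H_scale (H_counit x) 1"
proof (rule H_linear_eqI[OF H.vector_space_axioms,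
    of "\<lambda>x. lin_ext H_scale (\<lambda>(a, b). a * H_antipode b) (H_comult x)"])
  fix b :: idx
  show "lin_ext H_scale (\<lambda>(a, b). a * H_antipode b) (H_comult (H_basis b)) = H_scale (H_counit (H_basis b)) (1 :: 'a hopf_efuv)"
    unfolding H_lin_ext_comult_basis H_counit_basis
    by (cases b rule: idx_cases)
      (simp_all add: H_antipode_basis conv_unit_def, simp_all add: H_basis.simps H_col_def H_normalise H_one)
qed (simp_all add: H_comult_def H_counit_def pm.lin_H_add pm.lin_H_scale H.lin_ext_simps H.scale_left_distrib)

lemma H_fun_lin_ext: "H_fun c (lin_ext H_scale g p) = lin_ext (*) (\<lambda>x. H_fun c (g x)) p"
  by (rule linear_lin_ext[where L = "H_fun c", OF H.vector_space_axioms fld.vector_space_axioms]) simp_all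

theorem H_hopf_structure_exists: "H_hopf_structure H_comult H_counit (H_antipode :: 'k::field hopf_efuv \<Rightarrow> _)"
proof -
  have "hopf_algebra H_scale H_comult H_counit (H_antipode :: 'k hopf_efuv \<Rightarrow> _)"
  proof (intro hopf_algebra.intro coalgebra.intro coalgebra_axioms.intro hopf_algebra_axioms.intro
      H.vector_space_axioms)
    fix x y :: "'k hopf_efuv" and c :: 'k
    show "H_comult (x + y) \<approx>\<^sub>\<otimes> H_comult x + H_comult y"
      by (simp add: H_comult_def pm.lin_H_add)
    show "H_comult (H_scale c x) \<approx>\<^sub>\<otimes> pm_scale c (H_comult x)"
      by (simp add: H_comult_def pm.lin_H_scale)
    show "Vector_Spaces.linear H_scale (*) (H_counit :: 'k hopf_efuv \<Rightarrow> _)"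
      unfolding Vector_Spaces.linear_iff H_counit_def
      by (simp add: H.vector_space_axioms fld.vector_space_axioms)
    show "tensor3_eq H_scale UNIV H_scale UNIV H_scale UNIV
        (map_left H_comult (H_comult x)) (map_right H_comult (H_comult x))"
      by (rule H_comult_coassoc)
    show "lin_ext H_scale (\<lambda>(a, b). H_scale (H_counit a) b) (H_comult x) = x"
    proof (rule H_fun_eqI)
      fix c
      have "H_fun c (lin_ext H_scale (\<lambda>(a, b). H_scale (H_counit a) b) (H_comult x))
          = H_eval (H_fun conv_unit) (H_fun c) (H_comult x)"
        by (simp add: H_fun_lin_ext H_eval_def H_counit_def case_prod_unfold)
      then show "H_fun c (lin_ext H_scale (\<lambda>(a, b). H_scale (H_counit a) b) (H_comult x)) = H_fun c x"
        by (simp add: H_eval_H_comult conv_unit_left)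
    qed
    show "lin_ext H_scale (\<lambda>(a, b). H_scale (H_counit b) a) (H_comult x) = x"
    proof (rule H_fun_eqI)
      fix c
      have "H_fun c (lin_ext H_scale (\<lambda>(a, b). H_scale (H_counit b) a) (H_comult x))
          = H_eval (H_fun c) (H_fun conv_unit) (H_comult x)"
        by (simp add: H_fun_lin_ext H_eval_def H_counit_def case_prod_unfold mult.commute)
      then show "H_fun c (lin_ext H_scale (\<lambda>(a, b). H_scale (H_counit b) a) (H_comult x)) = H_fun c x"
        by (simp add: H_eval_H_comult conv_unit_right)
    qed
    show "H_comult 1 \<approx>\<^sub>\<otimes> fbasis (1, 1 :: 'k hopf_efuv)"
      by (rule tensor_eqI_eval) (simp add: H_eval_H_comult H_fun_conv_one)
    show "H_counit (1 :: 'k hopf_efuv) = 1"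
      by (simp add: H_counit_def H_fun_one conv_unit_def)
    show "Vector_Spaces.linear H_scale H_scale (H_antipode :: 'k hopf_efuv \<Rightarrow> _)"
      unfolding Vector_Spaces.linear_iff
      by (simp add: H.vector_space_axioms H_antipode_linear)
  qed (simp_all add: H_scale_mult_left H_scale_mult_right H_comult_mult H_counit_mult
      H_antipode_left H_antipode_right)
  moreover have gens: "H_e i = H_basis (L1, True, i)" "H_f i = H_basis (L1, False, i)"
    "(H_u :: 'k hopf_efuv) = H_basis (Lu, True, 0) + H_basis (Lu, False, 0)"
    "(H_v :: 'k hopf_efuv) = H_basis (Lv, True, 0) + H_basis (Lv, False, 0)" for i
    by (simp_all add: H_basis.simps H_col_def distrib_left[symmetric] H_one[symmetric])
  have anti: "H_antipode (H_u :: 'k hopf_efuv) = antipode_lam Lu" "H_antipode (H_v :: 'k hopf_efuv) = antipode_lam Lv"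
    by (simp_all only: gens(3,4) H_antipode_linear H_antipode_basis if_True if_False minus_zero
        distrib_right[symmetric] H_one[symmetric] mult_1_left)
  have counit: "H_counit (H_e i :: 'k hopf_efuv) = 1" "H_counit (H_f i :: 'k hopf_efuv) = 0"
    "H_counit (H_u :: 'k hopf_efuv) = 0" "H_counit (H_v :: 'k hopf_efuv) = 0"
    "H_antipode (H_e i :: 'k hopf_efuv) = H_e (- i)" "H_antipode (H_f i :: 'k hopf_efuv) = H_f i" for i
    by (simp_all add: gens H_counit_def conv_unit_def H_antipode_basis)
  note d = H_comult_gen[where 'a = 'k]
  ultimately show ?thesis
    unfolding H_hopf_structure_def
    using d[of "Gen_e _"] d[of "Gen_f _"] d[of Gen_u] d[of Gen_v] anti counit
    by (simp add: H_delta_def H_word_def add.assoc)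
qed

section \<open>The dual Chevalley property\<close>

lemma H_fun_supp: "H_fun c x = (\<Sum>b\<in>H_supp x. H_coord b x * c b)"
proof -
  have "H_fun c x = H_fun c (\<Sum>b\<in>H_supp x. H_scale (H_coord b x) (H_basis b))"
    using H_expand[of "H_supp x" x] by simp
  then show ?thesis by (simp add: H_fun_sum)
qed

locale H_structure =
  fixes \<Delta> :: "'k::field hopf_efuv \<Rightarrow> ('k hopf_efuv \<times> 'k hopf_efuv \<Rightarrow>\<^sub>0 'k)"
    and \<epsilon> :: "'k hopf_efuv \<Rightarrow> 'k" and S :: "'k hopf_efuv \<Rightarrow> 'k hopf_efuv"
  assumes H_str: "H_hopf_structure \<Delta> \<epsilon> S"

sublocale H_structure \<subseteq> hopf_algebra H_scale \<Delta> \<epsilon> S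
  using H_str by (simp add: H_hopf_structure_def)

context H_structure
begin

lemma eval_comult: "H_eval (H_fun c) (H_fun c') (\<Delta> x) = H_fun (conv c c') x"
proof (rule H_eval_comult)
  show "\<Delta> (H_gen g) \<approx>\<^sub>\<otimes> H_delta g" for g
    using H_str by (cases g) (auto simp: H_hopf_structure_def H_delta_def H_word_def add.assoc)
qed (fact comult_add comult_scale comult_mult comult_one)+

lemma comult_eq: "\<Delta> x \<approx>\<^sub>\<otimes> H_comult x"
  by (rule tensor_eqI_eval) (simp add: eval_comult H_eval_H_comult)

text \<open>The counit is determined as the neutral element of the convolution product.\<close>

lemma counit_eq: "\<epsilon> = H_fun conv_unit"
proof -
  have lin: "H_functional \<epsilon>"
    using counit_linear by (simp add: Vector_Spaces.linear_iff H_functional_def)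
  define c where "c = (\<lambda>b. \<epsilon> (H_basis b))"
  have \<epsilon>: "\<epsilon> = H_fun c" using H_functional_eq[OF lin] by (simp add: c_def)
  have "conv c c' b = c' b" for c' :: "idx \<Rightarrow> 'k" and b
  proof -
    have "conv c c' b = H_eval \<epsilon> (H_fun c') (\<Delta> (H_basis b))"
      by (simp add: \<epsilon> eval_comult)
    also have "\<dots> = H_fun c' (lin_ext H_scale (\<lambda>(a, b). H_scale (\<epsilon> a) b) (\<Delta> (H_basis b)))"
      by (simp add: H_fun_lin_ext H_eval_def case_prod_unfold)
    finally show ?thesis by (simp add: counit_left)
  qed
  from this[of conv_unit] have "c = conv_unit" unfolding conv_unit_right by auto
  then show ?thesis by (simp add: \<epsilon>)
qed

text \<open>A functional \<open>c\<close> acts on \<open>H\<close> by contracting the right or the left tensor factor of \<open>\<Delta>\<close>.\<close>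

definition hit_right :: "(idx \<Rightarrow> 'k) \<Rightarrow> 'k hopf_efuv \<Rightarrow> 'k hopf_efuv" where
  "hit_right c x = lin_ext H_scale (\<lambda>(a, b). H_scale (H_fun c b) a) (\<Delta> x)"

definition hit_left :: "(idx \<Rightarrow> 'k) \<Rightarrow> 'k hopf_efuv \<Rightarrow> 'k hopf_efuv" where
  "hit_left c x = lin_ext H_scale (\<lambda>(a, b). H_scale (H_fun c a) b) (\<Delta> x)"

lemma H_fun_hit_right: "H_fun d (hit_right c x) = H_fun (conv d c) x"
proof -
  have "H_fun d (hit_right c x) = H_eval (H_fun d) (H_fun c) (\<Delta> x)"
    by (simp add: hit_right_def H_fun_lin_ext H_eval_def case_prod_unfold mult.commute)
  then show ?thesis by (simp add: eval_comult)
qed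

lemma H_fun_hit_left: "H_fun d (hit_left c x) = H_fun (conv c d) x"
proof -
  have "H_fun d (hit_left c x) = H_eval (H_fun c) (H_fun d) (\<Delta> x)"
    by (simp add: hit_left_def H_fun_lin_ext H_eval_def case_prod_unfold)
  then show ?thesis by (simp add: eval_comult)
qed

text \<open>A representative of \<open>\<Delta> x\<close> with both factors in \<open>D\<close> stays in \<open>D\<close> when one factor is contracted.\<close>

lemma subcoalgebra_hit:
  assumes "subcoalgebra H_scale \<Delta> D" "x \<in> D"
  shows "hit_right c x \<in> D" "hit_left c x \<in> D"
proof -
  have sub: "H.subspace D" using assms(1) by (simp add: subcoalgebra_def)
  obtain y where y: "Poly_Mapping.keys y \<subseteq> D \<times> D" "y \<approx>\<^sub>\<otimes> \<Delta> x"
    using assms by (auto simp: subcoalgebra_def)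
  have "hit_right c x = lin_ext H_scale (\<lambda>(a, b). H_scale (H_fun c b) a) y"
    unfolding hit_right_def
    by (rule tensor_eq_lin_ext[OF H.vector_space_axioms _ _ _ _ tensor_eq_sym[OF y(2)]])
      (simp_all add: H.scale_right_distrib H.scale_left_distrib mult.commute)
  moreover have "\<dots> \<in> D"
    by (rule H.lin_ext_in_subspace[OF sub]) (use y(1) in \<open>auto intro: H.subspace_scale[OF sub]\<close>)
  ultimately show "hit_right c x \<in> D" by simp
  have "hit_left c x = lin_ext H_scale (\<lambda>(a, b). H_scale (H_fun c a) b) y"
    unfolding hit_left_def
    by (rule tensor_eq_lin_ext[OF H.vector_space_axioms _ _ _ _ tensor_eq_sym[OF y(2)]])
      (simp_all add: H.scale_right_distrib H.scale_left_distrib mult.commute)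
  moreover have "\<dots> \<in> D"
    by (rule H.lin_ext_in_subspace[OF sub]) (use y(1) in \<open>auto intro: H.subspace_scale[OF sub]\<close>)
  ultimately show "hit_left c x \<in> D" by simp
qed

lemma subcoalgebra_span:
  assumes "\<And>x. x \<in> A \<Longrightarrow> \<exists>y. Poly_Mapping.keys y \<subseteq> H.span A \<times> H.span A \<and> y \<approx>\<^sub>\<otimes> \<Delta> x"
  shows "subcoalgebra H_scale \<Delta> (H.span A)"
  unfolding subcoalgebra_def
proof (intro conjI ballI H.subspace_span)
  fix x assume "x \<in> H.span A"
  then show "\<exists>y. Poly_Mapping.keys y \<subseteq> H.span A \<times> H.span A \<and> y \<approx>\<^sub>\<otimes> \<Delta> x"
  proof (induction rule: H.span_induct_alt)
    case base
    have "\<Delta> 0 \<approx>\<^sub>\<otimes> pm_scale 0 (\<Delta> 0)" using comult_scale[of 0 0] by simp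
    then show ?case by (intro exI[of _ 0]) (simp add: tensor_eq_sym)
  next
    case (step c x y)
    obtain p q where p: "Poly_Mapping.keys p \<subseteq> H.span A \<times> H.span A" "p \<approx>\<^sub>\<otimes> \<Delta> x"
      and q: "Poly_Mapping.keys q \<subseteq> H.span A \<times> H.span A" "q \<approx>\<^sub>\<otimes> \<Delta> y"
      using assms[OF step(1)] step(2) by blast
    have "Poly_Mapping.keys (pm_scale c p) \<subseteq> Poly_Mapping.keys p"
      by (auto simp: in_keys_iff lookup_pm_scale)
    then have "Poly_Mapping.keys (pm_scale c p + q) \<subseteq> H.span A \<times> H.span A"
      using p(1) q(1) Poly_Mapping.keys_add[of "pm_scale c p" q] by blast
    moreover have "pm_scale c p + q \<approx>\<^sub>\<otimes> pm_scale c (\<Delta> x) + \<Delta> y"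
      by (intro tensor_eq_add tensor_eq_scale p(2) q(2))
    then have "pm_scale c p + q \<approx>\<^sub>\<otimes> \<Delta> (H_scale c x + y)"
      by (meson comult_add comult_scale tensor_eq_add tensor_eq_refl tensor_eq_sym tensor_eq_trans)
    ultimately show ?case by blast
  qed
qed

lemma comult_L1: "fbasis (H_basis (L1, True, k), H_basis (L1, c, k))
    + fbasis (H_basis (L1, False, k), H_basis (L1, \<not> c, - k)) \<approx>\<^sub>\<otimes> \<Delta> (H_basis (L1, c, k))"
proof -
  have "H_comult (H_basis (L1, c, k)) = fbasis (H_basis (L1, True, k), H_basis (L1, c, k))
    + fbasis (H_basis (L1, False, k), H_basis (L1, \<not> c, - k :: int) :: 'k hopf_efuv)"
    by (simp add: H_comult_def)
  then show ?thesis using comult_eq[of "H_basis (L1, c, k)"] by (simp add: tensor_eq_sym)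
qed

lemma keys_fbasis_add: "Poly_Mapping.keys (fbasis x + fbasis y :: 'b \<Rightarrow>\<^sub>0 'k) \<subseteq> {x, y}"
  using Poly_Mapping.keys_add[of "fbasis x" "fbasis y :: 'b \<Rightarrow>\<^sub>0 'k"] by (simp add: fbasis_def insert_commute)

text \<open>The index set must contain with each \<open>(c, k)\<close> the indices of both tensor factors in \<open>comult_L1\<close>.\<close>

lemma subcoalgebra_span_L1:
  assumes "\<And>c k. (c, k) \<in> I \<Longrightarrow> (True, k) \<in> I \<and> (False, k) \<in> I \<and> (\<not> c, - k) \<in> I"
  shows "subcoalgebra H_scale \<Delta> (H.span ((\<lambda>p. H_basis (L1, p)) ` I))"
proof (rule subcoalgebra_span)
  let ?A = "(\<lambda>p. H_basis (L1, p)) ` I"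
  have mem: "(H_basis (L1, c, k) :: 'k hopf_efuv) \<in> H.span ?A" if "(c, k) \<in> I" for c k
    using that by (intro H.span_base) force
  fix x :: "'k hopf_efuv" assume "x \<in> ?A"
  then obtain c k where ck: "(c, k) \<in> I" and x: "x = H_basis (L1, c, k)" by auto
  show "\<exists>y. Poly_Mapping.keys y \<subseteq> H.span ?A \<times> H.span ?A \<and> y \<approx>\<^sub>\<otimes> \<Delta> x"
    unfolding x using assms[OF ck] ck
    by - (rule exI, rule conjI[rotated], rule comult_L1, rule order_trans[OF keys_fbasis_add], auto intro: mem)
qed

text \<open>The comatrix coalgebra on \<open>e\<^sub>i, f\<^sub>i, f\<^sub>-\<^sub>i, e\<^sub>-\<^sub>i\<close>, spanned by the matrix coefficients of the
  two-dimensional representation of \<open>O(2)\<close> with weights \<open>i\<close> and \<open>- i\<close>.\<close>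

definition C_block :: "int \<Rightarrow> 'k hopf_efuv set" where
  "C_block i = H.span ((\<lambda>p. H_basis (L1, p)) ` (UNIV \<times> {i, - i}))"

text \<open>The determinant character of \<open>O(2)\<close>.\<close>

definition H_sgn :: "'k hopf_efuv" where "H_sgn = H_basis (L1, True, 0) - H_basis (L1, False, 0)"

definition blocks :: "'k hopf_efuv set set" where
  "blocks = {H.span {1}, H.span {H_sgn}} \<union> C_block ` {1..}"

text \<open>The coordinate ring of \<open>O(2)\<close>.\<close>

definition H0 :: "'k hopf_efuv set" where
  "H0 = H.span (range (\<lambda>p. H_basis (L1, p)))"

lemma grouplike_subcoalgebra:
  assumes "fbasis (x, x) \<approx>\<^sub>\<otimes> \<Delta> x"
  shows "subcoalgebra H_scale \<Delta> (H.span {x})"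
  by (rule subcoalgebra_span) (use assms in \<open>auto intro!: exI[of _ "fbasis (x, x)"] H.span_base simp: fbasis_def\<close>)

lemma blocks_subcoalgebra: "C \<in> blocks \<Longrightarrow> subcoalgebra H_scale \<Delta> C"
proof -
  have "fbasis (H_sgn, H_sgn) \<approx>\<^sub>\<otimes> \<Delta> H_sgn"
    by (rule tensor_eqI_eval) (simp add: eval_comult H_sgn_def conv_simps algebra_simps)
  moreover have "fbasis (1, 1) \<approx>\<^sub>\<otimes> \<Delta> 1" using comult_one by (rule tensor_eq_sym)
  moreover have "subcoalgebra H_scale \<Delta> (C_block i)" for i
    unfolding C_block_def by (rule subcoalgebra_span_L1) auto
  ultimately show "C \<in> blocks \<Longrightarrow> subcoalgebra H_scale \<Delta> C"
    unfolding blocks_def using grouplike_subcoalgebra by auto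
qed

lemma blocks_subset_H0: "C \<in> blocks \<Longrightarrow> C \<subseteq> H0"
proof -
  have mem: "H_basis (L1, c, k) \<in> H0" for c k
    unfolding H0_def by (rule H.span_base) force
  have "H.subspace H0" by (simp add: H0_def H.subspace_span)
  then have sp: "A \<subseteq> H0 \<Longrightarrow> H.span A \<subseteq> H0" for A
    by (simp add: H.span_minimal)
  have "1 \<in> H0" "H_sgn \<in> H0"
    unfolding H_sgn_def H_one_basis using \<open>H.subspace H0\<close>
    by (auto intro!: H.subspace_add H.subspace_diff mem)
  then have "H.span {1} \<subseteq> H0" "H.span {H_sgn} \<subseteq> H0" "C_block i \<subseteq> H0" for i
    unfolding C_block_def by (intro sp; auto intro: mem)+
  then show "C \<in> blocks \<Longrightarrow> C \<subseteq> H0" unfolding blocks_def by blast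
qed

lemma H_eq_0_iff: "x = 0 \<longleftrightarrow> (\<forall>b. H_coord b x = 0)"
  using H_expand[of "{}" x] by (auto simp: H_supp_def)

abbreviation unit_fun :: "idx \<Rightarrow> idx \<Rightarrow> 'k" where "unit_fun b \<equiv> (\<lambda>b'. if b' = b then 1 else 0)"

text \<open>Contracting with the functionals dual to \<open>u\<close> and \<open>v\<close> removes a factor \<open>u\<close> or \<open>v\<close> from a monomial.
  Applied to an element with a component of positive exterior degree, suitable contractions lead to
  a nonzero element of degree zero.\<close>

lemma subcoalgebra_meets_H0:
  assumes D: "subcoalgebra H_scale \<Delta> D" "x \<in> D" "x \<noteq> 0"
  obtains y where "y \<in> D" "y \<noteq> 0" "\<And>l c k. H_coord (l, c, k) y \<noteq> 0 \<Longrightarrow> l = L1"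
proof -
  note witness = that
  define cx cy :: "idx \<Rightarrow> 'k" where "cx = (\<lambda>(l, c, k). if l = Lu \<and> c then 1 else 0)"
    and "cy = (\<lambda>(l, c, k). if l = Lv \<and> c then 1 else 0)"
  let ?X = "hit_right cx" and ?Y = "hit_right cy"
  have X: "H_coord (L1, c, k) (?X z) = H_coord (Lu, c, k) z" "H_coord (Lu, c, k) (?X z) = 0"
    "H_coord (Lv, c, k) (?X z) = H_coord (Luv, c, k) z" "H_coord (Luv, c, k) (?X z) = 0"
    and Y: "H_coord (L1, c, k) (?Y z) = H_coord (Lv, c, k) z" "H_coord (Lv, c, k) (?Y z) = 0"
    "H_coord (Lu, c, k) (?Y z) = - H_coord (Luv, c, k) z" "H_coord (Luv, c, k) (?Y z) = 0" for z c k
  proof -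
    have eq: "H_fun d z = r * H_fun d' z" if "\<And>b. d b = r * d' b" for d d' :: "idx \<Rightarrow> 'k" and r
      using that by (simp add: H_fun_supp sum_distrib_left mult.left_commute)
    have "conv (unit_fun (L1, c, k)) cx b = 1 * unit_fun (Lu, c, k) b"
      "conv (unit_fun (Lu, c, k)) cx b = 0 * unit_fun (Lu, c, k) b"
      "conv (unit_fun (Lv, c, k)) cx b = 1 * unit_fun (Luv, c, k) b"
      "conv (unit_fun (Luv, c, k)) cx b = 0 * unit_fun (Lu, c, k) b"
      "conv (unit_fun (L1, c, k)) cy b = 1 * unit_fun (Lv, c, k) b"
      "conv (unit_fun (Lv, c, k)) cy b = 0 * unit_fun (Lu, c, k) b"
      "conv (unit_fun (Lu, c, k)) cy b = - 1 * unit_fun (Luv, c, k) b"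
      "conv (unit_fun (Luv, c, k)) cy b = 0 * unit_fun (Lu, c, k) b" for b
      by (cases b rule: idx_cases; cases c; auto simp: conv_simps cx_def cy_def)+
    note * = this[THEN eq]
    show "H_coord (L1, c, k) (?X z) = H_coord (Lu, c, k) z" "H_coord (Lu, c, k) (?X z) = 0"
      "H_coord (Lv, c, k) (?X z) = H_coord (Luv, c, k) z" "H_coord (Luv, c, k) (?X z) = 0"
      "H_coord (L1, c, k) (?Y z) = H_coord (Lv, c, k) z" "H_coord (Lv, c, k) (?Y z) = 0"
      "H_coord (Lu, c, k) (?Y z) = - H_coord (Luv, c, k) z" "H_coord (Luv, c, k) (?Y z) = 0"
      unfolding H_coord_def H_fun_hit_right using * by simp_all
  qed
  have fin: thesis if "y \<in> D" "H_coord b y \<noteq> 0" "\<And>l c k. H_coord (l, c, k) y \<noteq> 0 \<Longrightarrow> l = L1" for b y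
    by (rule witness[of y]) (use that H_coord_simps(3)[of b] in auto)
  consider (uv) c k where "H_coord (Luv, c, k) x \<noteq> 0"
    | (u) c k where "H_coord (Lu, c, k) x \<noteq> 0" "\<And>c k. H_coord (Luv, c, k) x = 0"
    | (v) c k where "H_coord (Lv, c, k) x \<noteq> 0" "\<And>c k. H_coord (Luv, c, k) x = 0"
    | (one) "\<And>l c k. H_coord (l, c, k) x \<noteq> 0 \<Longrightarrow> l = L1"
    by (metis lam.exhaust)
  then show thesis
  proof cases
    case uv
    have "?Y (?X x) \<in> D" by (intro subcoalgebra_hit[OF D(1)] D(2))
    then show thesis
      by (rule fin[where b = "(L1, c, k)"]) (use uv in \<open>auto simp: X Y\<close>, metis X Y lam.exhaust minus_zero)
  next
    case u
    have "?X x \<in> D" by (intro subcoalgebra_hit[OF D(1)] D(2))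
    then show thesis
      by (rule fin[where b = "(L1, c, k)"]) (use u in \<open>auto simp: X Y\<close>, metis X u(2) lam.exhaust)
  next
    case v
    have "?Y x \<in> D" by (intro subcoalgebra_hit[OF D(1)] D(2))
    then show thesis
      by (rule fin[where b = "(L1, c, k)"]) (use v in \<open>auto simp: X Y\<close>, metis Y v(2) lam.exhaust minus_zero)
  next
    case one
    obtain b where "H_coord b x \<noteq> 0" using D(3) by (auto simp: H_eq_0_iff)
    then show thesis using fin[OF D(2)] one by blast
  qed
qed

lemma H_fun_cong_supp: "(\<And>b. H_coord b x \<noteq> 0 \<Longrightarrow> d b = d' b) \<Longrightarrow> H_fun d x = H_fun d' x"
  unfolding H_fun_supp by (rule sum.cong) (auto simp: H_supp_def)

lemma hit_basis:
  "hit_right c (H_basis (L1, col, k)) = H_scale (c (L1, col, k)) (H_basis (L1, True, k))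
     + H_scale (c (L1, \<not> col, - k)) (H_basis (L1, False, k))"
  "hit_left c (H_basis (L1, col, k)) = H_scale (c (L1, True, k)) (H_basis (L1, col, k))
     + H_scale (c (L1, False, k)) (H_basis (L1, \<not> col, - k))"
  by (rule H_fun_eqI; simp add: H_fun_hit_right H_fun_hit_left conv_simps mult.commute)+

lemma subspace_scale_cancel:
  assumes "H.subspace D" "H_scale r x \<in> D" "r \<noteq> 0" shows "x \<in> D"
  using H.subspace_scale[OF assms(1,2), of "inverse r"] assms(3) by simp

text \<open>Let \<open>y\<close> be an element of exterior degree zero.  A component in a degree \<open>i \<noteq> 0\<close> can be isolated by
  contracting on both sides, and further contractions of the resulting monomial yield the whole
  block.  Otherwise \<open>y\<close> is a combination of the two group-likes, which the characters of their span
  separate if the characteristic is not two.\<close>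

lemma subcoalgebra_contains_block:
  assumes char: "(2 :: 'k) \<noteq> 0" and D: "subcoalgebra H_scale \<Delta> D" and "x \<in> D" "x \<noteq> 0"
  shows "\<exists>C\<in>blocks. C \<subseteq> D"
proof -
  have sub: "H.subspace D" using D by (simp add: subcoalgebra_def)
  obtain y where y: "y \<in> D" "y \<noteq> 0" "\<And>l c k. H_coord (l, c, k) y \<noteq> 0 \<Longrightarrow> l = L1"
    using subcoalgebra_meets_H0[OF D assms(3,4)] by blast
  show ?thesis
  proof (cases "\<exists>c i. i \<noteq> 0 \<and> H_coord (L1, c, i) y \<noteq> 0")
    case True
    then obtain c i where i: "i \<noteq> 0" "H_coord (L1, c, i) y \<noteq> 0" by blast
    \<comment> \<open>Contracting on both sides with \<open>e\<^sub>i\<^sup>*\<close> and \<open>e\<^sub>j\<^sup>*\<close> isolates a single monomial of \<open>y\<close>;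
      the right factor of \<open>f\<^sub>i\<close> next to \<open>f\<^sub>i\<close> is \<open>e\<^sub>-\<^sub>i\<close>, whence the sign in \<open>j\<close>.\<close>
    define j where "j = (if c then i else - i)"
    have mem_supp: "(L1, c, i) \<in> H_supp y" using i(2) by (simp add: H_supp_def)
    let ?z = "hit_left (unit_fun (L1, True, i)) (hit_right (unit_fun (L1, True, j)) y)"
    have "?z = H_scale (H_coord (L1, c, i) y) (H_basis (L1, c, i))"
    proof (rule H_fun_eqI)
      fix d :: "idx \<Rightarrow> 'k"
      have "H_fun d ?z = H_fun (conv (unit_fun (L1, True, i)) (conv d (unit_fun (L1, True, j)))) y"
        by (simp add: H_fun_hit_left H_fun_hit_right conv_assoc)
      also have "\<dots> = H_fun (\<lambda>b. if b = (L1, c, i) then d (L1, c, i) else 0) y"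
      proof (rule H_fun_cong_supp)
        fix b assume "H_coord b y \<noteq> 0"
        then obtain col k where "b = (L1, col, k)" using y(3) by (cases b) blast
        then show "conv (unit_fun (L1, True, i)) (conv d (unit_fun (L1, True, j))) b
            = (if b = (L1, c, i) then d (L1, c, i) else 0)"
          using i(1) by (cases c; cases col) (auto simp: conv_simps j_def)
      qed
      also have "\<dots> = d (L1, c, i) * H_coord (L1, c, i) y"
        unfolding H_fun_supp[of "\<lambda>b. if b = (L1, c, i) then d (L1, c, i) else 0"]
        using i(2) mem_supp by (simp add: if_distrib mult.commute cong: if_cong)
      finally show "H_fun d ?z = H_fun d (H_scale (H_coord (L1, c, i) y) (H_basis (L1, c, i)))"
        by (simp add: mult.commute)
    qed
    moreover have "?z \<in> D" by (intro subcoalgebra_hit[OF D] y(1))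
    ultimately have b: "H_basis (L1, c, i) \<in> D" using subspace_scale_cancel[OF sub _ i(2)] by simp
    have flip: "H_basis (L1, \<not> c, - k) \<in> D" if "H_basis (L1, c, k) \<in> D" "k \<noteq> 0" for c k
      using subcoalgebra_hit(2)[OF D that(1), of "unit_fun (L1, False, k)"] that(2)
      by (simp add: hit_basis)
    have row: "H_basis (L1, True, k) \<in> D \<and> H_basis (L1, False, k) \<in> D" if "H_basis (L1, c, k) \<in> D" "k \<noteq> 0" for c k
      using subcoalgebra_hit(1)[OF D that(1), of "unit_fun (L1, c, k)"]
        subcoalgebra_hit(1)[OF D that(1), of "unit_fun (L1, \<not> c, - k)"] that(2)
      by (cases c) (simp_all add: hit_basis)
    have all: "H_basis (L1, col, k) \<in> D" if "k \<in> {i, - i}" for col k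
      using row[OF b i(1)] flip[of True i] flip[of False i] i(1) that by (cases col) auto
    have "C_block \<bar>i\<bar> \<subseteq> D"
      unfolding C_block_def by (rule H.span_minimal[OF _ sub]) (use all in \<open>auto simp: abs_if\<close>)
    moreover have "C_block \<bar>i\<bar> \<in> blocks" using i(1) by (auto simp: blocks_def)
    ultimately show ?thesis by blast
  next
    case False
    define \<alpha> \<beta> where "\<alpha> = H_coord (L1, True, 0) y" and "\<beta> = H_coord (L1, False, 0) y"
    have supp: "H_supp y \<subseteq> {(L1, True, 0), (L1, False, 0)}"
    proof
      fix b assume "b \<in> H_supp y"
      then have nz: "H_coord b y \<noteq> 0" by (simp add: H_supp_def)
      obtain l c k where b: "b = (l, c, k)" by (cases b)
      have "l = L1" using y(3) nz b by blast
      moreover have "k = 0" using False nz b calculation by blast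
      ultimately show "b \<in> {(L1, True, 0), (L1, False, 0)}" using b by (cases c) auto
    qed
    have y_eq: "y = H_scale \<alpha> (H_basis (L1, True, 0)) + H_scale \<beta> (H_basis (L1, False, 0))"
      by (subst H_expand[OF _ supp]) (simp_all add: \<alpha>_def \<beta>_def)
    have fy: "H_fun d y = \<alpha> * d (L1, True, 0) + \<beta> * d (L1, False, 0)" for d
      by (simp add: y_eq)
    have "hit_right (\<lambda>b. 1) y = H_scale (\<alpha> + \<beta>) 1"
      by (rule H_fun_eqI) (simp add: H_fun_hit_right fy H_fun_one conv_simps algebra_simps)
    then have one: "H_scale (\<alpha> + \<beta>) 1 \<in> D" using subcoalgebra_hit(1)[OF D y(1)] by metis
    have "hit_right (\<lambda>(l, c, k). if c then 1 else - 1) y = H_scale (\<alpha> - \<beta>) H_sgn"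
      by (rule H_fun_eqI) (simp add: H_fun_hit_right fy H_sgn_def conv_simps algebra_simps)
    then have one': "H_scale (\<alpha> - \<beta>) H_sgn \<in> D" using subcoalgebra_hit(1)[OF D y(1)] by metis
    show ?thesis
    proof (cases "\<alpha> + \<beta> = 0")
      case True
      then have "\<alpha> - \<beta> = 2 * \<alpha>" by (simp add: eq_neg_iff_add_eq_0[symmetric] add_eq_0_iff)
      moreover have "\<alpha> \<noteq> 0" using y(2) y_eq True by auto
      ultimately have "\<alpha> - \<beta> \<noteq> 0" using char by (metis mult_eq_0_iff)
      then have "H_sgn \<in> D" by (rule subspace_scale_cancel[OF sub one'])
      then have "H.span {H_sgn} \<subseteq> D" using H.span_minimal[OF _ sub] by simp
      then show ?thesis by (auto simp: blocks_def)
    next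
      case False
      then have "1 \<in> D" using subspace_scale_cancel[OF sub one] by simp
      then have "H.span {1} \<subseteq> D" using H.span_minimal[OF _ sub] by simp
      then show ?thesis by (auto simp: blocks_def)
    qed
  qed
qed

lemma blocks_nonzero:
  assumes "C \<in> blocks" shows "C \<noteq> {0}"
proof -
  have nz: "H_basis b \<noteq> (0 :: 'k hopf_efuv)" for b
  proof
    assume "H_basis b = (0 :: 'k hopf_efuv)"
    then have "H_coord b (H_basis b :: 'k hopf_efuv) = 0" by (simp only: H_coord_simps(3))
    then show False by simp
  qed
  have "H_coord (L1, True, 0) (1 :: 'k hopf_efuv) \<noteq> 0" "H_coord (L1, True, 0) H_sgn \<noteq> 0"
    by (simp_all add: H_one_basis H_sgn_def) (simp_all add: H_coord_def)
  then have "1 \<noteq> (0 :: 'k hopf_efuv)" "H_sgn \<noteq> 0" by fastforce+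
  moreover have "H_basis (L1, True, i) \<in> C_block i" for i
    unfolding C_block_def by (rule H.span_base) force
  moreover have "x \<in> H.span {x}" for x :: "'k hopf_efuv" by (rule H.span_base) simp
  ultimately have "\<exists>x\<in>C. x \<noteq> 0"
    using assms nz unfolding blocks_def by (elim UnE insertE emptyE imageE) blast+
  then show ?thesis by blast
qed

text \<open>Lines contain no proper nonzero subspace, and blocks of different index have disjoint supports.\<close>

lemma blocks_minimal:
  assumes "C \<in> blocks" "C' \<in> blocks" "C' \<subseteq> C"
  shows "C' = C"
proof -
  have line: "C' = H.span {x}" if C: "C = H.span {x}" for x
  proof -
    have sub: "H.subspace C'" using blocks_subcoalgebra[OF assms(2)] by (simp add: subcoalgebra_def)
    obtain z where "z \<in> C'" "z \<noteq> 0" using blocks_nonzero[OF assms(2)] H.subspace_0[OF sub] by blast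
    moreover obtain r where "z = H_scale r x"
      using assms(3) C \<open>z \<in> C'\<close> by (auto simp: H.span_singleton)
    ultimately have "x \<in> C'" using subspace_scale_cancel[OF sub, of r x] by auto
    then have "H.span {x} \<subseteq> C'" by (intro H.span_minimal[OF _ sub]) simp
    then show ?thesis using assms(3) C by blast
  qed
  have block: "C' = C" if C: "C = C_block i" "i \<ge> 1" for i
  proof -
    have "H.subspace {z :: 'k hopf_efuv. \<forall>k. k \<notin> {i, - i} \<longrightarrow> H_coord (L1, True, k) z = 0}"
      by (auto simp: H.subspace_def)
    then have "C_block i \<subseteq> {z. \<forall>k. k \<notin> {i, - i} \<longrightarrow> H_coord (L1, True, k) z = 0}"
      unfolding C_block_def by (rule H.span_minimal[rotated]) auto
    then have out: "H_coord (L1, True, k) z = 0" if "z \<in> C'" "k \<notin> {i, - i}" for z k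
      using that assms(3) C(1) by blast
    have "1 \<notin> C'" using out[of 1 0] C(2) by (auto simp: H_one_basis)
    moreover have "H_sgn \<notin> C'" using out[of H_sgn 0] C(2)
      by (auto simp: H_sgn_def) (simp add: H_coord_def)
    ultimately obtain j where j: "C' = C_block j" "j \<ge> 1"
      using assms(2) H.span_base by (auto simp: blocks_def)
    have "H_basis (L1, True, j) \<in> C'" unfolding j C_block_def by (rule H.span_base) force
    then have "j \<in> {i, - i}" using out by fastforce
    then show ?thesis using j C by auto
  qed
  show ?thesis using assms(1) line block by (auto simp: blocks_def)
qed

text \<open>The simple subcoalgebras are exactly the blocks: every nonzero subcoalgebra contains a block, and
  no block contains another one.\<close>

lemma coradical_eq_H0:
  assumes char: "(2 :: 'k) \<noteq> 0" shows "coradical H_scale \<Delta> = H0"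
proof
  show "coradical H_scale \<Delta> \<subseteq> H0"
    unfolding coradical_def
  proof (rule H.span_minimal)
    show "\<Union> {C. simple_subcoalgebra H_scale \<Delta> C} \<subseteq> H0"
    proof safe
      fix x C assume C: "simple_subcoalgebra H_scale \<Delta> C" and x: "x \<in> C"
      have sc: "subcoalgebra H_scale \<Delta> C" using C by (simp add: simple_subcoalgebra_def)
      then have "0 \<in> C" using H.subspace_0 by (auto simp: subcoalgebra_def)
      then obtain z where "z \<in> C" "z \<noteq> 0" using C by (auto simp: simple_subcoalgebra_def)
      then obtain B where "B \<in> blocks" "B \<subseteq> C" using subcoalgebra_contains_block[OF char sc] by blast
      then have "B = C"
        using C blocks_subcoalgebra blocks_nonzero by (auto simp: simple_subcoalgebra_def)
      then show "x \<in> H0" using \<open>B \<in> blocks\<close> blocks_subset_H0 x by blast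
    qed
  qed (simp add: H0_def H.subspace_span)
next
  have simple: "simple_subcoalgebra H_scale \<Delta> C" if C: "C \<in> blocks" for C
    unfolding simple_subcoalgebra_def
  proof (intro conjI allI impI)
    show "subcoalgebra H_scale \<Delta> C" "C \<noteq> {0}" using C blocks_subcoalgebra blocks_nonzero by auto
    fix D assume D: "subcoalgebra H_scale \<Delta> D \<and> D \<subseteq> C"
    show "D = {0} \<or> D = C"
    proof (cases "\<exists>x\<in>D. x \<noteq> 0")
      case True
      then obtain B where "B \<in> blocks" "B \<subseteq> D" using subcoalgebra_contains_block[OF char] D by blast
      then show ?thesis using blocks_minimal[OF C] D by blast
    next
      case False
      moreover have "0 \<in> D" using D H.subspace_0 by (auto simp: subcoalgebra_def)
      ultimately show ?thesis by blast
    qed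
  qed
  have sub: "H.subspace (coradical H_scale \<Delta>)" by (simp add: coradical_def H.subspace_span)
  have block_sub: "C \<subseteq> coradical H_scale \<Delta>" if "C \<in> blocks" for C
    unfolding coradical_def using simple[OF that] by (intro subsetI H.span_base) blast
  have "H_basis (L1, c, k) \<in> coradical H_scale \<Delta>" for c k
  proof (cases "k = 0")
    case True
    have "x \<in> H.span {x}" for x :: "'k hopf_efuv" by (rule H.span_base) simp
    then have "1 \<in> coradical H_scale \<Delta>" "H_sgn \<in> coradical H_scale \<Delta>"
      using block_sub[of "H.span {1}"] block_sub[of "H.span {H_sgn}"]
      by (simp_all add: blocks_def subset_iff)
    then have "1 + H_sgn \<in> coradical H_scale \<Delta>" "1 - H_sgn \<in> coradical H_scale \<Delta>"
      by (simp_all add: H.subspace_add[OF sub] H.subspace_diff[OF sub])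
    moreover have "1 + H_sgn = H_scale 2 (H_basis (L1, True, 0))" "1 - H_sgn = H_scale 2 (H_basis (L1, False, 0))"
      by (rule H_fun_eqI; simp add: H_fun_one H_sgn_def)+
    ultimately show ?thesis using True subspace_scale_cancel[OF sub _ char] by (cases c) auto
  next
    case False
    have "H_basis (L1, c, k) \<in> C_block \<bar>k\<bar>"
      unfolding C_block_def by (rule H.span_base) (auto simp: abs_if intro!: image_eqI[of _ _ "(c, k)"])
    then show ?thesis using block_sub[of "C_block \<bar>k\<bar>"] False by (auto simp: blocks_def)
  qed
  then show "H0 \<subseteq> coradical H_scale \<Delta>"
    unfolding H0_def by (intro H.span_minimal sub) auto
qed

theorem dual_chevalley:
  assumes char: "(2 :: 'k) \<noteq> 0" shows "dual_chevalley_property H_scale \<Delta> S"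
proof -
  have sub: "H.subspace H0" by (simp add: H0_def H.subspace_span)
  have mem: "H_e i \<in> H0" "H_f i \<in> H0" for i
    unfolding H0_def by (rule H.span_base, force simp: H_basis.simps H_col_def image_iff)+
  have "subcoalgebra H_scale \<Delta> H0"
    unfolding H0_def using subcoalgebra_span_L1[of UNIV] by simp
  moreover have "1 \<in> H0" unfolding H_one by (intro H.subspace_add[OF sub] mem)
  moreover have "x * y \<in> H0" if x: "x \<in> H0" and y: "y \<in> H0" for x y
  proof -
    have xb: "x * H_basis (L1, p) \<in> H0" for p
    proof -
      have bb: "H_basis (L1, q) * H_basis (L1, p) \<in> H0" for q
        by (cases p; cases q) (auto simp: H_basis.simps H_col_def mem H.subspace_0[OF sub])
      show ?thesis using x bb unfolding H0_def
        by (induction rule: H.span_induct_alt)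
          (auto simp: distrib_right H_scale_mult_left H.span_zero intro!: H.span_add H.span_scale)
    qed
    show ?thesis using y xb unfolding H0_def
      by (induction rule: H.span_induct_alt)
        (auto simp: distrib_left H_scale_mult_right H.span_zero intro!: H.span_add H.span_scale)
  qed
  moreover have "S x \<in> H0" if "x \<in> H0" for x
  proof -
    have lin: "S (y + z) = S y + S z" "S (H_scale r y) = H_scale r (S y)" for y z r
      using antipode_linear by (simp_all add: Vector_Spaces.linear_iff)
    have "S 0 = 0" using lin(1)[of 0 0] by simp
    have Sb: "S (H_basis (L1, p)) \<in> H0" for p
      using H_str by (cases p) (auto simp: H_basis.simps H_col_def H_hopf_structure_def mem)
    show ?thesis using that Sb \<open>S 0 = 0\<close> unfolding H0_def
      by (induction rule: H.span_induct_alt)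
        (auto simp: lin H.span_zero intro!: H.span_add H.span_scale)
  qed
  ultimately show ?thesis
    unfolding dual_chevalley_property_def hopf_subalgebra_def coradical_eq_H0[OF char] by blast
qed

end

section \<open>Linear functionals\<close>

definition lform :: "('k::field \<Rightarrow> 'b::ab_group_add \<Rightarrow> 'b) \<Rightarrow> ('b \<Rightarrow> 'k) \<Rightarrow> bool" where
  "lform sc \<phi> \<longleftrightarrow> (\<forall>x y. \<phi> (x + y) = \<phi> x + \<phi> y) \<and> (\<forall>c x. \<phi> (sc c x) = c * \<phi> x)"

context vector_space
begin

lemma lformD:
  assumes "lform scale \<phi>"
  shows "\<phi> (x + y) = \<phi> x + \<phi> y" "\<phi> (scale c x) = c * \<phi> x" "\<phi> 0 = 0" "\<phi> (- x) = - \<phi> x"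
    "\<phi> (x - y) = \<phi> x - \<phi> y" "\<phi> (sum f F) = (\<Sum>i\<in>F. \<phi> (f i))"
proof -
  have add: "\<phi> (x + y) = \<phi> x + \<phi> y" and sc: "\<phi> (scale c x) = c * \<phi> x" for x y c
    using assms by (simp_all add: lform_def)
  have zero: "\<phi> 0 = 0" using sc[of 0 0] by simp
  have neg: "\<phi> (- x) = - \<phi> x" for x using add[of x "- x"] zero by (simp add: eq_neg_iff_add_eq_0 add.commute)
  show "\<phi> (x + y) = \<phi> x + \<phi> y" "\<phi> (scale c x) = c * \<phi> x" "\<phi> 0 = 0" "\<phi> (- x) = - \<phi> x"
    by (fact add sc zero neg)+
  show "\<phi> (x - y) = \<phi> x - \<phi> y" using add[of x "- y"] neg by simp
  show "\<phi> (sum f F) = (\<Sum>i\<in>F. \<phi> (f i))"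
    by (induction F rule: infinite_finite_induct) (simp_all add: add zero)
qed

lemma lform_extend_basis:
  assumes "independent B" shows "\<exists>\<phi>. lform scale \<phi> \<and> (\<forall>b\<in>B. \<phi> b = f b)"
proof -
  interpret vp: vector_space_pair scale "(*) :: 'a \<Rightarrow> 'a \<Rightarrow> 'a"
    by (intro vector_space_pair.intro vector_space_axioms fld.vector_space_axioms)
  show ?thesis
    using vp.linear_independent_extend[OF assms, of f]
    by (auto simp: lform_def Vector_Spaces.linear_iff)
qed

lemma lform_separate:
  assumes "subspace W" "x \<notin> W"
  shows "\<exists>\<phi>. lform scale \<phi> \<and> \<phi> x = 1 \<and> (\<forall>w\<in>W. \<phi> w = 0)"
proof -
  obtain B where B: "B \<subseteq> W" "independent B" "W \<subseteq> span B" using maximal_independent_subset by blast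
  have W: "span B = W" using B span_minimal[OF B(1) assms(1)] by blast
  then have "independent (insert x B)" using B assms(2) by (simp add: independent_insertI)
  then obtain \<phi> where \<phi>: "lform scale \<phi>" "\<forall>b\<in>insert x B. \<phi> b = (if b = x then 1 else 0)"
    using lform_extend_basis[of "insert x B" "\<lambda>b. if b = x then 1 else 0"] by blast
  have "subspace {w. \<phi> w = 0}" using lformD[OF \<phi>(1)] by (simp add: subspace_def)
  moreover have "B \<subseteq> {w. \<phi> w = 0}" using \<phi>(2) B(1) assms(2) by auto
  ultimately have "W \<subseteq> {w. \<phi> w = 0}" using span_minimal W by metis
  then show ?thesis using \<phi> by auto
qed

lemma lform_extend:
  assumes U: "subspace U" and add: "\<And>x y. x \<in> U \<Longrightarrow> y \<in> U \<Longrightarrow> g (x + y) = g x + g y"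
    and sc: "\<And>c x. x \<in> U \<Longrightarrow> g (scale c x) = c * g x"
  shows "\<exists>\<phi>. lform scale \<phi> \<and> (\<forall>u\<in>U. \<phi> u = g u)"
proof -
  obtain B where B: "B \<subseteq> U" "independent B" "U \<subseteq> span B" using maximal_independent_subset by blast
  obtain \<phi> where \<phi>: "lform scale \<phi>" "\<forall>b\<in>B. \<phi> b = g b" using lform_extend_basis[OF B(2)] by blast
  have "g 0 = 0" using sc[of 0 0] subspace_0[OF U] by simp
  then have "subspace {u \<in> U. \<phi> u = g u}"
    using lformD[OF \<phi>(1)] U add sc by (auto simp: subspace_def)
  moreover have "B \<subseteq> {u \<in> U. \<phi> u = g u}" using B(1) \<phi>(2) by auto
  ultimately have "span B \<subseteq> {u \<in> U. \<phi> u = g u}" by (rule span_minimal[rotated])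
  then show ?thesis using \<phi>(1) B(3) by blast
qed

text \<open>The value \<open>\<phi> u\<close> depends on \<open>f u\<close> modulo \<open>W\<close> only, so \<open>\<phi>\<close> descends to \<open>f U + W\<close>; an extension to the
  whole space always exists.  In this way forms are transported along the arrows of a zigzag.\<close>

lemma lform_push:
  assumes U: "subspace U" and W: "subspace W" and \<phi>: "lform scale \<phi>"
    and fadd: "\<And>x y. f (x + y) = f x + f y" and fsc: "\<And>c x. f (scale c x) = scale c (f x)"
    and van: "\<And>u. u \<in> U \<Longrightarrow> f u \<in> W \<Longrightarrow> \<phi> u = 0"
  shows "\<exists>\<psi>. lform scale \<psi> \<and> (\<forall>u\<in>U. \<psi> (f u) = \<phi> u) \<and> (\<forall>w\<in>W. \<psi> w = 0)"
proof -
  have fdiff: "f (x - y) = f x - f y" for x y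
    using fadd[of "x - y" y] by (simp add: algebra_simps)
  define R where "R = {y. \<exists>u\<in>U. \<exists>w\<in>W. y = f u + w}"
  define g where "g y = \<phi> (SOME u. u \<in> U \<and> y - f u \<in> W)" for y
  have g: "g (f u + w) = \<phi> u" if "u \<in> U" "w \<in> W" for u w
  proof -
    let ?P = "\<lambda>v. v \<in> U \<and> f u + w - f v \<in> W"
    have "?P u" using that by simp
    then have v: "?P (SOME v. ?P v)" by (rule someI)
    have "f (u - (SOME v. ?P v)) \<in> W"
      using subspace_diff[OF W conjunct2[OF v] that(2)] by (simp add: fdiff)
    then have "\<phi> (u - (SOME v. ?P v)) = 0" using van subspace_diff[OF U that(1)] v by blast
    then show ?thesis by (simp add: g_def lformD[OF \<phi>])
  qed
  have Rcl: "subspace R"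
    unfolding subspace_def
  proof (intro conjI ballI allI)
    have "f 0 = 0" using fadd[of 0 0] by simp
    then show "0 \<in> R" using subspace_0[OF U] subspace_0[OF W] unfolding R_def by force
  next
    fix x y assume "x \<in> R" "y \<in> R"
    then obtain u w u' w' where "u \<in> U" "w \<in> W" "u' \<in> U" "w' \<in> W" "x = f u + w" "y = f u' + w'"
      unfolding R_def by blast
    then have "x + y = f (u + u') + (w + w')" "u + u' \<in> U" "w + w' \<in> W"
      using U W by (simp_all add: fadd subspace_add)
    then show "x + y \<in> R" unfolding R_def by blast
  next
    fix c x assume "x \<in> R"
    then obtain u w where "u \<in> U" "w \<in> W" "x = f u + w" unfolding R_def by blast
    then have "scale c x = f (scale c u) + scale c w" "scale c u \<in> U" "scale c w \<in> W"
      using U W by (simp_all add: fsc subspace_scale scale_right_distrib)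
    then show "scale c x \<in> R" unfolding R_def by blast
  qed
  have "\<exists>\<psi>. lform scale \<psi> \<and> (\<forall>u\<in>R. \<psi> u = g u)"
  proof (rule lform_extend[OF Rcl])
    fix x y assume "x \<in> R" "y \<in> R"
    then obtain u w u' w' where *: "u \<in> U" "w \<in> W" "u' \<in> U" "w' \<in> W" and xy: "x = f u + w" "y = f u' + w'"
      unfolding R_def by blast
    have "x + y = f (u + u') + (w + w')" by (simp add: xy fadd)
    then have "g (x + y) = \<phi> (u + u')" using g[of "u + u'" "w + w'"] * U W by (simp add: subspace_add)
    then show "g (x + y) = g x + g y" using * by (simp add: xy g lformD[OF \<phi>])
  next
    fix c x assume "x \<in> R"
    then obtain u w where *: "u \<in> U" "w \<in> W" and x: "x = f u + w" unfolding R_def by blast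
    have "scale c x = f (scale c u) + scale c w" by (simp add: x fsc scale_right_distrib)
    then have "g (scale c x) = \<phi> (scale c u)" using g[of "scale c u" "scale c w"] * U W by (simp add: subspace_scale)
    then show "g (scale c x) = c * g x" using * by (simp add: x g lformD[OF \<phi>])
  qed
  then obtain \<psi> where \<psi>: "lform scale \<psi>" "\<forall>u\<in>R. \<psi> u = g u" by blast
  have "\<psi> (f u) = \<phi> u" if "u \<in> U" for u
  proof -
    have "f u + 0 \<in> R" using that subspace_0[OF W] unfolding R_def by blast
    then show ?thesis using \<psi>(2) g[OF that subspace_0[OF W]] by simp
  qed
  moreover have "\<psi> w = 0" if "w \<in> W" for w
  proof -
    have "f 0 = 0" using fadd[of 0 0] by simp
    then have "w \<in> R" "g w = \<phi> 0" using that subspace_0[OF U] g[of 0 w] unfolding R_def by force+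
    then show ?thesis using \<psi>(2) lformD(3)[OF \<phi>] by simp
  qed
  ultimately show ?thesis using \<psi>(1) by blast
qed

end

section \<open>Graded representations\<close>

text \<open>Representations of \<open>O(2)\<close> and an exterior algebra, as they arise from comodules: \<open>p i\<close> is the
  projection onto the space of weight \<open>i\<close>, the involution \<open>s\<close> is a reflection, and \<open>X\<close>, \<open>Y\<close> are the
  odd generators of weights \<open>-1\<close> and \<open>1\<close>.  The operators are linear on the whole ambient space, so
  that linearity holds without side conditions and forms can be composed with them; the relations
  hold on \<open>V\<close>.\<close>

locale O2rep = vector_space sm
  for sm :: "'k::field \<Rightarrow> 'm::ab_group_add \<Rightarrow> 'm" +
  fixes V :: "'m set" and p :: "int \<Rightarrow> 'm \<Rightarrow> 'm" and s X Y :: "'m \<Rightarrow> 'm" and K :: nat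
  assumes char: "(2 :: 'k) \<noteq> 0"
    and V: "subspace V"
    and p_lin: "p i (x + y) = p i x + p i y" "p i (sm c x) = sm c (p i x)"
    and s_lin: "s (x + y) = s x + s y" "s (sm c x) = sm c (s x)"
    and X_lin: "X (x + y) = X x + X y" "X (sm c x) = sm c (X x)"
    and Y_lin: "Y (x + y) = Y x + Y y" "Y (sm c x) = sm c (Y x)"
    and into: "x \<in> V \<Longrightarrow> p i x \<in> V" "x \<in> V \<Longrightarrow> s x \<in> V" "x \<in> V \<Longrightarrow> X x \<in> V" "x \<in> V \<Longrightarrow> Y x \<in> V"
    and pp: "x \<in> V \<Longrightarrow> p i (p j x) = (if i = j then p i x else 0)"
    and p_out: "x \<in> V \<Longrightarrow> \<bar>i\<bar> > int K \<Longrightarrow> p i x = 0"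
    and p_sum: "x \<in> V \<Longrightarrow> x = (\<Sum>i\<in>{- int K..int K}. p i x)"
    and ss: "x \<in> V \<Longrightarrow> s (s x) = x"
    and ps: "x \<in> V \<Longrightarrow> p i (s x) = s (p (- i) x)"
    and pX: "x \<in> V \<Longrightarrow> p i (X x) = X (p (i + 1) x)"
    and pY: "x \<in> V \<Longrightarrow> p i (Y x) = Y (p (i - 1) x)"
    and XX: "x \<in> V \<Longrightarrow> X (X x) = 0"
    and YY: "x \<in> V \<Longrightarrow> Y (Y x) = 0"
    and YX: "x \<in> V \<Longrightarrow> Y (X x) = - X (Y x)"
    and Xs: "x \<in> V \<Longrightarrow> X (s x) = s (Y x)"
begin

lemma Ys: "x \<in> V \<Longrightarrow> Y (s x) = s (X x)"
  using Xs[of "s x"] ss into by metis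

lemma zero_diff [simp]: "p i 0 = 0" "s 0 = 0" "X 0 = 0" "Y 0 = 0"
  "p i (- x) = - p i x" "s (- x) = - s x" "X (- x) = - X x" "Y (- x) = - Y x"
  "p i (x - y) = p i x - p i y" "s (x - y) = s x - s y" "X (x - y) = X x - X y" "Y (x - y) = Y x - Y y"
proof -
  have *: "T 0 = 0 \<and> T (- x) = - T x \<and> T (x - y) = T x - T y" if "\<And>x y. T (x + y) = T x + T y" for T :: "'m \<Rightarrow> 'm" and x y
  proof -
    have 0: "T 0 = 0" using that[of 0 0] by simp
    moreover have m: "T (- x) = - T x" for x using that[of x "- x"] 0 by (simp add: eq_neg_iff_add_eq_0 add.commute)
    ultimately show ?thesis using that[of x "- y"] by simp
  qed
  show "p i 0 = 0" "s 0 = 0" "X 0 = 0" "Y 0 = 0"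
  "p i (- x) = - p i x" "s (- x) = - s x" "X (- x) = - X x" "Y (- x) = - Y x"
  "p i (x - y) = p i x - p i y" "s (x - y) = s x - s y" "X (x - y) = X x - X y" "Y (x - y) = Y x - Y y"
    using *[of "p i", OF p_lin(1)] *[of s, OF s_lin(1)] *[of X, OF X_lin(1)] *[of Y, OF Y_lin(1)] by blast+
qed

lemmas lin = p_lin s_lin X_lin Y_lin

lemma in_V [intro]: "0 \<in> V" "x \<in> V \<Longrightarrow> y \<in> V \<Longrightarrow> x + y \<in> V" "x \<in> V \<Longrightarrow> y \<in> V \<Longrightarrow> x - y \<in> V"
  "x \<in> V \<Longrightarrow> sm c x \<in> V" "x \<in> V \<Longrightarrow> - x \<in> V"
  using V by (simp_all add: subspace_0 subspace_add subspace_diff subspace_scale subspace_neg)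

definition stable :: "'m set \<Rightarrow> bool" where
  "stable N \<longleftrightarrow> subspace N \<and> N \<subseteq> V \<and> (\<forall>x\<in>N. (\<forall>i. p i x \<in> N) \<and> s x \<in> N \<and> X x \<in> N \<and> Y x \<in> N)"

definition indecomposable :: bool where
  "indecomposable \<longleftrightarrow> V \<noteq> {0} \<and> (\<forall>N N'. stable N \<and> stable N' \<and> N \<inter> N' = {0} \<and>
     {x + y | x y. x \<in> N \<and> y \<in> N'} = V \<longrightarrow> N = {0} \<or> N' = {0})"

definition sclosed :: "'m set \<Rightarrow> 'm \<Rightarrow> bool" where
  "sclosed B x \<longleftrightarrow> x = 0 \<or> x \<in> B \<or> - x \<in> B"

text \<open>In a basis of this kind the operators are given by matrices with entries \<open>0, \<plusminus>1\<close>, at most one in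
  each column.\<close>

definition monomial :: "'m set \<Rightarrow> bool" where
  "monomial B \<longleftrightarrow> B \<subseteq> V \<and> (\<forall>b\<in>B. (\<exists>i. p i b = b) \<and> sclosed B (s b) \<and> sclosed B (X b) \<and> sclosed B (Y b))"

lemma sclosed_span: "sclosed B x \<Longrightarrow> x \<in> span B"
  unfolding sclosed_def using span_base span_zero span_neg by (metis minus_minus)

lemma monomial_stable:
  assumes "monomial B" shows "stable (span B)"
proof -
  have closed: "T x \<in> span B" if "\<And>b. b \<in> B \<Longrightarrow> T b \<in> span B" "x \<in> span B"
    "\<And>x y. T (x + y) = T x + T y" "\<And>c x. T (sm c x) = sm c (T x)" for T x
    using that(2)
  proof (induction rule: span_induct_alt)
    case base
    have "T 0 = 0" using that(3)[of 0 0] by simp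
    then show ?case by (simp add: span_zero)
  qed (simp add: that span_add span_scale)
  have pB: "p i b \<in> span B" if b: "b \<in> B" for b i
  proof -
    obtain j where j: "p j b = b" and "b \<in> V" using assms b by (auto simp: monomial_def)
    then have "p i b = (if i = j then b else 0)" using pp[of b i j] by auto
    then show ?thesis using b by (simp add: span_base span_zero)
  qed
  have "span B \<subseteq> V" using assms V by (auto simp: monomial_def intro: span_minimal[THEN subsetD])
  have "s b \<in> span B" "X b \<in> span B" "Y b \<in> span B" if "b \<in> B" for b
    using assms that by (auto simp: monomial_def intro: sclosed_span)
  with pB have "p i x \<in> span B" "s x \<in> span B" "X x \<in> span B" "Y x \<in> span B" if "x \<in> span B" for x i
    using closed[of "p i" x] closed[of s x] closed[of X x] closed[of Y x] that by (simp_all add: lin)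
  then show ?thesis using \<open>span B \<subseteq> V\<close> by (simp add: stable_def)
qed

text \<open>The forms \<open>\<psi>\<close> are the coefficients of a projection onto the span of the vectors \<open>b\<close>, whose
  kernel \<open>Q\<close> is a complement.  As both are stable, \<open>Q = {0}\<close>.\<close>

lemma split_off:
  assumes ind: indecomposable and J: "finite J" "J \<noteq> {}"
    and mono: "monomial (b ` J)"
    and \<psi>: "\<And>j. j \<in> J \<Longrightarrow> lform sm (\<psi> j)"
    and bi: "\<And>i j. i \<in> J \<Longrightarrow> j \<in> J \<Longrightarrow> \<psi> i (b j) = (if i = j then 1 else 0)"
    and Q: "stable {v \<in> V. \<forall>j\<in>J. \<psi> j v = 0}"
  shows "independent (b ` J) \<and> span (b ` J) = V \<and> monomial (b ` J) \<and> finite (b ` J) \<and> card (b ` J) \<le> card J"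
proof -
  let ?P = "span (b ` J)" and ?Q = "{v \<in> V. \<forall>j\<in>J. \<psi> j v = 0}"
  have bV: "b j \<in> V" if "j \<in> J" for j using mono that by (auto simp: monomial_def)
  have P: "stable ?P" using mono by (rule monomial_stable)
  have inj: "inj_on b J"
    using bi by (intro inj_onI) (metis zero_neq_one)
  define E where "E v = (\<Sum>j\<in>J. sm (\<psi> j v) (b j))" for v
  have E\<psi>: "\<psi> i (E v) = \<psi> i v" if "i \<in> J" for i v
    using J(1) that by (simp add: E_def lformD[OF \<psi>[OF that]] bi if_distrib cong: if_cong)
  have EP: "E v \<in> ?P" for v unfolding E_def by (intro span_sum span_scale span_base) auto
  have EV: "E v \<in> V" for v using P EP by (auto simp: stable_def)
  have EQ: "v - E v \<in> ?Q" if "v \<in> V" for v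
    using that EV by (auto simp: lformD[OF \<psi>] E\<psi>)
  have E_id: "E x = x" if "x \<in> ?P" for x
    using that
  proof (induction rule: span_induct_alt)
    case base
    show ?case by (simp add: E_def lformD[OF \<psi>])
  next
    case (step c x y)
    then obtain j where j: "j \<in> J" "x = b j" by blast
    have "E x = x" using J(1) j by (simp add: E_def bi if_distrib[of "\<lambda>c. sm c _"] cong: if_cong)
    moreover have "E (sm c x + y) = sm c (E x) + E y"
      by (simp add: E_def lformD[OF \<psi>] scale_left_distrib sum.distrib scale_sum_right)
    ultimately show ?case using step by simp
  qed
  have "?P \<inter> ?Q = {0}"
  proof safe
    fix x assume x: "x \<in> ?P" "\<forall>j\<in>J. \<psi> j x = 0"
    then have "E x = 0" by (simp add: E_def)
    then show "x = 0" using E_id[OF x(1)] by simp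
  qed (auto simp: span_zero lformD[OF \<psi>])
  moreover have "{x + y | x y. x \<in> ?P \<and> y \<in> ?Q} = V"
  proof
    show "{x + y | x y. x \<in> ?P \<and> y \<in> ?Q} \<subseteq> V" using P by (auto simp: stable_def)
    show "V \<subseteq> {x + y | x y. x \<in> ?P \<and> y \<in> ?Q}"
    proof
      fix v assume "v \<in> V"
      then have "v = E v + (v - E v)" "E v \<in> ?P" "v - E v \<in> ?Q" using EP EQ by auto
      then show "v \<in> {x + y | x y. x \<in> ?P \<and> y \<in> ?Q}" by blast
    qed
  qed
  ultimately have "?P = {0} \<or> ?Q = {0}" using ind P Q unfolding indecomposable_def by blast
  moreover have "?P \<noteq> {0}"
  proof -
    obtain j where j: "j \<in> J" using J(2) by blast
    have "b j \<noteq> 0" using bi[OF j j] lformD(3)[OF \<psi>[OF j]] by auto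
    then show ?thesis using j span_base[of "b j" "b ` J"] by blast
  qed
  ultimately have Q0: "?Q = {0}" by blast
  have "v \<in> ?P" if "v \<in> V" for v
    using EQ[OF that] EP[of v] Q0 by auto
  then have "?P = V" using P by (auto simp: stable_def)
  moreover have "independent (b ` J)"
  proof (rule independent_if_scalars_zero)
    fix f x assume sum0: "(\<Sum>x\<in>b ` J. sm (f x) x) = 0" and "x \<in> b ` J"
    then obtain i where i: "i \<in> J" "x = b i" by blast
    have "0 = \<psi> i (\<Sum>j\<in>J. sm (f (b j)) (b j))"
      using sum0 by (simp add: sum.reindex[OF inj] lformD[OF \<psi>[OF i(1)]])
    also have "\<dots> = f x"
      using J(1) i by (simp add: lformD[OF \<psi>[OF i(1)]] bi if_distrib cong: if_cong)
    finally show "f x = 0" by simp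
  qed (use J in auto)
  ultimately show ?thesis using mono J(1) by (auto intro: card_image_le)
qed

end

context O2rep
begin

definition monomial_basis :: "nat \<Rightarrow> 'm set \<Rightarrow> bool" where
  "monomial_basis n B \<longleftrightarrow> independent B \<and> span B = V \<and> monomial B \<and> finite B \<and> card B \<le> n"

lemma stable_kernel:
  assumes \<psi>: "\<And>j. j \<in> J \<Longrightarrow> lform sm (\<psi> j)"
    and "\<And>v j k. v \<in> V \<Longrightarrow> (\<And>j. j \<in> J \<Longrightarrow> \<psi> j v = 0) \<Longrightarrow> j \<in> J \<Longrightarrow>
      \<psi> j (p k v) = 0 \<and> \<psi> j (s v) = 0 \<and> \<psi> j (X v) = 0 \<and> \<psi> j (Y v) = 0"
  shows "stable {v \<in> V. \<forall>j\<in>J. \<psi> j v = 0}"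
  unfolding stable_def subspace_def using assms(2)
  by (auto simp: lformD[OF \<psi>] into)

lemma shift_p: "x \<in> V \<Longrightarrow> X (p j x) = p (j - 1) (X x)" "x \<in> V \<Longrightarrow> Y (p j x) = p (j + 1) (Y x)"
  "x \<in> V \<Longrightarrow> s (p j x) = p (- j) (s x)"
  using pX[of x "j - 1"] pY[of x "j + 1"] ps[of x "- j"] by simp_all

subsection \<open>Summands on which \<open>XY\<close> does not vanish\<close>

fun mon :: "lam \<Rightarrow> 'm \<Rightarrow> 'm" where
  "mon L1 v = v" | "mon Lu v = X v" | "mon Lv v = Y v" | "mon Luv v = X (Y v)"

text \<open>If a form takes the value \<open>1\<close> on \<open>X (Y m)\<close> and \<open>0\<close> on \<open>m\<close>, then its compositions with these
  operators are dual to \<open>m, X m, Y m, X (Y m)\<close> on a given weight: the exterior algebra is a Frobenius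
  algebra.\<close>

fun dual_mon :: "lam \<Rightarrow> 'm \<Rightarrow> 'm" where
  "dual_mon L1 v = X (Y v)" | "dual_mon Lu v = - Y v" | "dual_mon Lv v = X v" | "dual_mon Luv v = v"

lemma lform_dual_mon:
  assumes "lform sm \<phi>" shows "lform sm (\<lambda>v. \<phi> (p i (dual_mon l v)))"
  unfolding lform_def by (cases l) (simp_all add: lformD[OF assms] lin)

lemma lform_comp_s: "lform sm \<phi> \<Longrightarrow> lform sm (\<lambda>v. \<phi> (s v))"
  by (simp add: lform_def lin)

lemma UNIV_lam: "UNIV = {L1, Lu, Lv, Luv}"
  using lam.exhaust by auto

text \<open>The generators \<open>m\<close> and \<open>s m\<close> have different weights, so \<open>m\<close> and its mirror image contribute four
  basis vectors each.  Coincidences between the weights of the two halves are harmless: they occur for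
  \<open>i = \<plusminus>1\<close> only, and there \<open>X\<^sup>2 = Y\<^sup>2 = 0\<close> makes the pairing vanish.\<close>

lemma projective_summand_nonzero:
  assumes ind: indecomposable and m: "m \<in> V" "p i m = m" "X (Y m) \<noteq> 0" and i: "i \<noteq> 0"
  shows "\<exists>B. monomial_basis 8 B"
proof -
  have pm: "p j m = (if j = i then m else 0)" for j using pp[of m j i] m by auto
  have odd: "1 - i = i \<longleftrightarrow> False" "- i - 1 = i \<longleftrightarrow> False" "- 1 - i = i \<longleftrightarrow> False" "- i = i \<longleftrightarrow> False"
    "1 + - i = i \<longleftrightarrow> False" "- i + 1 = i \<longleftrightarrow> False"
    using i by presburger+
  have "m \<notin> span {X (Y m)}"
  proof
    assume "m \<in> span {X (Y m)}"
    then obtain c where "m = sm c (X (Y m))" by (auto simp: span_singleton)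
    then have "Y m = Y (sm c (X (Y m)))" by simp
    then have "Y m = 0" using m by (simp add: lin YX into YY)
    then show False using m(3) by simp
  qed
  have "X (Y m) \<notin> span {m}"
  proof
    assume "X (Y m) \<in> span {m}"
    then obtain c where c: "X (Y m) = sm c m" by (auto simp: span_singleton)
    then have "c \<noteq> 0" using m(3) by auto
    moreover have "X (X (Y m)) = sm c (X m)" by (simp add: c lin)
    ultimately have "X m = 0" using m by (simp add: XX into)
    then have "Y (X m) = 0" by simp
    then show False using m by (simp add: YX)
  qed
  then obtain \<phi> where \<phi>: "lform sm \<phi>" "\<phi> (X (Y m)) = 1" "\<phi> m = 0"
    using lform_separate[of "span {m}" "X (Y m)"] span_base[of m "{m}"] by (auto simp: subspace_span)
  note \<phi>D = lformD[OF \<phi>(1)]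
  define b where "b = (\<lambda>(l, \<sigma>). if \<sigma> then s (mon l m) else mon l m)"
  define \<psi> where "\<psi> = (\<lambda>(l, \<sigma>) v. \<phi> (p i (dual_mon l (if \<sigma> then s v else v))))"
  have \<psi>l: "lform sm (\<psi> j)" for j
    using lform_dual_mon[OF \<phi>(1), of i "fst j"] lform_comp_s[OF lform_dual_mon[OF \<phi>(1), of i "fst j"]]
    by (cases j; cases "snd j") (auto simp: \<psi>_def)
  have bi: "\<psi> j (b j') = (if j = j' then 1 else 0)" for j j'
    by (cases j; cases j'; cases "fst j"; cases "fst j'"; cases "snd j"; cases "snd j'")
      (simp_all add: \<psi>_def b_def m into XX YY YX Xs Ys ss pX pY ps pm \<phi> \<phi>D odd i)
  let ?B = "b ` UNIV"
  have mem: "mon l m \<in> ?B" "s (mon l m) \<in> ?B" for l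
    by (rule image_eqI[of _ _ "(l, False)"], simp add: b_def, simp,
        rule image_eqI[of _ _ "(l, True)"], simp add: b_def, simp)
  note mem' = mem[of L1] mem[of Lu] mem[of Lv] mem[of Luv]
  have "monomial ?B"
    unfolding monomial_def
  proof (intro conjI ballI)
    show "?B \<subseteq> V"
      by (auto simp: b_def m into split: if_splits) (case_tac a; simp add: m into)+
    fix x assume "x \<in> ?B"
    then obtain l \<sigma> where x: "x = b (l, \<sigma>)" by auto
    have "p (if \<sigma> then - j else j) x = x" if "j = (case l of L1 \<Rightarrow> i | Luv \<Rightarrow> i | Lu \<Rightarrow> i - 1 | Lv \<Rightarrow> i + 1)" for j
      unfolding x using that by (cases l; cases \<sigma>) (simp_all add: b_def m into ps pX pY pm)
    then show "\<exists>i. p i x = x" by blast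
    show "sclosed ?B (s x)" "sclosed ?B (X x)" "sclosed ?B (Y x)"
      unfolding x sclosed_def using mem'
      by (cases l; cases \<sigma>; simp add: b_def m into XX YY YX Xs Ys ss)+
  qed
  moreover have "stable {v \<in> V. \<forall>j\<in>UNIV. \<psi> j v = 0}"
  proof (rule stable_kernel[OF \<psi>l])
    fix v j k assume v: "v \<in> V" "\<And>j. j \<in> UNIV \<Longrightarrow> \<psi> j v = 0"
    have "\<psi> (l, \<sigma>) v = 0" for l \<sigma> using v(2) by simp
    note * = this[of L1 False] this[of Lu False] this[of Lv False] this[of Luv False]
      this[of L1 True] this[of Lu True] this[of Lv True] this[of Luv True]
    show "\<psi> j (p k v) = 0 \<and> \<psi> j (s v) = 0 \<and> \<psi> j (X v) = 0 \<and> \<psi> j (Y v) = 0"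
      using * v(1)
      by (cases j; cases "fst j"; cases "snd j")
        (simp_all add: \<psi>_def \<phi>D into XX YY YX Xs Ys ss shift_p pp, auto)
  qed
  ultimately have "independent ?B \<and> span ?B = V \<and> monomial ?B \<and> finite ?B \<and> card ?B \<le> card (UNIV :: (lam \<times> bool) set)"
    using bi by (intro split_off[OF ind _ _ _ \<psi>l]) (auto simp: UNIV_lam finite_Prod_UNIV)
  moreover have "card (UNIV :: (lam \<times> bool) set) = 8"
    by (simp add: UNIV_Times_UNIV[symmetric] card_cartesian_product UNIV_lam del: UNIV_Times_UNIV)
  ultimately show ?thesis unfolding monomial_basis_def by metis
qed

text \<open>Here the generator is an eigenvector of \<open>s\<close>, and its four multiples are permuted by \<open>s\<close> up to
  sign.\<close>

lemma projective_summand_zero: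
  assumes ind: indecomposable and m: "m \<in> V" "p 0 m = m" "X (Y m) \<noteq> 0" and e: "s m = sm e m" "e * e = 1"
  shows "\<exists>B. monomial_basis 8 B"
proof -
  have e': "e = 1 \<or> e = - 1" using e(2) by (metis mult_1_right square_eq_iff)
  have pm: "p j m = (if j = 0 then m else 0)" for j using pp[of m j 0] m by auto
  have sX: "s (X m) = sm e (Y m)" "s (Y m) = sm e (X m)" "s (X (Y m)) = sm (- e) (X (Y m))"
  proof -
    have "s (X m) = Y (s m)" using Ys m by simp
    then show *: "s (X m) = sm e (Y m)" by (simp add: e lin)
    have "s (Y m) = X (s m)" using Xs m by simp
    then show "s (Y m) = sm e (X m)" by (simp add: e lin)
    have "s (X (Y m)) = Y (s (Y m))" using Ys m into by simp
    also have "\<dots> = Y (sm e (X m))" by (simp add: \<open>s (Y m) = sm e (X m)\<close>)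
    finally show "s (X (Y m)) = sm (- e) (X (Y m))" using m by (simp add: lin YX)
  qed
  obtain \<phi>0 where \<phi>0: "lform sm \<phi>0" "\<phi>0 (X (Y m)) = 1"
    using lform_separate[of "{0}" "X (Y m)"] m(3) by (auto simp: subspace_def)
  \<comment> \<open>Averaging turns the form into an eigenform of \<open>s\<close>, which makes its kernel conditions \<open>s\<close>-stable; the
    eigenvalue must be that of \<open>X (Y m)\<close>, namely \<open>- e\<close>.\<close>
  define h where "h = inverse (2 :: 'k)"
  have h: "h * (1 + 1) = 1" using char by (simp add: h_def)
  define \<phi> where "\<phi> v = h * (\<phi>0 v - e * \<phi>0 (s v))" for v
  have \<phi>l: "lform sm \<phi>"
    by (simp add: lform_def \<phi>_def lformD[OF \<phi>0(1)] lin algebra_simps)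
  note \<phi>D = lformD[OF \<phi>l]
  have "\<phi> (X (Y m)) = h * (1 + e * e)"
    by (simp add: \<phi>_def sX \<phi>0 lformD[OF \<phi>0(1)])
  then have \<phi>1: "\<phi> (X (Y m)) = 1" using e(2) h by simp
  have \<phi>m: "\<phi> m = 0"
  proof -
    have "\<phi> m = h * (\<phi>0 m - e * e * \<phi>0 m)" by (simp add: \<phi>_def e(1) lformD[OF \<phi>0(1)])
    then show ?thesis using e(2) by simp
  qed
  have \<phi>s: "\<phi> (s v) = - e * \<phi> v" if "v \<in> V" for v
  proof -
    have "- e * \<phi> v = h * (e * e * \<phi>0 (s v) - e * \<phi>0 v)"
      by (simp add: \<phi>_def algebra_simps)
    then show ?thesis using e(2) that by (simp only: \<phi>_def ss mult_1_left)
  qed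
  define b where "b l = mon l m" for l
  define \<psi> where "\<psi> l v = \<phi> (p 0 (dual_mon l v))" for l v
  have \<psi>l: "lform sm (\<psi> j)" for j
    using lform_dual_mon[OF \<phi>l, of 0 j] by (simp add: \<psi>_def[abs_def])
  have bi: "\<psi> j (b j') = (if j = j' then 1 else 0)" for j j'
    by (cases j; cases j')
      (simp_all add: \<psi>_def b_def m into XX YY YX ss pX pY ps pm \<phi>1 \<phi>m \<phi>D)
  let ?B = "b ` UNIV"
  have mem: "mon l m \<in> ?B" for l by (auto simp: b_def)
  note mem' = mem[of L1] mem[of Lu] mem[of Lv] mem[of Luv]
  have "monomial ?B"
    unfolding monomial_def
  proof (intro conjI ballI)
    show "?B \<subseteq> V" by (auto simp: b_def) (case_tac xa; simp add: m into)
    fix x assume "x \<in> ?B"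
    then obtain l where x: "x = b l" by auto
    have "p j x = x" if "j = (case l of L1 \<Rightarrow> 0 | Luv \<Rightarrow> 0 | Lu \<Rightarrow> - 1 | Lv \<Rightarrow> 1)" for j
      unfolding x using that by (cases l) (simp_all add: b_def m into ps pX pY pm)
    then show "\<exists>i. p i x = x" by blast
    show "sclosed ?B (s x)" "sclosed ?B (X x)" "sclosed ?B (Y x)"
      unfolding x sclosed_def using mem' e'
      by (cases l; auto simp: b_def m into XX YY YX e(1) sX)+
  qed
  moreover have "stable {v \<in> V. \<forall>j\<in>UNIV. \<psi> j v = 0}"
  proof (rule stable_kernel[OF \<psi>l])
    fix v j k assume v: "v \<in> V" "\<And>j. j \<in> UNIV \<Longrightarrow> \<psi> j v = 0"
    have "\<psi> l v = 0" for l using v(2) by simp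
    note * = this[of L1] this[of Lu] this[of Lv] this[of Luv]
    have sp: "\<phi> (p 0 (s w)) = - e * \<phi> (p 0 w)" if "w \<in> V" for w
      using \<phi>s[of "p 0 w"] that by (simp add: ps into)
    show "\<psi> j (p k v) = 0 \<and> \<psi> j (s v) = 0 \<and> \<psi> j (X v) = 0 \<and> \<psi> j (Y v) = 0"
      using * v(1)
      by (cases j) (simp_all add: \<psi>_def \<phi>D into XX YY YX Xs Ys ss shift_p pp sp)
  qed
  ultimately have "independent ?B \<and> span ?B = V \<and> monomial ?B \<and> finite ?B \<and> card ?B \<le> card (UNIV :: lam set)"
    using bi by (intro split_off[OF ind _ _ _ \<psi>l]) (auto simp: UNIV_lam)
  moreover have "card (UNIV :: lam set) \<le> 8" by (simp add: UNIV_lam)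
  ultimately have "monomial_basis 8 ?B" unfolding monomial_basis_def using le_trans by blast
  then show ?thesis by blast
qed

text \<open>In weight zero, \<open>m\<close> is replaced by one of the eigenvectors \<open>m \<plusminus> s m\<close>, whose sum is \<open>2 m\<close>.\<close>

lemma projective_case:
  assumes ind: indecomposable and "v \<in> V" "X (Y v) \<noteq> 0"
  shows "\<exists>B. monomial_basis 8 B"
proof -
  have sumT: "X (Y (sum f F)) = (\<Sum>i\<in>F. X (Y (f i)))" for f and F :: "int set"
    by (induction F rule: infinite_finite_induct) (simp_all add: lin)
  have "X (Y v) = (\<Sum>i\<in>{- int K..int K}. X (Y (p i v)))"
    using arg_cong[OF p_sum[OF assms(2)], of "\<lambda>v. X (Y v)"] by (simp only: sumT)
  then obtain i where i: "X (Y (p i v)) \<noteq> 0" using assms(3) by (metis sum.neutral)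
  define m where "m = p i v"
  have m: "m \<in> V" "p i m = m" "X (Y m) \<noteq> 0" using assms(2) i by (simp_all add: m_def into pp)
  show ?thesis
  proof (cases "i = 0")
    case False
    then show ?thesis using projective_summand_nonzero[OF ind m] by blast
  next
    case True
    have "X (Y (m + s m)) + X (Y (m - s m)) = sm 2 (X (Y m))"
      using scale_left_distrib[of 1 1 "X (Y m)"] by (simp add: lin)
    then have "X (Y (m + s m)) \<noteq> 0 \<or> X (Y (m - s m)) \<noteq> 0" using m(3) char by auto
    moreover have "s (m + s m) = sm 1 (m + s m)" "s (m - s m) = sm (- 1) (m - s m)"
      "p 0 (m + s m) = m + s m" "p 0 (m - s m) = m - s m"
      using m True by (simp_all add: lin ss ps)
    moreover have "m + s m \<in> V" "m - s m \<in> V" using m by (auto simp: into)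
    ultimately show ?thesis using projective_summand_zero[OF ind] by fastforce
  qed
qed

end

subsection \<open>Separating tops from socles\<close>

context vector_space
begin

lemma projection_exists:
  assumes "subspace W"
  shows "\<exists>q. (\<forall>x y. q (x + y) = q x + q y) \<and> (\<forall>c x. q (scale c x) = scale c (q x)) \<and> range q \<subseteq> W \<and> (\<forall>w\<in>W. q w = w)"
proof -
  interpret vp: vector_space_pair scale scale
    by (intro vector_space_pair.intro vector_space_axioms)
  obtain B where B: "B \<subseteq> W" "independent B" "W \<subseteq> span B" using maximal_independent_subset by blast
  obtain q where q: "Vector_Spaces.linear scale scale q" "\<forall>x\<in>B. q x = id x" "range q = span (id ` B)"
    using vp.linear_independent_extend_subspace[OF B(2), of id] by blast
  have lin: "q (x + y) = q x + q y" "q (scale c x) = scale c (q x)" for x y c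
    using q(1) by (simp_all add: Vector_Spaces.linear_iff)
  have "q 0 = 0" using lin(2)[of 0 0] by simp
  have "q w = w" if "w \<in> span B" for w
    using that by (induction rule: span_induct_alt) (use q(2) \<open>q 0 = 0\<close> in \<open>auto simp: lin\<close>)
  then show ?thesis using lin q(3) B span_minimal[OF B(1) assms] by (intro exI[of _ q]) auto
qed

end

context O2rep
begin

lemma lin_sum: "p j (sum f F) = (\<Sum>i\<in>F. p j (f i))" "s (sum f F) = (\<Sum>i\<in>F. s (f i))"
  by (induction F rule: infinite_finite_induct) (simp_all add: lin)

lemma sum_V: "(\<And>i. i \<in> F \<Longrightarrow> f i \<in> V) \<Longrightarrow> sum f F \<in> V"
  by (rule subspace_sum[OF V])

text \<open>Let \<open>Z\<close> be the common kernel of \<open>X\<close> and \<open>Y\<close>, which contains their images because \<open>XY = 0\<close>.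
  Averaging a projection onto \<open>Z\<close> over the grading and over \<open>s\<close> yields an equivariant complement \<open>C\<close>.
  The operators lead from the even part of \<open>C\<close> to the odd part of \<open>Z\<close> and vice versa, so \<open>V\<close> is the sum
  of two subrepresentations, one of which is zero by indecomposability.\<close>

lemma parity_split:
  assumes ind: indecomposable and XY: "\<And>v. v \<in> V \<Longrightarrow> X (Y v) = 0"
  shows "\<exists>c. \<forall>v\<in>V. \<forall>i. even i \<noteq> c \<longrightarrow> X (p i v) = 0 \<and> Y (p i v) = 0"
proof -
  define Z where "Z = {z \<in> V. X z = 0 \<and> Y z = 0}"
  have Zs: "subspace Z" unfolding Z_def subspace_def using V by (auto simp: lin subspace_0)
  have ZV: "z \<in> V" if "z \<in> Z" for z using that by (simp add: Z_def)
  have pZ: "p i z \<in> Z" and sZ: "s z \<in> Z" if "z \<in> Z" for i z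
    using that by (auto simp: Z_def into shift_p Xs Ys)
  obtain q where qe: "\<forall>x y. q (x + y) = q x + q y" "\<forall>c x. q (sm c x) = sm c (q x)" "range q \<subseteq> Z"
    "\<forall>z\<in>Z. q z = z"
    using projection_exists[OF Zs] by metis
  have q: "q (x + y) = q x + q y" "q (sm c x) = sm c (q x)" "q x \<in> Z" "z \<in> Z \<Longrightarrow> q z = z" for x y z c
    using qe by blast+
  have q0: "q 0 = 0" using q(2)[of 0 0] by simp
  let ?I = "{- int K..int K}"
  define A where "A v = (\<Sum>i\<in>?I. p i (q (p i v)))" for v
  define h where "h = inverse (2 :: 'k)"
  have h: "sm h (x + x) = x" for x
    using scale_left_distrib[of 1 1 x, symmetric] char by (simp add: h_def)
  define q' where "q' v = sm h (A v + s (A (s v)))" for v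
  have A_lin: "A (x + y) = A x + A y" for x y by (simp add: A_def lin q sum.distrib)
  have AZ: "A v \<in> Z" for v unfolding A_def by (intro subspace_sum[OF Zs] pZ q(3))
  have A_id: "A z = z" if "z \<in> Z" for z
  proof -
    have "A z = (\<Sum>i\<in>?I. p i z)" unfolding A_def
      by (rule sum.cong) (simp_all add: q(4) pZ that pp ZV)
    then show ?thesis using p_sum[OF ZV[OF that]] by simp
  qed
  have Ap: "p j (A v) = A (p j v)" if v: "v \<in> V" for j v
  proof (cases "j \<in> ?I")
    case True
    have "p j (A v) = (\<Sum>i\<in>?I. if i = j then p j (q (p j v)) else 0)"
      unfolding A_def lin_sum by (rule sum.cong) (auto simp: pp ZV q(3))
    moreover have "A (p j v) = (\<Sum>i\<in>?I. if i = j then p j (q (p j v)) else 0)"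
      unfolding A_def by (rule sum.cong) (auto simp: pp v q0)
    ultimately show ?thesis by simp
  next
    case False
    then have "p j v = 0" "p j (A v) = 0" using p_out v ZV[OF AZ] by auto
    then show ?thesis by (simp add: A_def q0)
  qed
  have q'_lin: "q' (x + y) = q' x + q' y" for x y
    by (simp add: q'_def lin A_lin scale_right_distrib)
  have q'_0: "q' 0 = 0" using q'_lin[of 0 0] by simp
  have q'_diff: "q' (x - y) = q' x - q' y" for x y using q'_lin[of "x - y" y] by (simp add: algebra_simps)
  have q'Z: "q' v \<in> Z" for v unfolding q'_def
    by (intro subspace_scale[OF Zs] subspace_add[OF Zs] sZ AZ)
  have q'_id: "q' z = z" if "z \<in> Z" for z
    using that by (simp add: q'_def A_id sZ ss ZV h)
  have q'p: "p j (q' v) = q' (p j v)" if v: "v \<in> V" for j v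
    using v by (simp add: q'_def lin Ap ps into ZV AZ)
  have q's: "s (q' v) = q' (s v)" if v: "v \<in> V" for v
    using v by (simp add: q'_def lin ss ZV AZ add.commute)
  \<comment> \<open>\<open>N c\<close> consists of \<open>C\<close> in the weights of one parity and of \<open>Z\<close> in those of the other.\<close>
  define N where "N c = {v \<in> V. \<forall>i. q' (p i v) = (if even i = c then 0 else p i v)}" for c
  have N_Z: "p i v \<in> Z" if "v \<in> N c" "even i \<noteq> c" for v i c
    using that q'Z[of "p i v"] by (auto simp: N_def)
  have N_sub: "subspace (N c)" for c
  proof -
    have sc: "q' (sm r x) = sm r (q' x)" for r x
      by (simp add: q'_def A_def lin q(2) scale_sum_right[symmetric] scale_right_distrib[symmetric] mult.commute)
    show ?thesis unfolding N_def subspace_def using V by (auto simp: lin q'_lin q'_0 sc subspace_0)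
  qed
  have N_stable: "stable (N c)" for c
    unfolding stable_def
  proof (intro conjI ballI allI N_sub)
    show "N c \<subseteq> V" by (auto simp: N_def)
    fix v assume v: "v \<in> N c"
    then have vV: "v \<in> V" by (simp add: N_def)
    have vq: "q' (p i v) = (if even i = c then 0 else p i v)" for i using v by (simp add: N_def)
    show "p k v \<in> N c" for k using vq by (auto simp: N_def into vV pp q'_0)
    show "s v \<in> N c"
      using vq by (auto simp: N_def into vV ps q's[symmetric])
    have in_Z: "X w \<in> Z" "Y w \<in> Z" if "w \<in> V" for w
      using that XY by (auto simp: Z_def into XX YY YX)
    have "q' (X (p (i + 1) v)) = (if even i = c then 0 else X (p (i + 1) v))" for i
      using N_Z[OF v, of "i + 1"] q'_id[OF in_Z(1)[OF into(1)[OF vV]]] by (auto simp: Z_def q'_0)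
    then show "X v \<in> N c" by (auto simp: N_def into vV pX)
    have "q' (Y (p (i - 1) v)) = (if even i = c then 0 else Y (p (i - 1) v))" for i
      using N_Z[OF v, of "i - 1"] q'_id[OF in_Z(2)[OF into(1)[OF vV]]] by (auto simp: Z_def q'_0)
    then show "Y v \<in> N c" by (auto simp: N_def into vV pY)
  qed
  have "N True \<inter> N False = {0}"
  proof safe
    fix v assume v: "v \<in> N True" "v \<in> N False"
    have "p i v = 0" for i using v by (auto simp: N_def split: if_splits)
    then show "v = 0" using p_sum[of v] v by (simp add: N_def)
  qed (use N_sub subspace_0 in blast)+
  moreover have "{x + y | x y. x \<in> N True \<and> y \<in> N False} = V"
  proof
    show "{x + y | x y. x \<in> N True \<and> y \<in> N False} \<subseteq> V" by (auto simp: N_def)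
    show "V \<subseteq> {x + y | x y. x \<in> N True \<and> y \<in> N False}"
    proof
      fix v assume v: "v \<in> V"
      define t where "t c i = (if even i = c then p i v - q' (p i v) else q' (p i v))" for c i
      define a where "a c = (\<Sum>i\<in>?I. t c i)" for c
      have tV: "t c i \<in> V" for c i using v ZV[OF q'Z] by (auto simp: t_def into)
      have pt: "p j (t c i) = (if i = j then t c i else 0)" for c i j
        using v by (auto simp: t_def into pp q'p q'_0)
      have pa: "p j (a c) = t c j" for c j
      proof (cases "j \<in> ?I")
        case True
        then show ?thesis by (simp add: a_def lin_sum pt)
      next
        case False
        then have "p j v = 0" using p_out v by auto
        then have "t c j = 0" by (simp add: t_def q'_0)
        then show ?thesis unfolding a_def lin_sum pt by (simp add: sum.delta)
      qed
      have "a c \<in> V" for c using sum_V[of ?I "t c"] tV by (simp add: a_def)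
      then have "a c \<in> N c" for c
        by (auto simp: N_def pa t_def q'_diff q'_id q'Z)
      moreover have "v = a True + a False"
      proof -
        have "a True + a False = (\<Sum>i\<in>?I. p i v)"
          unfolding a_def sum.distrib[symmetric] by (rule sum.cong) (auto simp: t_def)
        then show ?thesis using p_sum[OF v] by simp
      qed
      ultimately show "v \<in> {x + y | x y. x \<in> N True \<and> y \<in> N False}" by blast
    qed
  qed
  ultimately have "N True = {0} \<or> N False = {0}"
    using ind N_stable unfolding indecomposable_def by blast
  then obtain c where "N (\<not> c) = {0}" by (metis (full_types))
  with \<open>{x + y | x y. x \<in> N True \<and> y \<in> N False} = V\<close> have "V \<subseteq> N c" by (cases c) auto
  then show ?thesis using N_Z by (intro exI[of _ c]) (auto simp: Z_def)
qed

end

subsection \<open>Strands\<close>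

text \<open>Weights of the parity \<open>par\<close> are sources, the others are sinks: arrows \<open>X\<close> and \<open>Y\<close> lead from sources
  to the neighbouring sinks.\<close>

locale O2string = O2rep sm V p s X Y K
  for sm :: "'k::field \<Rightarrow> 'm::ab_group_add \<Rightarrow> 'm" and V p s X Y K +
  fixes par :: bool
  assumes sink: "x \<in> V \<Longrightarrow> even i \<noteq> par \<Longrightarrow> X (p i x) = 0" "x \<in> V \<Longrightarrow> even i \<noteq> par \<Longrightarrow> Y (p i x) = 0"
begin

abbreviation src :: "int \<Rightarrow> bool" where "src i \<equiv> even i = par"

definition Wt :: "int \<Rightarrow> 'm set" where "Wt i = {x \<in> V. p i x = x}"

lemma Wt_subspace: "subspace (Wt i)"
  unfolding Wt_def subspace_def using V by (auto simp: lin subspace_0)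

lemma WtV: "x \<in> Wt i \<Longrightarrow> x \<in> V" and Wtp: "x \<in> Wt i \<Longrightarrow> p j x = (if j = i then x else 0)"
  and p_Wt: "x \<in> V \<Longrightarrow> p i x \<in> Wt i"
  using pp by (auto simp: Wt_def into) (metis pp)+

lemma Wt_ops: "x \<in> Wt i \<Longrightarrow> s x \<in> Wt (- i)" "x \<in> Wt i \<Longrightarrow> X x \<in> Wt (i - 1)" "x \<in> Wt i \<Longrightarrow> Y x \<in> Wt (i + 1)"
  by (auto simp: Wt_def into ps pX pY)

lemma sink_Wt: "x \<in> Wt i \<Longrightarrow> \<not> src i \<Longrightarrow> X x = 0" "x \<in> Wt i \<Longrightarrow> \<not> src i \<Longrightarrow> Y x = 0"
  using sink[of x i] by (auto simp: Wt_def)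

lemma Wt_out: "\<bar>i\<bar> > int K \<Longrightarrow> Wt i = {0}"
  using p_out subspace_0[OF V] by (auto simp: Wt_def)

text \<open>A strand follows the zigzag from weight \<open>a\<close> to \<open>a + l\<close>.  Neighbouring vectors are related by the arrow
  between their weights, the forms by its transpose, and the zigzag stops at the far end: at a source
  the next arrow kills the vector, at a sink the form kills the image of the next arrow.\<close>

definition strand :: "int \<Rightarrow> nat \<Rightarrow> (nat \<Rightarrow> 'm) \<Rightarrow> (nat \<Rightarrow> 'm \<Rightarrow> 'k) \<Rightarrow> bool" where
  "strand a l x \<phi> \<longleftrightarrow>
     (\<forall>i\<le>l. x i \<in> Wt (a + int i) \<and> lform sm (\<phi> i)) \<and>
     (\<forall>i<l. if src (a + int i)
        then Y (x i) = x (Suc i) \<and> (\<forall>v\<in>Wt (a + int i). \<phi> (Suc i) (Y v) = \<phi> i v)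
        else X (x (Suc i)) = x i \<and> (\<forall>v\<in>Wt (a + int i + 1). \<phi> (Suc i) v = \<phi> i (X v))) \<and>
     (if src (a + int l) then Y (x l) = 0 else \<forall>v\<in>Wt (a + int l + 1). \<phi> l (X v) = 0)"

lemma strand_Suc:
  assumes "strand (a + 1) l x \<phi>" "x0 \<in> Wt a" "lform sm \<phi>0"
    and "src a \<Longrightarrow> Y x0 = x 0 \<and> (\<forall>v\<in>Wt a. \<phi> 0 (Y v) = \<phi>0 v)"
    and "\<not> src a \<Longrightarrow> X (x 0) = x0 \<and> (\<forall>v\<in>Wt (a + 1). \<phi> 0 v = \<phi>0 (X v))"
  shows "strand a (Suc l) (case_nat x0 x) (case_nat \<phi>0 \<phi>)"
  unfolding strand_def
proof (intro conjI allI impI)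
  have str: "\<And>i. i \<le> l \<Longrightarrow> x i \<in> Wt (a + 1 + int i) \<and> lform sm (\<phi> i)"
    "\<And>i. i < l \<Longrightarrow> if src (a + 1 + int i)
        then Y (x i) = x (Suc i) \<and> (\<forall>v\<in>Wt (a + 1 + int i). \<phi> (Suc i) (Y v) = \<phi> i v)
        else X (x (Suc i)) = x i \<and> (\<forall>v\<in>Wt (a + 1 + int i + 1). \<phi> (Suc i) v = \<phi> i (X v))"
    "if src (a + 1 + int l) then Y (x l) = 0 else \<forall>v\<in>Wt (a + 1 + int l + 1). \<phi> l (X v) = 0"
    using assms(1) unfolding strand_def by blast+
  fix i
  have sh: "a + int (Suc j) = a + 1 + int j" for j by simp
  show "case_nat x0 x i \<in> Wt (a + int i)" "lform sm (case_nat \<phi>0 \<phi> i)" if "i \<le> Suc l"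
    using that str(1)[of "i - 1"] assms(2,3) by (cases i; simp add: sh del: of_nat_Suc)+
  show "if src (a + int i)
        then Y (case_nat x0 x i) = case_nat x0 x (Suc i) \<and> (\<forall>v\<in>Wt (a + int i). case_nat \<phi>0 \<phi> (Suc i) (Y v) = case_nat \<phi>0 \<phi> i v)
        else X (case_nat x0 x (Suc i)) = case_nat x0 x i \<and> (\<forall>v\<in>Wt (a + int i + 1). case_nat \<phi>0 \<phi> (Suc i) v = case_nat \<phi>0 \<phi> i (X v))"
    if "i < Suc l"
  proof (cases i)
    case 0
    then show ?thesis using assms(4,5) by simp
  next
    case (Suc j)
    then show ?thesis using str(2)[of j] that unfolding Suc sh by simp
  qed
  show "if src (a + int (Suc l)) then Y (case_nat x0 x (Suc l)) = 0
      else \<forall>v\<in>Wt (a + int (Suc l) + 1). case_nat \<phi>0 \<phi> (Suc l) (X v) = 0"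
    using str(3) unfolding sh by simp
qed

lemma strand_0:
  assumes "x0 \<in> Wt a" "lform sm \<phi>0" "src a \<Longrightarrow> Y x0 = 0" "\<not> src a \<Longrightarrow> \<forall>v\<in>Wt (a + 1). \<phi>0 (X v) = 0"
  shows "strand a 0 (\<lambda>_. x0) (\<lambda>_. \<phi>0)"
  using assms by (simp add: strand_def)

text \<open>The part of the zigzag beyond the weight \<open>a\<close> is recorded by a flag in the weight space, each step
  \<open>F j \<subset> F (j + 1)\<close> of which carries a length.  The vector and the form at a step need not be paired
  nontrivially, so the extension property applies to several vectors and forms independently.\<close>

definition flag :: "int \<Rightarrow> nat \<Rightarrow> nat \<Rightarrow> (nat \<Rightarrow> 'm set) \<Rightarrow> (nat \<Rightarrow> nat) \<Rightarrow> bool" where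
  "flag a n r F len \<longleftrightarrow> F 0 = {0} \<and> F r = Wt a \<and> (\<forall>j\<le>r. subspace (F j)) \<and> (\<forall>j<r. F j \<subseteq> F (Suc j)) \<and>
     (\<forall>j<r. len j \<le> n \<and> (\<forall>x\<in>F (Suc j). \<forall>\<phi>. lform sm \<phi> \<longrightarrow> (\<forall>v\<in>F j. \<phi> v = 0) \<longrightarrow>
        (\<exists>xs \<phi>s. xs 0 = x \<and> \<phi>s 0 = \<phi> \<and> strand a (len j) xs \<phi>s)))"

text \<open>For an arrow leaving \<open>V\<^sub>a\<close>, the flag is pulled back.  Its new lowest step is the kernel of the arrow,
  where strands have length \<open>0\<close>.\<close>

lemma flag_src:
  assumes fl: "flag (a + 1) n r G len" and src: "src a"
  shows "flag a (Suc n) (Suc r) (case_nat {0} (\<lambda>j. {x \<in> Wt a. Y x \<in> G j})) (case_nat 0 (\<lambda>j. Suc (len j)))"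
proof -
  let ?F = "case_nat {0} (\<lambda>j. {x \<in> Wt a. Y x \<in> G j})"
  have G: "G 0 = {0}" "G r = Wt (a + 1)" "\<And>j. j \<le> r \<Longrightarrow> subspace (G j)" "\<And>j. j < r \<Longrightarrow> G j \<subseteq> G (Suc j)"
    "\<And>j. j < r \<Longrightarrow> len j \<le> n"
    "\<And>j x \<phi>. j < r \<Longrightarrow> x \<in> G (Suc j) \<Longrightarrow> lform sm \<phi> \<Longrightarrow> (\<And>v. v \<in> G j \<Longrightarrow> \<phi> v = 0) \<Longrightarrow>
        (\<exists>xs \<phi>s. xs 0 = x \<and> \<phi>s 0 = \<phi> \<and> strand (a + 1) (len j) xs \<phi>s)"
    using fl unfolding flag_def by blast+
  have sub: "subspace {x \<in> Wt a. Y x \<in> G j}" if "j \<le> r" for j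
    using G(3)[OF that] Wt_subspace[of a] by (auto simp: subspace_def lin)
  have "\<exists>xs \<phi>s. xs 0 = x \<and> \<phi>s 0 = \<phi> \<and> strand a (case_nat 0 (\<lambda>j. Suc (len j)) j) xs \<phi>s"
    if j: "j < Suc r" and x: "x \<in> ?F (Suc j)" and \<phi>: "lform sm \<phi>" "\<And>v. v \<in> ?F j \<Longrightarrow> \<phi> v = 0" for j x \<phi>
  proof (cases j)
    case 0
    then show ?thesis
      using x G(1) src \<phi>(1) by (intro exI[of _ "\<lambda>_. x"] exI[of _ "\<lambda>_. \<phi>"]) (simp add: strand_0)
  next
    case (Suc i)
    have van: "\<phi> u = 0" if "u \<in> Wt a" "Y u \<in> G i" for u using \<phi>(2)[of u] that Suc by simp
    have "subspace (G i)" using G(3) j Suc by simp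
    then have "\<exists>\<psi>. lform sm \<psi> \<and> (\<forall>u\<in>Wt a. \<psi> (Y u) = \<phi> u) \<and> (\<forall>w\<in>G i. \<psi> w = 0)"
      using van by (rule lform_push[OF Wt_subspace _ \<phi>(1) Y_lin])
    then obtain \<psi> where \<psi>: "lform sm \<psi>" "\<forall>u\<in>Wt a. \<psi> (Y u) = \<phi> u" "\<forall>w\<in>G i. \<psi> w = 0"
      by blast
    obtain xs \<phi>s where "xs 0 = Y x" "\<phi>s 0 = \<psi>" "strand (a + 1) (len i) xs \<phi>s"
      using G(6)[of i "Y x" \<psi>] \<psi> j Suc x by auto
    then have "strand a (Suc (len i)) (case_nat x xs) (case_nat \<phi> \<phi>s)"
      using x \<phi>(1) \<psi>(2) src Suc by (intro strand_Suc) auto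
    then show ?thesis using Suc by (intro exI[of _ "case_nat x xs"] exI[of _ "case_nat \<phi> \<phi>s"]) simp
  qed
  moreover have "?F (Suc r) = Wt a" using Wt_ops(3)[of _ a] G(2) by auto
  moreover have "?F j \<subseteq> ?F (Suc j)" if "j < Suc r" for j
    using that G(4)[of "j - 1"] G(1) subspace_0[OF Wt_subspace] by (cases j) auto
  moreover have "subspace (?F j)" if "j \<le> Suc r" for j
    using that sub[of "j - 1"] by (cases j) (auto simp: subspace_def)
  moreover have "case_nat 0 (\<lambda>j. Suc (len j)) j \<le> Suc n" if "j < Suc r" for j
    using that G(5)[of "j - 1"] by (cases j) auto
  ultimately show ?thesis unfolding flag_def by (auto simp del: nat.case(2))
qed

text \<open>For an arrow arriving at \<open>V\<^sub>a\<close>, the flag is pushed forward.  Its new highest step leads beyond the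
  image of the arrow; strands have length \<open>0\<close> there.\<close>

lemma flag_sink:
  assumes fl: "flag (a + 1) n r G len" and sink: "\<not> src a"
  shows "flag a (Suc n) (Suc r) (\<lambda>j. if j \<le> r then X ` G j else Wt a) (\<lambda>j. if j < r then Suc (len j) else 0)"
proof -
  let ?F = "\<lambda>j. if j \<le> r then X ` G j else Wt a" and ?l = "\<lambda>j. if j < r then Suc (len j) else 0"
  have G: "G 0 = {0}" "G r = Wt (a + 1)" "\<And>j. j \<le> r \<Longrightarrow> subspace (G j)" "\<And>j. j < r \<Longrightarrow> G j \<subseteq> G (Suc j)"
    "\<And>j. j < r \<Longrightarrow> len j \<le> n"
    "\<And>j x \<phi>. j < r \<Longrightarrow> x \<in> G (Suc j) \<Longrightarrow> lform sm \<phi> \<Longrightarrow> (\<And>v. v \<in> G j \<Longrightarrow> \<phi> v = 0) \<Longrightarrow>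
        (\<exists>xs \<phi>s. xs 0 = x \<and> \<phi>s 0 = \<phi> \<and> strand (a + 1) (len j) xs \<phi>s)"
    using fl unfolding flag_def by blast+
  have XW: "X ` Wt (a + 1) \<subseteq> Wt a" using Wt_ops(2)[of _ "a + 1"] by auto
  have sub: "subspace (X ` G j)" if "j \<le> r" for j
  proof -
    have "subspace (G j)" using G(3) that by blast
    show ?thesis
      unfolding subspace_def
    proof (intro conjI ballI allI)
      show "0 \<in> X ` G j" using subspace_0[OF \<open>subspace (G j)\<close>] by (intro image_eqI[of _ _ 0]) simp_all
      show "x + y \<in> X ` G j" if "x \<in> X ` G j" "y \<in> X ` G j" for x y
        using that subspace_add[OF \<open>subspace (G j)\<close>] by (auto simp: X_lin(1)[symmetric])
      show "sm c x \<in> X ` G j" if "x \<in> X ` G j" for c x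
        using that subspace_scale[OF \<open>subspace (G j)\<close>] by (auto simp: X_lin(2)[symmetric])
    qed
  qed
  have ext: "\<exists>xs \<phi>s. xs 0 = x \<and> \<phi>s 0 = \<phi> \<and> strand a (?l j) xs \<phi>s"
    if j: "j < Suc r" and x: "x \<in> ?F (Suc j)" and \<phi>: "lform sm \<phi>" "\<And>v. v \<in> ?F j \<Longrightarrow> \<phi> v = 0" for j x \<phi>
  proof (cases "j < r")
    case True
    then obtain y where y: "y \<in> G (Suc j)" "x = X y" using x by auto
    have "lform sm (\<lambda>v. \<phi> (X v))" by (simp add: lform_def lformD[OF \<phi>(1)] lin)
    moreover have "\<phi> (X v) = 0" if "v \<in> G j" for v using \<phi>(2)[of "X v"] True that by auto
    ultimately obtain xs \<phi>s where st: "xs 0 = y" "\<phi>s 0 = (\<lambda>v. \<phi> (X v))" "strand (a + 1) (len j) xs \<phi>s"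
      using G(6)[OF True y(1), of "\<lambda>v. \<phi> (X v)"] by blast
    then have "y \<in> Wt (a + 1)" by (auto simp: strand_def)
    then have "x \<in> Wt a" using XW y(2) by blast
    then have "strand a (Suc (len j)) (case_nat x xs) (case_nat \<phi> \<phi>s)"
      using \<phi>(1) st y(2) sink by (intro strand_Suc) auto
    then show ?thesis using True by (intro exI[of _ "case_nat x xs"] exI[of _ "case_nat \<phi> \<phi>s"]) simp
  next
    case False
    then have "j = r" using j by simp
    then have "strand a 0 (\<lambda>_. x) (\<lambda>_. \<phi>)" using x \<phi> G(2) sink by (intro strand_0) auto
    then show ?thesis using False by (intro exI[of _ "\<lambda>_. x"] exI[of _ "\<lambda>_. \<phi>"]) simp
  qed
  have mono: "?F j \<subseteq> ?F (Suc j)" if "j < Suc r" for j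
    using that G(4)[of j] G(2) XW by (auto simp: le_less_Suc_eq) (metis le_less_Suc_eq less_Suc_eq_le image_eqI subsetD)
  show ?thesis
    unfolding flag_def
  proof (intro conjI allI impI ballI)
    show "?F 0 = {0}" "?F (Suc r) = Wt a" using G(1) by simp_all
    show "subspace (?F j)" if "j \<le> Suc r" for j using sub Wt_subspace by auto
    show "?F j \<subseteq> ?F (Suc j)" if "j < Suc r" for j by (rule mono[OF that])
    show "?l j \<le> Suc n" if "j < Suc r" for j using G(5)[of j] by auto
    show "\<exists>xs \<phi>s. xs 0 = x \<and> \<phi>s 0 = \<phi> \<and> strand a (?l j) xs \<phi>s"
      if "j < Suc r" "x \<in> ?F (Suc j)" "lform sm \<phi>" "\<forall>v\<in>?F j. \<phi> v = 0" for j x \<phi>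
      using ext[of j x \<phi>] that by blast
  qed
qed

lemma flag_exists: "int K + 1 \<le> a + int n \<Longrightarrow> \<exists>r F len. flag a n r F len"
proof (induction n arbitrary: a)
  case 0
  then have "Wt a = {0}" by (intro Wt_out) simp
  then have "flag a 0 0 (\<lambda>_. {0}) (\<lambda>_. 0)" by (simp add: flag_def subspace_def)
  then show ?case by blast
next
  case (Suc n)
  then have "int K + 1 \<le> (a + 1) + int n" by simp
  from Suc.IH[OF this] obtain r G len where "flag (a + 1) n r G len" by blast
  then show ?case using flag_src flag_sink by blast
qed

subsection \<open>Splitting off a string summand\<close>

lemma sclosed_sm: "sclosed B x \<Longrightarrow> e = 1 \<or> e = - 1 \<Longrightarrow> sclosed B (sm e x)"
  by (auto simp: sclosed_def)

text \<open>The labels \<open>S\<close> allow one or two strands.  Biorthogonality propagates along the zigzag from the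
  initial vectors and forms.  If the strands start in weight zero, then \<open>s\<close> has to permute their initial
  vectors and forms by \<open>\<tau>\<close>, up to a sign \<open>e\<close>; otherwise the strands and their mirror images are disjoint
  and nothing arrives from the weights below \<open>a\<close>.\<close>

lemma strand_summand:
  fixes S :: "bool set" and l :: "bool \<Rightarrow> nat" and x :: "bool \<Rightarrow> nat \<Rightarrow> 'm" and \<phi> :: "bool \<Rightarrow> nat \<Rightarrow> 'm \<Rightarrow> 'k"
  assumes ind: indecomposable and a: "a \<ge> 0" and low: "\<And>i. \<bar>i\<bar> < a \<Longrightarrow> Wt i = {0}"
    and S: "S \<noteq> {}" and len: "\<And>\<sigma>. \<sigma> \<in> S \<Longrightarrow> l \<sigma> \<le> n"
    and str: "\<And>\<sigma>. \<sigma> \<in> S \<Longrightarrow> strand a (l \<sigma>) (x \<sigma>) (\<phi> \<sigma>)"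
    and bi0: "\<And>\<sigma> \<tau>. \<sigma> \<in> S \<Longrightarrow> \<tau> \<in> S \<Longrightarrow> \<phi> \<sigma> 0 (x \<tau> 0) = (if \<sigma> = \<tau> then 1 else 0)"
    and e: "e = 1 \<or> e = - 1"
    and sc: "\<And>\<sigma>. a = 0 \<Longrightarrow> \<sigma> \<in> S \<Longrightarrow> \<tau> \<sigma> \<in> S \<and> s (x \<sigma> 0) = sm e (x (\<tau> \<sigma>) 0) \<and>
       (\<forall>v\<in>Wt 0. \<phi> \<sigma> 0 (s v) = e * \<phi> (\<tau> \<sigma>) 0 v)"
  shows "\<exists>B. monomial_basis (4 * (n + 1)) B"
proof -
  have xW: "x \<sigma> i \<in> Wt (a + int i)" and \<phi>l: "lform sm (\<phi> \<sigma> i)" if "\<sigma> \<in> S" "i \<le> l \<sigma>" for \<sigma> i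
    using str[OF that(1)] that(2) by (simp_all add: strand_def)
  note xV = WtV[OF xW]
  have step: "if src (a + int i)
        then Y (x \<sigma> i) = x \<sigma> (Suc i) \<and> (\<forall>v\<in>Wt (a + int i). \<phi> \<sigma> (Suc i) (Y v) = \<phi> \<sigma> i v)
        else X (x \<sigma> (Suc i)) = x \<sigma> i \<and> (\<forall>v\<in>Wt (a + int i + 1). \<phi> \<sigma> (Suc i) v = \<phi> \<sigma> i (X v))"
    if "\<sigma> \<in> S" "i < l \<sigma>" for \<sigma> i
    using str[OF that(1)] that(2) unfolding strand_def by blast
  have stop: "if src (a + int (l \<sigma>)) then Y (x \<sigma> (l \<sigma>)) = 0 else \<forall>v\<in>Wt (a + int (l \<sigma>) + 1). \<phi> \<sigma> (l \<sigma>) (X v) = 0"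
    if "\<sigma> \<in> S" for \<sigma>
    using str[OF that] unfolding strand_def by blast
  have bi: "\<phi> \<sigma> i (x \<tau>' i) = (if \<sigma> = \<tau>' then 1 else 0)" if "\<sigma> \<in> S" "\<tau>' \<in> S" "i \<le> l \<sigma>" "i \<le> l \<tau>'" for \<sigma> \<tau>' i
    using that(3,4)
  proof (induction i)
    case 0
    then show ?case using bi0 that by simp
  next
    case (Suc i)
    have "\<phi> \<sigma> (Suc i) (x \<tau>' (Suc i)) = \<phi> \<sigma> i (x \<tau>' i)"
    proof (cases "src (a + int i)")
      case True
      then have "x \<tau>' (Suc i) = Y (x \<tau>' i)" "\<forall>v\<in>Wt (a + int i). \<phi> \<sigma> (Suc i) (Y v) = \<phi> \<sigma> i v"
        using step[OF that(1), of i] step[OF that(2), of i] Suc.prems by simp_all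
      then show ?thesis using xW[OF that(2), of i] Suc.prems by simp
    next
      case False
      then have "X (x \<tau>' (Suc i)) = x \<tau>' i" "\<forall>v\<in>Wt (a + int i + 1). \<phi> \<sigma> (Suc i) v = \<phi> \<sigma> i (X v)"
        using step[OF that(1), of i] step[OF that(2), of i] Suc.prems by simp_all
      moreover have "x \<tau>' (Suc i) \<in> Wt (a + int i + 1)"
        using xW[OF that(2), of "Suc i"] Suc.prems by (simp add: ac_simps)
      ultimately show ?thesis by simp
    qed
    then show ?case using Suc by simp
  qed
  \<comment> \<open>Only at weight zero can an operator lead out of a strand, namely into its mirror image.\<close>
  have Yx: "Y (x \<sigma> i) = 0 \<or> (i < l \<sigma> \<and> Y (x \<sigma> i) = x \<sigma> (Suc i))" if "\<sigma> \<in> S" "i \<le> l \<sigma>" for \<sigma> i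
  proof (cases "src (a + int i)")
    case True
    then show ?thesis using step[OF that(1), of i] stop[OF that(1)] that(2) by (cases "i = l \<sigma>") auto
  next
    case False
    then show ?thesis using sink_Wt(2)[OF xW[OF that]] by simp
  qed
  have Xx: "X (x \<sigma> i) = 0 \<or> (\<exists>j. i = Suc j \<and> X (x \<sigma> i) = x \<sigma> j) \<or> (i = 0 \<and> a = 0)" if "\<sigma> \<in> S" "i \<le> l \<sigma>" for \<sigma> i
  proof (cases i)
    case 0
    then show ?thesis
      using Wt_ops(2)[OF xW[OF that]] low[of "a - 1"] a by (cases "a = 0") auto
  next
    case (Suc j)
    show ?thesis
    proof (cases "src (a + int i)")
      case True
      then have "\<not> src (a + int j)" using Suc by auto
      then show ?thesis using step[OF that(1), of j] that(2) Suc by auto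
    next
      case False
      then show ?thesis using sink_Wt(1)[OF xW[OF that]] by simp
    qed
  qed
  have \<phi>X: "\<phi> \<sigma> i (X w) = 0 \<or> (i < l \<sigma> \<and> \<phi> \<sigma> i (X w) = \<phi> \<sigma> (Suc i) w)"
    if "\<sigma> \<in> S" "i \<le> l \<sigma>" "w \<in> Wt (a + int i + 1)" for \<sigma> i w
  proof (cases "src (a + int i)")
    case True
    then have "X w = 0" using sink_Wt(1)[OF that(3)] by auto
    then show ?thesis using lformD(3)[OF \<phi>l[OF that(1,2)]] by simp
  next
    case False
    then show ?thesis using step[OF that(1), of i] stop[OF that(1)] that(2,3) by (cases "i = l \<sigma>") auto
  qed
  have \<phi>Y: "\<phi> \<sigma> i (Y w) = 0 \<or> (\<exists>j. i = Suc j \<and> \<phi> \<sigma> i (Y w) = \<phi> \<sigma> j w) \<or> (i = 0 \<and> a = 0)"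
    if "\<sigma> \<in> S" "i \<le> l \<sigma>" "w \<in> Wt (a + int i - 1)" for \<sigma> i w
  proof (cases i)
    case 0
    have "Y w = 0" if "a > 0" using low[of "a - 1"] \<open>w \<in> Wt (a + int i - 1)\<close> 0 that by auto
    then show ?thesis using 0 a lformD(3)[OF \<phi>l[OF that(1,2)]] by (cases "a = 0") auto
  next
    case (Suc j)
    show ?thesis
    proof (cases "src (a + int j)")
      case True
      then show ?thesis using step[OF that(1), of j] that(2,3) Suc by auto
    next
      case False
      then have "Y w = 0" using sink_Wt(2)[OF that(3)] Suc by auto
      then show ?thesis using lformD(3)[OF \<phi>l[OF that(1,2)]] by simp
    qed
  qed
  \<comment> \<open>The flag \<open>t\<close> marks mirror images; in weight zero they are already among the initial vectors.\<close>
  define J where "J = {(\<sigma>, i, t). \<sigma> \<in> S \<and> i \<le> l \<sigma> \<and> (t \<longrightarrow> a + int i \<noteq> 0)}"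
  define b where "b = (\<lambda>(\<sigma>, i, t). if t then s (x \<sigma> i) else x \<sigma> i)"
  define \<psi> where "\<psi> = (\<lambda>(\<sigma>, i, t) v. \<phi> \<sigma> i (p (a + int i) (if t then s v else v)))"
  have Jsub: "J \<subseteq> UNIV \<times> {..n} \<times> UNIV" using le_trans[OF _ len] by (auto simp: J_def)
  have finJ: "finite J" using Jsub by (rule finite_subset) simp
  have cardJ: "card J \<le> 4 * (n + 1)"
    using card_mono[OF _ Jsub] by (simp add: card_cartesian_product)
  have neJ: "J \<noteq> {}" using S by (auto simp: J_def)
  have \<psi>l: "lform sm (\<psi> j)" if jJ: "j \<in> J" for j
  proof -
    obtain \<sigma> i t where j: "j = (\<sigma>, i, t)" "\<sigma> \<in> S" "i \<le> l \<sigma>" using jJ by (auto simp: J_def)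
    show ?thesis unfolding j(1) \<psi>_def lform_def
      by (cases t) (simp_all add: lformD[OF \<phi>l[OF j(2,3)]] lin)
  qed
  have biJ: "\<psi> j (b j') = (if j = j' then 1 else 0)" if jJ: "j \<in> J" "j' \<in> J" for j j'
  proof -
    obtain \<sigma> i t where j: "j = (\<sigma>, i, t)" "\<sigma> \<in> S" "i \<le> l \<sigma>" "t \<longrightarrow> a + int i \<noteq> 0" using jJ by (auto simp: J_def)
    obtain \<sigma>' i' t' where j': "j' = (\<sigma>', i', t')" "\<sigma>' \<in> S" "i' \<le> l \<sigma>'" "t' \<longrightarrow> a + int i' \<noteq> 0"
      using jJ by (auto simp: J_def)
    note \<phi>0 = lformD(3)[OF \<phi>l[OF j(2,3)]]
    note W = xW[OF j'(2,3)] and V' = xV[OF j'(2,3)]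
    have main: "\<phi> \<sigma> i (p (a + int i) (x \<sigma>' i')) = (if \<sigma> = \<sigma>' \<and> i = i' then 1 else 0)"
      using Wtp[OF W, of "a + int i"] bi[OF j(2) j'(2) j(3)] j'(3) \<phi>0 by auto
    have cross: "p (a + int i) (s (x \<sigma>' i')) = 0" if "a + int i \<noteq> 0 \<or> a + int i' \<noteq> 0"
      using Wtp[OF W, of "- (a + int i)"] that a by (auto simp: ps V')
    show ?thesis
      unfolding j(1) j'(1) \<psi>_def b_def using main cross j(4) j'(4) \<phi>0
      by (cases t; cases t') (auto simp: ss V')
  qed
  let ?B = "b ` J"
  have mem_x: "x \<sigma> i \<in> ?B" if "\<sigma> \<in> S" "i \<le> l \<sigma>" for \<sigma> i
    using that by (intro image_eqI[of _ _ "(\<sigma>, i, False)"]) (simp_all add: b_def J_def)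
  have cl_x: "sclosed ?B (x \<sigma> i)" if "\<sigma> \<in> S" "i \<le> l \<sigma>" for \<sigma> i
    using mem_x[OF that] by (simp add: sclosed_def)
  have cl_s: "sclosed ?B (s (x \<sigma> i))" if "\<sigma> \<in> S" "i \<le> l \<sigma>" for \<sigma> i
  proof (cases "a + int i = 0")
    case True
    then have "a = 0" "i = 0" using a by auto
    then show ?thesis using sc[OF _ that(1)] cl_x[of "\<tau> \<sigma>" 0] e by (simp add: sclosed_sm)
  next
    case False
    then have "s (x \<sigma> i) \<in> ?B"
      using that by (intro image_eqI[of _ _ "(\<sigma>, i, True)"]) (simp_all add: b_def J_def)
    then show ?thesis by (simp add: sclosed_def)
  qed
  have cl0: "sclosed ?B 0" by (simp add: sclosed_def)
  have cl_Y: "sclosed ?B (Y (x \<sigma> i))" "sclosed ?B (s (Y (x \<sigma> i)))" if "\<sigma> \<in> S" "i \<le> l \<sigma>" for \<sigma> i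
    using Yx[OF that] cl_x[OF that(1), of "Suc i"] cl_s[OF that(1), of "Suc i"] cl0 by auto
  have cl_X: "sclosed ?B (X (x \<sigma> i))" "sclosed ?B (s (X (x \<sigma> i)))" if "\<sigma> \<in> S" "i \<le> l \<sigma>" for \<sigma> i
  proof -
    have "sclosed ?B (X (x \<sigma> i)) \<and> sclosed ?B (s (X (x \<sigma> i)))"
      using Xx[OF that]
    proof (elim disjE exE conjE)
      fix j assume "i = Suc j" "X (x \<sigma> i) = x \<sigma> j"
      then show ?thesis using cl_x[OF that(1), of j] cl_s[OF that(1), of j] that(2) by simp
    next
      assume z: "i = 0" "a = 0"
      have t: "\<tau> \<sigma> \<in> S" "s (x \<sigma> 0) = sm e (x (\<tau> \<sigma>) 0)" using sc[OF z(2) that(1)] by auto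
      have V0: "x \<sigma> 0 \<in> V" "x (\<tau> \<sigma>) 0 \<in> V" using xV[OF that(1), of 0] xV[OF t(1), of 0] by auto
      have "s (X (x \<sigma> 0)) = Y (s (x \<sigma> 0))" using Ys[OF V0(1)] by simp
      also have "\<dots> = sm e (Y (x (\<tau> \<sigma>) 0))" by (simp add: t(2) lin)
      finally have sX: "s (X (x \<sigma> 0)) = sm e (Y (x (\<tau> \<sigma>) 0))" .
      have "X (x \<sigma> 0) = s (s (X (x \<sigma> 0)))" using V0 by (simp add: ss into)
      then have X': "X (x \<sigma> 0) = sm e (s (Y (x (\<tau> \<sigma>) 0)))" by (simp add: sX lin)
      show ?thesis unfolding z(1) sX unfolding X' using cl_Y[OF t(1), of 0] e by (simp add: sclosed_sm)
    qed (simp_all add: cl0)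
    then show "sclosed ?B (X (x \<sigma> i))" "sclosed ?B (s (X (x \<sigma> i)))" by auto
  qed
  have mono: "monomial ?B"
    unfolding monomial_def
  proof (intro conjI ballI)
    show "?B \<subseteq> V" using xV by (auto simp: b_def J_def into split: if_splits)
    fix y assume "y \<in> ?B"
    then obtain \<sigma> i t where y: "y = (if t then s (x \<sigma> i) else x \<sigma> i)" "\<sigma> \<in> S" "i \<le> l \<sigma>"
      by (auto simp: b_def J_def)
    have "p (if t then - (a + int i) else a + int i) y = y"
      unfolding y(1) using Wtp[OF xW[OF y(2,3)]] Wtp[OF Wt_ops(1)[OF xW[OF y(2,3)]]] by simp
    then show "\<exists>i. p i y = y" by blast
    note V' = xV[OF y(2,3)]
    show "sclosed ?B (s y)" "sclosed ?B (X y)" "sclosed ?B (Y y)"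
      unfolding y(1) using cl_x[OF y(2,3)] cl_s[OF y(2,3)] cl_X[OF y(2,3)] cl_Y[OF y(2,3)]
      by (cases t; simp add: ss Xs Ys V')+
  qed
  \<comment> \<open>A description of the common kernel that is visibly stable under \<open>s\<close>.\<close>
  define Q where "Q v \<longleftrightarrow> v \<in> V \<and> (\<forall>\<sigma>\<in>S. \<forall>i\<le>l \<sigma>. \<phi> \<sigma> i (p (a + int i) v) = 0 \<and> \<phi> \<sigma> i (p (a + int i) (s v)) = 0)" for v
  have Q_iff: "Q v" if v: "v \<in> V" "\<And>j. j \<in> J \<Longrightarrow> \<psi> j v = 0" for v
  proof -
    have A: "\<phi> \<sigma> i (p (a + int i) v) = 0" if "\<sigma> \<in> S" "i \<le> l \<sigma>" for \<sigma> i
      using v(2)[of "(\<sigma>, i, False)"] that by (simp add: J_def \<psi>_def)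
    moreover have "\<phi> \<sigma> i (p (a + int i) (s v)) = 0" if "\<sigma> \<in> S" "i \<le> l \<sigma>" for \<sigma> i
    proof (cases "a + int i = 0")
      case True
      then have z: "a = 0" "i = 0" using a by auto
      have "\<phi> \<sigma> 0 (s (p 0 v)) = e * \<phi> (\<tau> \<sigma>) 0 (p 0 v)" using sc[OF z(1) that(1)] p_Wt[OF v(1)] by blast
      then show ?thesis using A[of "\<tau> \<sigma>" 0] sc[OF z(1) that(1)] z v(1) by (simp add: ps)
    next
      case False
      then show ?thesis using v(2)[of "(\<sigma>, i, True)"] that by (simp add: J_def \<psi>_def)
    qed
    ultimately show ?thesis using v(1) by (simp add: Q_def)
  qed
  have Q\<psi>: "\<psi> j v = 0" if "Q v" "j \<in> J" for v j
    using that by (auto simp: Q_def J_def \<psi>_def)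
  have QV: "v \<in> V" if "Q v" for v using that by (simp add: Q_def)
  have Qp: "Q (p k v)" if "Q v" for v k
  proof -
    have v: "v \<in> V" by (rule QV[OF that])
    have "p j (p k v) = p j v \<or> p j (p k v) = 0" "p j (s (p k v)) = p j (s v) \<or> p j (s (p k v)) = 0" for j
      using v by (simp_all add: pp shift_p(3) into)
    then have "\<phi> \<sigma> i (p (a + int i) (p k v)) = 0 \<and> \<phi> \<sigma> i (p (a + int i) (s (p k v))) = 0"
      if "\<sigma> \<in> S" "i \<le> l \<sigma>" for \<sigma> i
      using \<open>Q v\<close> that lformD(3)[OF \<phi>l[OF that]] unfolding Q_def by metis
    then show ?thesis using v by (simp add: Q_def into)
  qed
  have Qs: "Q (s v)" if "Q v" for v
    using that by (auto simp: Q_def into ss)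
  have QX: "Q (X v)" if Qv: "Q v" for v
  proof -
    have v: "v \<in> V" by (rule QV[OF Qv])
    have A: "\<phi> \<sigma> i (p (a + int i) v) = 0" "\<phi> \<sigma> i (p (a + int i) (s v)) = 0" if "\<sigma> \<in> S" "i \<le> l \<sigma>" for \<sigma> i
      using Qv that by (auto simp: Q_def)
    have XA: "\<phi> \<sigma> i (X (p (a + int i + 1) v)) = 0" if "\<sigma> \<in> S" "i \<le> l \<sigma>" for \<sigma> i
      using \<phi>X[OF that p_Wt[OF v]] A(1)[OF that(1), of "Suc i"] by (auto simp: ac_simps)
    have YA: "\<phi> \<sigma> i (Y (p (a + int i - 1) (s v))) = 0" if "\<sigma> \<in> S" "i \<le> l \<sigma>" for \<sigma> i
      using \<phi>Y[OF that p_Wt[OF into(2)[OF v]]]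
    proof (elim disjE exE conjE)
      fix j assume "i = Suc j" "\<phi> \<sigma> i (Y (p (a + int i - 1) (s v))) = \<phi> \<sigma> j (p (a + int i - 1) (s v))"
      then show ?thesis using A(2)[OF that(1), of j] that(2) by simp
    next
      assume z: "i = 0" "a = 0"
      have t: "\<tau> \<sigma> \<in> S" "\<forall>v\<in>Wt 0. \<phi> \<sigma> 0 (s v) = e * \<phi> (\<tau> \<sigma>) 0 v" using sc[OF z(2) that(1)] by auto
      have "Y (p (- 1) (s v)) = s (X (p 1 v))" using v by (simp add: ps Ys into)
      moreover have "X (p 1 v) \<in> Wt 0" using Wt_ops(2)[OF p_Wt[OF v, of 1]] by simp
      ultimately have "\<phi> \<sigma> 0 (Y (p (- 1) (s v))) = e * \<phi> (\<tau> \<sigma>) 0 (X (p 1 v))" using t(2) by simp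
      then show ?thesis using XA[OF t(1), of 0] z by simp
    qed
    show ?thesis using v XA YA by (auto simp: Q_def into pX Ys[symmetric] pY)
  qed
  have QY: "Q (Y v)" if "Q v" for v
  proof -
    have "Y v = s (X (s v))" using QV[OF that] by (simp add: Xs ss into)
    then show ?thesis using Qs[OF QX[OF Qs[OF that]]] by simp
  qed
  have "stable {v \<in> V. \<forall>j\<in>J. \<psi> j v = 0}"
  proof (rule stable_kernel[OF \<psi>l])
    fix v j k assume "v \<in> V" "\<And>j. j \<in> J \<Longrightarrow> \<psi> j v = 0" and j: "j \<in> J"
    then have "Q v" by (intro Q_iff)
    then show "\<psi> j (p k v) = 0 \<and> \<psi> j (s v) = 0 \<and> \<psi> j (X v) = 0 \<and> \<psi> j (Y v) = 0"
      using Q\<psi>[OF Qp j] Q\<psi>[OF Qs j] Q\<psi>[OF QX j] Q\<psi>[OF QY j] by simp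
  qed
  from split_off[OF ind finJ neJ mono \<psi>l biJ this] cardJ
  have "monomial_basis (4 * (n + 1)) ?B" unfolding monomial_basis_def using le_trans by blast
  then show ?thesis by blast
qed

text \<open>Strands start at the least weight \<open>a \<ge> 0\<close> that occurs, at the lowest step of the flag.  For \<open>a = 0\<close>
  the strand continues towards negative weights according to the mirror flag \<open>s F\<close>.  The bound counts
  two strands of at most \<open>K + 2\<close> vectors and their mirror images.\<close>

lemma string_case:
  assumes ind: indecomposable
  shows "\<exists>B. monomial_basis (4 * (K + 2)) B"
proof -
  have mirror: "Wt (- i) = {0} \<longleftrightarrow> Wt i = {0}" for i
  proof -
    have *: "Wt (- i) = {0}" if "Wt i = {0}" for i
    proof safe
      fix x assume x: "x \<in> Wt (- i)"
      then have "s x \<in> Wt i" using Wt_ops(1)[OF x] by simp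
      then have "s (s x) = 0" using that by simp
      then show "x = 0" using ss[OF WtV[OF x]] by simp
    qed (rule subspace_0[OF Wt_subspace])
    show ?thesis using *[of i] *[of "- i"] by auto
  qed
  have "\<exists>n::nat. Wt (int n) \<noteq> {0}"
  proof -
    obtain v where v: "v \<in> V" "v \<noteq> 0" using ind subspace_0[OF V] unfolding indecomposable_def by blast
    then obtain i where "p i v \<noteq> 0" using p_sum[OF v(1)] by (metis sum.neutral)
    then have "Wt i \<noteq> {0}" using p_Wt[OF v(1)] by blast
    then have "Wt (int (nat \<bar>i\<bar>)) \<noteq> {0}" using mirror[of i] by (cases "i \<ge> 0") auto
    then show ?thesis by blast
  qed
  define a where "a = (LEAST n::nat. Wt (int n) \<noteq> {0})"
  have a: "Wt (int a) \<noteq> {0}" unfolding a_def using \<open>\<exists>n. _ n\<close> by (rule LeastI_ex)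
  have low: "Wt i = {0}" if "\<bar>i\<bar> < int a" for i
  proof -
    have "nat \<bar>i\<bar> < a" using that by linarith
    then have "Wt (int (nat \<bar>i\<bar>)) = {0}" unfolding a_def using not_less_Least by blast
    then show ?thesis using mirror[of i] by (cases "i \<ge> 0") auto
  qed
  obtain r F len where "flag (int a) (K + 1) r F len" using flag_exists[of "int a" "K + 1"] by auto
  then have F: "F 0 = {0}" "F r = Wt (int a)" "\<And>j. j \<le> r \<Longrightarrow> subspace (F j)" "\<And>j. j < r \<Longrightarrow> F j \<subseteq> F (Suc j)"
    "\<And>j. j < r \<Longrightarrow> len j \<le> K + 1"
    and ext: "\<And>j x \<phi>. j < r \<Longrightarrow> x \<in> F (Suc j) \<Longrightarrow> lform sm \<phi> \<Longrightarrow> (\<forall>v\<in>F j. \<phi> v = 0) \<Longrightarrow>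
        (\<exists>xs \<phi>s. xs 0 = x \<and> \<phi>s 0 = \<phi> \<and> strand (int a) (len j) xs \<phi>s)"
    unfolding flag_def by blast+
  \<comment> \<open>Below the lowest step the flag is zero, so every form vanishes there.\<close>
  define j where "j = (LEAST j. F (Suc j) \<noteq> {0})"
  have rpos: "r \<noteq> 0" using F(1,2) a by (cases r) auto
  then have ex: "F (Suc (r - 1)) \<noteq> {0}" using F(2) a by simp
  then have jF: "F (Suc j) \<noteq> {0}" unfolding j_def by (rule LeastI)
  have "j \<le> r - 1" unfolding j_def by (rule Least_le) (rule ex)
  then have jr: "j < r" using rpos by simp
  have j0: "F j = {0}"
  proof (cases j)
    case (Suc i)
    then show ?thesis using not_less_Least[of i "\<lambda>j. F (Suc j) \<noteq> {0}"] by (auto simp: j_def)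
  qed (simp add: F(1))
  have Fmono: "F i \<subseteq> F i'" if "i \<le> i'" "i' \<le> r" for i i'
    using that by (induction i') (auto simp: le_Suc_eq dest: F(4)[OF Suc_le_lessD])
  show ?thesis
  proof (cases "a = 0")
    case False
    obtain x where x: "x \<in> F (Suc j)" "x \<noteq> 0" using jF F(3)[of "Suc j"] jr subspace_0 by auto
    obtain \<phi> where \<phi>: "lform sm \<phi>" "\<phi> x = 1" using lform_separate[of "{0}" x] x(2) by (auto simp: subspace_def)
    obtain xs \<phi>s where st: "xs 0 = x" "\<phi>s 0 = \<phi>" "strand (int a) (len j) xs \<phi>s"
      using ext[OF jr x(1) \<phi>(1)] j0 lformD(3)[OF \<phi>(1)] by auto
    show ?thesis
      using strand_summand[of "int a" "{True}" "\<lambda>_. len j" "K + 1" "\<lambda>_. xs" "\<lambda>_. \<phi>s" 1 id] ind low False F(5)[OF jr] st \<phi>(2)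
      by simp
  next
    case a0: True
    let ?U = "F (Suc j)"
    have FW: "F i \<subseteq> Wt 0" if "i \<le> r" for i using Fmono[OF that] F(2) a0 by simp
    have FV: "x \<in> V" if "x \<in> F i" "i \<le> r" for x i using FW[OF that(2)] that(1) WtV by blast
    \<comment> \<open>\<open>j'\<close> is the first step of the mirror flag that meets the lowest step of \<open>F\<close>.\<close>
    define P where "P i \<longleftrightarrow> ?U \<inter> s ` F (Suc i) \<noteq> {0}" for i
    have sW: "s ` Wt 0 = Wt 0"
    proof
      show "s ` Wt 0 \<subseteq> Wt 0" using Wt_ops(1)[of _ 0] by auto
      show "Wt 0 \<subseteq> s ` Wt 0"
        using Wt_ops(1)[of _ 0] ss[OF WtV] by (metis image_eqI minus_zero subsetI)
    qed
    have sF: "subspace (s ` F i)" if "i \<le> r" for i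
      unfolding subspace_def
    proof (intro conjI ballI allI)
      show "0 \<in> s ` F i" using subspace_0[OF F(3)[OF that]] by (intro image_eqI[of _ _ 0]) simp_all
      show "x + y \<in> s ` F i" if "x \<in> s ` F i" "y \<in> s ` F i" for x y
        using that subspace_add[OF F(3)[OF \<open>i \<le> r\<close>]] by (auto simp: s_lin(1)[symmetric])
      show "sm c x \<in> s ` F i" if "x \<in> s ` F i" for c x
        using that subspace_scale[OF F(3)[OF \<open>i \<le> r\<close>]] by (auto simp: s_lin(2)[symmetric])
    qed
    have exP: "P (r - 1)"
    proof -
      have "?U \<subseteq> s ` F (Suc (r - 1))" using FW[of "Suc j"] jr F(2) a0 sW rpos by simp
      then show ?thesis using jF by (auto simp: P_def)
    qed
    define j' where "j' = (LEAST i. P i)"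
    have Pj': "P j'" unfolding j'_def using exP by (rule LeastI)
    have "j' \<le> r - 1" unfolding j'_def using exP by (rule Least_le)
    then have jr': "j' < r" using rpos by simp
    have j'0: "?U \<inter> s ` F j' = {0}"
    proof (cases j')
      case 0
      then show ?thesis using F(1) subspace_0[OF F(3)[of "Suc j"]] jr by auto
    next
      case (Suc i)
      then show ?thesis using not_less_Least[of i P] by (auto simp: j'_def P_def)
    qed
    have "j \<le> j'"
    proof (rule ccontr)
      assume "\<not> j \<le> j'"
      then have "F (Suc j') \<subseteq> F j" using Fmono[of "Suc j'" j] jr by simp
      then have "s ` F (Suc j') \<subseteq> {0}" using j0 by auto
      then show False using Pj' subspace_0[OF F(3)[of "Suc j"]] subspace_0[OF sF[of "Suc j'"]] jr jr' unfolding P_def by auto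
    qed
    have "0 \<in> ?U" "0 \<in> s ` F (Suc j')"
      using subspace_0[OF F(3)[of "Suc j"]] subspace_0[OF sF[of "Suc j'"]] jr jr' by simp_all
    then obtain x0 where x0: "x0 \<in> ?U" "x0 \<in> s ` F (Suc j')" "x0 \<noteq> 0"
      using Pj' unfolding P_def by blast
    have x0V: "x0 \<in> V" using FV[OF x0(1)] jr by simp
    have sx0: "s x0 \<in> F (Suc j')" using x0(2) ss[OF FV] jr' by auto
    show ?thesis
    proof (cases "j' = j")
      case True
      \<comment> \<open>The lowest step meets its own mirror image; the intersection contains an eigenvector of \<open>s\<close>.\<close>
      have subU: "subspace ?U" using F(3) jr by simp
      have "(x0 + s x0) + (x0 - s x0) = sm 2 x0" using scale_left_distrib[of 1 1 x0] by simp
      then have "x0 + s x0 \<noteq> 0 \<or> x0 - s x0 \<noteq> 0" using x0(3) char by auto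
      moreover have "s (x0 + s x0) = sm 1 (x0 + s x0)" "s (x0 - s x0) = sm (- 1) (x0 - s x0)"
        using x0V by (simp_all add: lin ss)
      moreover have "x0 + s x0 \<in> ?U" "x0 - s x0 \<in> ?U"
        using subspace_add[OF subU] subspace_diff[OF subU] x0(1) sx0 True by auto
      ultimately obtain x e where x: "x \<in> ?U" "x \<noteq> 0" "s x = sm e x" and e: "e = 1 \<or> e = - 1" by metis
      have ee: "e * e = 1" using e by auto
      obtain \<phi>0 where \<phi>0: "lform sm \<phi>0" "\<phi>0 x = 1" using lform_separate[of "{0}" x] x(2) by (auto simp: subspace_def)
      define h where "h = inverse (2 :: 'k)"
      have h: "h * (1 + 1) = 1" using char by (simp add: h_def)
      define \<phi> where "\<phi> v = h * (\<phi>0 v + e * \<phi>0 (s v))" for v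
      have \<phi>l: "lform sm \<phi>" by (simp add: lform_def \<phi>_def lformD[OF \<phi>0(1)] lin algebra_simps)
      have \<phi>x: "\<phi> x = 1" using h ee by (simp add: \<phi>_def x(3) lformD[OF \<phi>0(1)] \<phi>0(2))
      have \<phi>s: "\<phi> (s v) = e * \<phi> v" if "v \<in> V" for v
      proof -
        have "e * \<phi> v = h * (e * e * \<phi>0 (s v) + e * \<phi>0 v)" by (simp add: \<phi>_def algebra_simps)
        then show ?thesis using that by (simp only: ee \<phi>_def ss mult_1_left)
      qed
      obtain xs \<phi>s' where st: "xs 0 = x" "\<phi>s' 0 = \<phi>" "strand (int a) (len j) xs \<phi>s'"
        using ext[OF jr x(1) \<phi>l] j0 lformD(3)[OF \<phi>l] by auto
      show ?thesis
        using strand_summand[of "int a" "{True}" "\<lambda>_. len j" "K + 1" "\<lambda>_. xs" "\<lambda>_. \<phi>s'" e id]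
          ind low F(5)[OF jr] st \<phi>x e x(3) \<phi>s WtV by simp
    next
      case False
      \<comment> \<open>\<open>x0\<close> and its mirror image lie at the different steps \<open>j\<close> and \<open>j'\<close> and start two strands.\<close>
      then have "Suc j \<le> j'" using \<open>j \<le> j'\<close> by simp
      have nin: "x0 \<notin> s ` F j'" using j'0 x0 by blast
      obtain \<phi> where \<phi>: "lform sm \<phi>" "\<phi> x0 = 1" "\<forall>w\<in>s ` F j'. \<phi> w = 0"
        using lform_separate[OF sF nin] jr' by auto
      have \<phi>sl: "lform sm (\<lambda>v. \<phi> (s v))" by (rule lform_comp_s[OF \<phi>(1)])
      have cross: "\<phi> (s x0) = 0"
        using \<phi>(3) Fmono[OF \<open>Suc j \<le> j'\<close>] jr' x0(1) by auto
      obtain xs1 \<phi>s1 where st1: "xs1 0 = x0" "\<phi>s1 0 = \<phi>" "strand (int a) (len j) xs1 \<phi>s1"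
        using ext[OF jr x0(1) \<phi>(1)] j0 lformD(3)[OF \<phi>(1)] by auto
      obtain xs2 \<phi>s2 where st2: "xs2 0 = s x0" "\<phi>s2 0 = (\<lambda>v. \<phi> (s v))" "strand (int a) (len j') xs2 \<phi>s2"
        using ext[OF jr' sx0 \<phi>sl] \<phi>(3) by auto
      let ?l = "\<lambda>b. if b then len j else len j'" and ?x = "\<lambda>b. if b then xs1 else xs2"
        and ?\<phi> = "\<lambda>b. if b then \<phi>s1 else \<phi>s2"
      have "\<exists>B. monomial_basis (4 * (K + 1 + 1)) B"
      proof (rule strand_summand[of "int a" UNIV ?l "K + 1" ?x ?\<phi> 1 Not])
        show "?l \<sigma> \<le> K + 1" for \<sigma> using F(5)[OF jr] F(5)[OF jr'] by simp
        show "strand (int a) (?l \<sigma>) (?x \<sigma>) (?\<phi> \<sigma>)" for \<sigma> using st1 st2 by simp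
        show "?\<phi> \<sigma> 0 (?x \<tau> 0) = (if \<sigma> = \<tau> then 1 else 0)" for \<sigma> \<tau>
          using st1 st2 \<phi>(2) cross x0V by (simp add: ss)
        show "(\<not> \<sigma>) \<in> UNIV \<and> s (?x \<sigma> 0) = sm 1 (?x (\<not> \<sigma>) 0) \<and>
          (\<forall>v\<in>Wt 0. ?\<phi> \<sigma> 0 (s v) = 1 * ?\<phi> (\<not> \<sigma>) 0 v)" for \<sigma>
          using st1 st2 x0V WtV[of _ 0] by (simp add: ss)
      qed (use ind low in auto)
      then show ?thesis by simp
    qed
  qed
qed

end

theorem (in O2rep) indecomposable_monomial_basis:
  assumes ind: indecomposable
  shows "\<exists>B. monomial_basis (4 * (K + 2)) B"
proof (cases "\<exists>v\<in>V. X (Y v) \<noteq> 0")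
  case True
  then obtain B where "monomial_basis 8 B" using projective_case[OF ind] by blast
  then have "monomial_basis (4 * (K + 2)) B" by (simp add: monomial_basis_def)
  then show ?thesis by blast
next
  case False
  then obtain c where c: "\<forall>v\<in>V. \<forall>i. even i \<noteq> c \<longrightarrow> X (p i v) = 0 \<and> Y (p i v) = 0"
    using parity_split[OF ind] by blast
  interpret O2string sm V p s X Y K c
    by unfold_locales (use c in auto)
  show ?thesis by (rule string_case[OF ind])
qed

section \<open>Comodules as representations of the dual algebra\<close>

text \<open>The action of the dual algebra of \<open>H\<close> on a right comodule.\<close>

definition cact :: "('k::field \<Rightarrow> 'm::ab_group_add \<Rightarrow> 'm) \<Rightarrow> ('m \<Rightarrow> ('m \<times> 'k hopf_efuv \<Rightarrow>\<^sub>0 'k))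
    \<Rightarrow> (idx \<Rightarrow> 'k) \<Rightarrow> 'm \<Rightarrow> 'm" where
  "cact sm \<rho> c x = lin_ext sm (\<lambda>(m, h). sm (H_fun c h) m) (\<rho> x)"

definition dirac :: "idx \<Rightarrow> idx \<Rightarrow> 'k::field" where "dirac b b' = (if b' = b then 1 else 0)"

lemma H_coord_dirac: "H_coord b = H_fun (dirac b)"
  by (simp add: H_coord_def dirac_def[abs_def])

locale H_space = M: vector_space sm for sm :: "'k::field \<Rightarrow> 'm::ab_group_add \<Rightarrow> 'm"
begin

lemma lin_ext_contract_cong:
  assumes "tensor_eq sm V H_scale UNIV p q"
  shows "lin_ext sm (\<lambda>(m, h). sm (H_fun c h) m) p = lin_ext sm (\<lambda>(m, h). sm (H_fun c h) m) q"
  by (rule tensor_eq_lin_ext[OF M.vector_space_axioms _ _ _ _ assms])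
    (simp_all add: M.scale_right_distrib M.scale_left_distrib mult.commute)

text \<open>Only finitely many monomials occur in \<open>\<rho> x\<close>, so functions of infinite support act as well.\<close>

lemma cact_finite:
  "\<exists>F. finite F \<and> (\<forall>c. cact sm \<rho> c x = (\<Sum>b\<in>F. sm (c b) (cact sm \<rho> (dirac b) x))) \<and>
     (\<forall>b. b \<notin> F \<longrightarrow> cact sm \<rho> (dirac b) x = 0)"
proof -
  define F where "F = (\<Union>(m, h)\<in>Poly_Mapping.keys (\<rho> x). H_supp h)"
  have F: "finite F" by (auto simp: F_def)
  have exp: "H_fun c h = (\<Sum>b\<in>F. c b * H_fun (dirac b) h)" if "(m, h) \<in> Poly_Mapping.keys (\<rho> x)" for c m h
  proof -
    have sub: "H_supp h \<subseteq> F" using that by (auto simp: F_def)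
    have "H_fun c h = H_fun c (\<Sum>b\<in>F. H_scale (H_coord b h) (H_basis b))"
      using H_expand[OF F sub] by simp
    then show ?thesis by (simp add: H_fun_sum H_coord_dirac mult.commute)
  qed
  have "cact sm \<rho> c x = (\<Sum>b\<in>F. sm (c b) (cact sm \<rho> (dirac b) x))" for c
  proof -
    have "cact sm \<rho> c x = lin_ext sm (\<lambda>(m, h). \<Sum>b\<in>F. sm (c b) (sm (H_fun (dirac b) h) m)) (\<rho> x)"
      unfolding cact_def by (rule M.lin_ext_cong) (auto simp: exp M.scale_sum_left)
    then show ?thesis
      by (simp add: case_prod_unfold M.lin_ext_fun_sum M.lin_ext_fun_scale cact_def del: M.scale_scale)
  qed
  moreover have "cact sm \<rho> (dirac b) x = 0" if "b \<notin> F" for b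
  proof -
    have "cact sm \<rho> (dirac b) x = lin_ext sm (\<lambda>_. 0) (\<rho> x)"
      unfolding cact_def
      by (rule M.lin_ext_cong) (use that in \<open>auto simp: F_def H_supp_def H_coord_dirac\<close>)
    then show ?thesis by simp
  qed
  ultimately show ?thesis using F by blast
qed

lemma cact_eqI:
  assumes "\<And>b. c b = r * c' b" shows "cact sm \<rho> c x = sm r (cact sm \<rho> c' x)"
proof -
  have "H_fun c h = r * H_fun c' h" for h
    by (simp add: H_fun_supp assms sum_distrib_left mult.left_commute)
  then show ?thesis by (simp add: cact_def case_prod_unfold M.lin_ext_fun_scale[symmetric])
qed

lemma additive_sum:
  assumes V: "M.subspace V" and add: "\<And>x y. x \<in> V \<Longrightarrow> y \<in> V \<Longrightarrow> f (x + y) = f x + f y"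
    and sc: "\<And>c x. x \<in> V \<Longrightarrow> f (sm c x) = sm c (f x)"
    and "finite F" "\<And>i. i \<in> F \<Longrightarrow> g i \<in> V"
  shows "f (\<Sum>i\<in>F. sm (r i) (g i)) = (\<Sum>i\<in>F. sm (r i) (f (g i)))"
  using assms(4,5)
proof (induction F rule: finite_induct)
  case empty
  show ?case using sc[OF M.subspace_0[OF V], of 0] by simp
next
  case (insert i F)
  have "sm (r i) (g i) \<in> V" "(\<Sum>i\<in>F. sm (r i) (g i)) \<in> V"
    using insert by (auto intro!: M.subspace_sum[OF V] M.subspace_scale[OF V])
  then show ?case using insert by (simp add: add sc)
qed

lemma additive_contract:
  assumes V: "M.subspace V" and add: "\<And>x y. x \<in> V \<Longrightarrow> y \<in> V \<Longrightarrow> f (x + y) = f x + f y"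
    and sc: "\<And>c x. x \<in> V \<Longrightarrow> f (sm c x) = sm c (f x)"
    and keys: "Poly_Mapping.keys p \<subseteq> V \<times> UNIV"
  shows "f (lin_ext sm (\<lambda>(m, h). sm (a h) m) p) = lin_ext sm (\<lambda>(m, h). sm (a h) (f m)) p"
proof -
  have "fst z \<in> V" if "z \<in> Poly_Mapping.keys p" for z using keys that by auto
  then show ?thesis
    using additive_sum[OF V add sc, of "Poly_Mapping.keys p" fst "\<lambda>x. Poly_Mapping.lookup p x * a (snd x)"]
    by (simp add: lin_ext_def case_prod_unfold)
qed

lemma comodule_hom_cact:
  assumes V: "M.subspace V" and keys: "\<And>x. x \<in> V \<Longrightarrow> Poly_Mapping.keys (\<rho> x) \<subseteq> V \<times> UNIV"
    and hom: "comodule_hom H_scale sm (V, \<rho>) (W, \<sigma>) f" and x: "x \<in> V"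
  shows "f (cact sm \<rho> c x) = cact sm \<sigma> c (f x)"
proof -
  have f: "\<And>x y. x \<in> V \<Longrightarrow> y \<in> V \<Longrightarrow> f (x + y) = f x + f y" "\<And>c x. x \<in> V \<Longrightarrow> f (sm c x) = sm c (f x)"
    "tensor_eq sm W H_scale UNIV (\<sigma> (f x)) (lin_ext pm_scale (\<lambda>(m, h). fbasis (f m, h)) (\<rho> x))"
    using hom x by (auto simp: comodule_hom_def)
  have "cact sm \<sigma> c (f x) = lin_ext sm (\<lambda>(m, h). sm (H_fun c h) m) (lin_ext pm_scale (\<lambda>(m, h). fbasis (f m, h)) (\<rho> x))"
    unfolding cact_def by (rule lin_ext_contract_cong[OF f(3)])
  also have "\<dots> = lin_ext sm (\<lambda>(m, h). sm (H_fun c h) (f m)) (\<rho> x)"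
    by (simp add: M.lin_ext_lin_ext case_prod_unfold)
  also have "\<dots> = f (cact sm \<rho> c x)"
    unfolding cact_def by (rule additive_contract[OF V f(1,2) keys[OF x], symmetric])
  finally show ?thesis ..
qed

text \<open>Conversely, commuting with the coordinate functionals is enough, since equality in \<open>W \<otimes> H\<close> can be
  tested on coordinates.\<close>

lemma comodule_homI:
  assumes V: "M.subspace V" and keys: "\<And>x. x \<in> V \<Longrightarrow> Poly_Mapping.keys (\<rho> x) \<subseteq> V \<times> UNIV"
    and W: "M.subspace W" and keysW: "\<And>x. x \<in> W \<Longrightarrow> Poly_Mapping.keys (\<sigma> x) \<subseteq> W \<times> UNIV"
    and f: "f ` V \<subseteq> W" "\<And>x y. x \<in> V \<Longrightarrow> y \<in> V \<Longrightarrow> f (x + y) = f x + f y"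
      "\<And>c x. x \<in> V \<Longrightarrow> f (sm c x) = sm c (f x)"
    and comm: "\<And>b x. x \<in> V \<Longrightarrow> f (cact sm \<rho> (dirac b) x) = cact sm \<sigma> (dirac b) (f x)"
  shows "comodule_hom H_scale sm (V, \<rho>) (W, \<sigma>) f"
  unfolding comodule_hom_def prod.case
proof (intro conjI ballI allI f)
  fix x assume x: "x \<in> V"
  let ?q = "lin_ext pm_scale (\<lambda>(m, h). fbasis (f m, h)) (\<rho> x)"
  have fx: "f x \<in> W" using f(1) x by blast
  show "tensor_eq sm W H_scale UNIV (\<sigma> (f x)) ?q"
  proof (rule tensor_eq_coordI[OF M.vector_space_axioms W keysW[OF fx]])
    have sub: "pm.subspace {q :: 'm \<times> 'k hopf_efuv \<Rightarrow>\<^sub>0 'k. Poly_Mapping.keys q \<subseteq> W \<times> UNIV}"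
    proof -
      have "Poly_Mapping.keys (pm_scale c q) \<subseteq> Poly_Mapping.keys q" for c and q :: "'m \<times> 'k hopf_efuv \<Rightarrow>\<^sub>0 'k"
        by (auto simp: in_keys_iff lookup_pm_scale)
      then show ?thesis
        unfolding pm.subspace_def using Poly_Mapping.keys_add by (auto, fast, fast)
    qed
    have "?q \<in> {q. Poly_Mapping.keys q \<subseteq> W \<times> UNIV}"
      by (rule pm.lin_ext_in_subspace[OF sub])
        (use keys[OF x] f(1) in \<open>auto simp: fbasis_def image_subset_iff dest!: subsetD\<close>)
    then show "Poly_Mapping.keys ?q \<subseteq> W \<times> UNIV" by simp
    fix b
    have "lin_ext sm (\<lambda>(m, h). sm (H_coord b h) m) ?q = lin_ext sm (\<lambda>(m, h). sm (H_fun (dirac b) h) (f m)) (\<rho> x)"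
      by (simp add: M.lin_ext_lin_ext case_prod_unfold H_coord_dirac)
    also have "\<dots> = f (cact sm \<rho> (dirac b) x)"
      unfolding cact_def by (rule additive_contract[OF V f(2,3) keys[OF x], symmetric])
    also have "\<dots> = lin_ext sm (\<lambda>(m, h). sm (H_coord b h) m) (\<sigma> (f x))"
      unfolding comm[OF x] by (simp add: cact_def H_coord_dirac)
    finally show "lin_ext sm (\<lambda>(m, h). sm (H_coord b h) m) (\<sigma> (f x)) = lin_ext sm (\<lambda>(m, h). sm (H_coord b h) m) ?q" ..
  qed
qed

end

locale H_comodule = St: H_structure \<Delta> \<epsilon> S + H_space sm
  for \<Delta> :: "'k::field hopf_efuv \<Rightarrow> ('k hopf_efuv \<times> 'k hopf_efuv \<Rightarrow>\<^sub>0 'k)" and \<epsilon> S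
    and sm :: "'k \<Rightarrow> 'm::ab_group_add \<Rightarrow> 'm" +
  fixes V :: "'m set" and \<rho> :: "'m \<Rightarrow> ('m \<times> 'k hopf_efuv \<Rightarrow>\<^sub>0 'k)"
  assumes comod: "comodule H_scale \<Delta> \<epsilon> sm (V, \<rho>)"
begin

lemma VS: "M.subspace V" and keys: "\<And>x. x \<in> V \<Longrightarrow> Poly_Mapping.keys (\<rho> x) \<subseteq> V \<times> UNIV"
  using comod by (simp_all add: comodule_def)

abbreviation D :: "(idx \<Rightarrow> 'k) \<Rightarrow> 'm \<Rightarrow> 'm" where "D \<equiv> cact sm \<rho>"

lemma D_in: "x \<in> V \<Longrightarrow> D c x \<in> V"
  unfolding cact_def by (rule M.lin_ext_in_subspace[OF VS]) (use keys in \<open>auto intro: M.subspace_scale[OF VS]\<close>)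

lemma D_add: "x \<in> V \<Longrightarrow> y \<in> V \<Longrightarrow> D c (x + y) = D c x + D c y"
proof -
  assume "x \<in> V" "y \<in> V"
  then have "tensor_eq sm V H_scale UNIV (\<rho> (x + y)) (\<rho> x + \<rho> y)" using comod by (simp add: comodule_def)
  from lin_ext_contract_cong[OF this] show ?thesis by (simp add: cact_def M.lin_ext_add)
qed

lemma D_scale: "x \<in> V \<Longrightarrow> D c (sm r x) = sm r (D c x)"
proof -
  assume "x \<in> V"
  then have "tensor_eq sm V H_scale UNIV (\<rho> (sm r x)) (pm_scale r (\<rho> x))" using comod by (simp add: comodule_def)
  from lin_ext_contract_cong[OF this] show ?thesis by (simp add: cact_def M.lin_ext_scale)
qed

lemma D_unit: "x \<in> V \<Longrightarrow> D conv_unit x = x"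
  using comod by (simp add: comodule_def cact_def St.counit_eq)

text \<open>Coassociativity of the coaction, evaluated on a pair of functionals.\<close>

lemma D_D: assumes x: "x \<in> V" shows "D c (D c' x) = D (conv c c') x"
proof -
  let ?g = "\<lambda>(m, h, h'). sm (H_fun c h * H_fun c' h') m"
  have "tensor3_eq sm V H_scale UNIV H_scale UNIV (map_left \<rho> (\<rho> x)) (map_right \<Delta> (\<rho> x))"
    using comod x by (simp add: comodule_def)
  then have eq: "lin_ext sm ?g (map_left \<rho> (\<rho> x)) = lin_ext sm ?g (map_right \<Delta> (\<rho> x))"
    by (rule tensor3_eq_lin_ext[OF M.vector_space_axioms, rotated 6])
      (simp_all add: M.scale_right_distrib M.scale_left_distrib distrib_left distrib_right ac_simps)
  have "lin_ext sm ?g (map_left \<rho> (\<rho> x)) = lin_ext sm (\<lambda>(m, h'). sm (H_fun c' h') (D c m)) (\<rho> x)"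
  proof -
    have "lin_ext sm (\<lambda>(m', h). sm (H_fun c h * H_fun c' h') m') q
        = sm (H_fun c' h') (lin_ext sm (\<lambda>(m', h). sm (H_fun c h) m') q)" for h' q
      by (simp add: M.lin_ext_fun_scale[symmetric] case_prod_unfold mult.commute)
    then show ?thesis
      unfolding map_left_def M.lin_ext_lin_ext cact_def by (simp add: case_prod_unfold M.lin_ext_lin_ext)
  qed
  also have "\<dots> = D c (D c' x)"
    unfolding cact_def[of sm \<rho> c' x] by (rule additive_contract[OF VS D_add D_scale keys[OF x], symmetric])
  finally have left: "lin_ext sm ?g (map_left \<rho> (\<rho> x)) = D c (D c' x)" .
  have "lin_ext sm (\<lambda>(a, b). sm (H_fun c a * H_fun c' b) m) q = sm (H_eval (H_fun c) (H_fun c') q) m" for m q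
    unfolding H_eval_def
    by (subst linear_lin_ext[where L = "\<lambda>r. sm r m", OF fld.vector_space_axioms M.vector_space_axioms])
      (simp_all add: M.scale_left_distrib case_prod_unfold)
  then have "lin_ext sm ?g (map_right \<Delta> (\<rho> x)) = D (conv c c') x"
    unfolding map_right_def M.lin_ext_lin_ext cact_def
    by (simp add: case_prod_unfold M.lin_ext_lin_ext St.eval_comult[symmetric])
  then show ?thesis using left eq by simp
qed

definition wproj :: "int \<Rightarrow> 'm \<Rightarrow> 'm" where "wproj i = D (dirac (L1, True, i))"

text \<open>The functionals whose action is \<open>s\<close>, \<open>X\<close> and \<open>Y\<close>: evaluation at the reflection in \<open>O(2)\<close>, and the
  tangent vectors at the identity dual to \<open>u\<close> and \<open>v\<close>.\<close>

definition fun_s :: "idx \<Rightarrow> 'k" where "fun_s = (\<lambda>(l, c, k). if l = L1 \<and> \<not> c then 1 else 0)"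
definition fun_X :: "idx \<Rightarrow> 'k" where "fun_X = (\<lambda>(l, c, k). if l = Lu \<and> c then 1 else 0)"
definition fun_Y :: "idx \<Rightarrow> 'k" where "fun_Y = (\<lambda>(l, c, k). if l = Lv \<and> c then 1 else 0)"

lemma D_DI: "x \<in> V \<Longrightarrow> (\<And>b. conv c c' b = r * d b) \<Longrightarrow> D c (D c' x) = sm r (D d x)"
  by (simp add: D_D cact_eqI)

lemma D_D_eqI: "x \<in> V \<Longrightarrow> (\<And>b. conv c c' b = conv d d' b) \<Longrightarrow> D c (D c' x) = D d (D d' x)"
  using cact_eqI[of "conv c c'" 1 "conv d d'"] by (simp add: D_D)

lemma dirac_simps: "dirac (l, c, k) (l', c', k') = (if l' = l \<and> c' = c \<and> k' = k then 1 else 0)"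
  by (simp add: dirac_def)

lemmas funs = conv_simps dirac_simps fun_s_def fun_X_def fun_Y_def

lemma relations:
  assumes x: "x \<in> V"
  shows "wproj i (wproj j x) = (if i = j then wproj i x else 0)"
    "D fun_s (D fun_s x) = x" "wproj i (D fun_s x) = D fun_s (wproj (- i) x)"
    "wproj i (D fun_X x) = D fun_X (wproj (i + 1) x)" "wproj i (D fun_Y x) = D fun_Y (wproj (i - 1) x)"
    "D fun_X (D fun_X x) = 0" "D fun_Y (D fun_Y x) = 0" "D fun_Y (D fun_X x) = - D fun_X (D fun_Y x)"
    "D fun_X (D fun_s x) = D fun_s (D fun_Y x)"
proof -
  have "wproj i (wproj j x) = sm (if i = j then 1 else 0) (wproj i x)"
    unfolding wproj_def by (rule D_DI[OF x], case_tac b rule: idx_cases) (auto simp: funs)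
  then show "wproj i (wproj j x) = (if i = j then wproj i x else 0)" by simp
  have "D fun_s (D fun_s x) = sm 1 (D conv_unit x)"
    by (rule D_DI[OF x], case_tac b rule: idx_cases) (auto simp: funs conv_unit_def)
  then show "D fun_s (D fun_s x) = x" using D_unit[OF x] by simp
  show "wproj i (D fun_s x) = D fun_s (wproj (- i) x)"
    unfolding wproj_def by (rule D_D_eqI[OF x], case_tac b rule: idx_cases) (auto simp: funs)
  show "wproj i (D fun_X x) = D fun_X (wproj (i + 1) x)"
    unfolding wproj_def by (rule D_D_eqI[OF x], case_tac b rule: idx_cases) (auto simp: funs)
  show "wproj i (D fun_Y x) = D fun_Y (wproj (i - 1) x)"
    unfolding wproj_def by (rule D_D_eqI[OF x], case_tac b rule: idx_cases) (auto simp: funs)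
  have "D fun_X (D fun_X x) = sm 0 (D conv_unit x)"
    by (rule D_DI[OF x], case_tac b rule: idx_cases) (auto simp: funs)
  then show "D fun_X (D fun_X x) = 0" by simp
  have "D fun_Y (D fun_Y x) = sm 0 (D conv_unit x)"
    by (rule D_DI[OF x], case_tac b rule: idx_cases) (auto simp: funs)
  then show "D fun_Y (D fun_Y x) = 0" by simp
  have "D fun_Y (D fun_X x) = sm (- 1) (D (conv fun_X fun_Y) x)"
    by (rule D_DI[OF x], case_tac b rule: idx_cases) (auto simp: funs)
  then show "D fun_Y (D fun_X x) = - D fun_X (D fun_Y x)" using D_D[OF x] by simp
  show "D fun_X (D fun_s x) = D fun_s (D fun_Y x)"
    by (rule D_D_eqI[OF x], case_tac b rule: idx_cases) (auto simp: funs)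
qed

text \<open>Every coordinate functional is a convolution product of these functionals, so a subspace or a
  linear map that is compatible with the operators is compatible with the coaction.\<close>

lemma D_dirac:
  assumes x: "x \<in> V"
  shows "D (dirac (L1, True, k)) x = wproj k x" "D (dirac (L1, False, k)) x = wproj k (D fun_s x)"
    "D (dirac (Lu, True, k)) x = wproj k (D fun_X x)" "D (dirac (Lu, False, k)) x = wproj k (D fun_s (D fun_X x))"
    "D (dirac (Lv, True, k)) x = wproj k (D fun_Y x)" "D (dirac (Lv, False, k)) x = wproj k (D fun_s (D fun_Y x))"
    "D (dirac (Luv, True, k)) x = wproj k (D fun_Y (D fun_X x))" "D (dirac (Luv, False, k)) x = wproj k (D fun_s (D fun_Y (D fun_X x)))"
proof -
  have eq: "D d x = D d' x" if "\<And>b. d b = d' b" for d d'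
    using cact_eqI[of d 1 d'] that by simp
  show "D (dirac (L1, True, k)) x = wproj k x" by (simp add: wproj_def)
  show "D (dirac (L1, False, k)) x = wproj k (D fun_s x)"
    unfolding wproj_def D_D[OF x] by (rule eq, case_tac b rule: idx_cases) (auto simp: funs)
  show "D (dirac (Lu, True, k)) x = wproj k (D fun_X x)"
    unfolding wproj_def D_D[OF x] by (rule eq, case_tac b rule: idx_cases) (auto simp: funs)
  show "D (dirac (Lv, True, k)) x = wproj k (D fun_Y x)"
    unfolding wproj_def D_D[OF x] by (rule eq, case_tac b rule: idx_cases) (auto simp: funs)
  show "D (dirac (Lu, False, k)) x = wproj k (D fun_s (D fun_X x))"
    unfolding wproj_def D_D[OF x] D_D[OF D_in[OF x]]
    by (rule eq, case_tac b rule: idx_cases) (auto simp: funs)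
  show "D (dirac (Lv, False, k)) x = wproj k (D fun_s (D fun_Y x))"
    unfolding wproj_def D_D[OF x] D_D[OF D_in[OF x]]
    by (rule eq, case_tac b rule: idx_cases) (auto simp: funs)
  show "D (dirac (Luv, True, k)) x = wproj k (D fun_Y (D fun_X x))"
    unfolding wproj_def D_D[OF x] D_D[OF D_in[OF x]]
    by (rule eq, case_tac b rule: idx_cases) (auto simp: funs)
  show "D (dirac (Luv, False, k)) x = wproj k (D fun_s (D fun_Y (D fun_X x)))"
    unfolding wproj_def D_D[OF x] D_D[OF D_in[OF x]]
    by (rule eq, case_tac b rule: idx_cases) (auto simp: funs)
qed

lemma subcomodule_D:
  assumes N: "subcomodule H_scale sm (V, \<rho>) N" and x: "x \<in> N"
  shows "D c x \<in> N"
proof -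
  have sub: "M.subspace N" using N by (simp add: subcomodule_def)
  obtain y where y: "Poly_Mapping.keys y \<subseteq> N \<times> UNIV" "tensor_eq sm V H_scale UNIV y (\<rho> x)"
    using N x by (auto simp: subcomodule_def)
  have "D c x = lin_ext sm (\<lambda>(m, h). sm (H_fun c h) m) y"
    unfolding cact_def by (rule lin_ext_contract_cong[OF y(2), symmetric])
  then show ?thesis
    using M.lin_ext_in_subspace[OF sub, of y "\<lambda>(m, h). sm (H_fun c h) m"] y(1)
    by (auto intro: M.subspace_scale[OF sub])
qed

lemma subcomoduleI:
  assumes N: "M.subspace N" "N \<subseteq> V" and D: "\<And>x b. x \<in> N \<Longrightarrow> D (dirac b) x \<in> N"
  shows "subcomodule H_scale sm (V, \<rho>) N"
  unfolding subcomodule_def prod.case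
proof (intro conjI ballI N)
  fix x assume x: "x \<in> N"
  then have xV: "x \<in> V" using N by blast
  define F where "F = (\<Union>(m, h)\<in>Poly_Mapping.keys (\<rho> x). H_supp h)"
  have F: "finite F" by (auto simp: F_def)
  let ?y = "\<Sum>b\<in>F. fbasis (D (dirac b) x, H_basis b) :: 'm \<times> 'k hopf_efuv \<Rightarrow>\<^sub>0 'k"
  have "tensor_eq sm V H_scale UNIV (\<rho> x)
      (\<Sum>b\<in>F. fbasis (lin_ext sm (\<lambda>(m, h). sm (H_coord b h) m) (\<rho> x), H_basis b))"
    by (rule tensor_eq_coordinates[OF M.vector_space_axioms H.vector_space_axioms VS keys[OF xV] F],
        rule H_expand[OF F]) (auto simp: F_def)
  then have "tensor_eq sm V H_scale UNIV ?y (\<rho> x)"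
    by (simp add: cact_def H_coord_dirac tensor_eq_sym)
  moreover have "Poly_Mapping.keys ?y \<subseteq> N \<times> UNIV"
  proof -
    have "Poly_Mapping.keys ?y \<subseteq> (\<Union>b\<in>F. Poly_Mapping.keys (fbasis (D (dirac b) x, H_basis b) :: 'm \<times> 'k hopf_efuv \<Rightarrow>\<^sub>0 'k))"
      by (rule Poly_Mapping.keys_sum)
    also have "\<dots> \<subseteq> N \<times> UNIV" using D[OF x] by (auto simp: fbasis_def)
    finally show ?thesis .
  qed
  ultimately show "\<exists>y. Poly_Mapping.keys y \<subseteq> N \<times> UNIV \<and> tensor_eq sm V H_scale UNIV y (\<rho> x)" by blast
qed

definition weights :: "int set" where "weights = {i. \<exists>x\<in>V. wproj i x \<noteq> 0}"

lemma finite_weights: assumes "finite_dim_comodule sm (V, \<rho>)" shows "finite weights"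
proof -
  obtain B where B: "finite B" "V = M.span B" using assms by (auto simp: finite_dim_comodule_def)
  have BV: "B \<subseteq> V" using B(2) M.span_base by blast
  have fin: "finite {i. wproj i x \<noteq> 0}" for x
  proof -
    obtain F where F: "finite F" "\<And>b. b \<notin> F \<Longrightarrow> D (dirac b) x = 0" using cact_finite[of \<rho> x] by blast
    have "(\<lambda>i. (L1, True, i)) ` {i. wproj i x \<noteq> 0} \<subseteq> F" using F(2) by (auto simp: wproj_def)
    then have "finite ((\<lambda>i. (L1, True, i)) ` {i. wproj i x \<noteq> 0})" using F(1) finite_subset by blast
    then show ?thesis by (rule finite_imageD) (simp add: inj_on_def)
  qed
  have "weights \<subseteq> (\<Union>x\<in>B. {i. wproj i x \<noteq> 0})"
  proof
    fix i assume "i \<in> weights"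
    then obtain x where x: "x \<in> V" "wproj i x \<noteq> 0" by (auto simp: weights_def)
    have "\<exists>b\<in>B. wproj i b \<noteq> 0"
    proof (rule ccontr)
      assume no: "\<not> (\<exists>b\<in>B. wproj i b \<noteq> 0)"
      have 0: "wproj i 0 = 0" using D_scale[OF M.subspace_0[OF VS], of _ 0] by (simp add: wproj_def)
      have "M.subspace {x \<in> V. wproj i x = 0}"
        using VS 0 by (auto simp: M.subspace_def wproj_def D_add D_scale)
      moreover have "B \<subseteq> {x \<in> V. wproj i x = 0}" using no BV by auto
      ultimately have "V \<subseteq> {x \<in> V. wproj i x = 0}" unfolding B(2)[symmetric] using M.span_minimal B(2) by metis
      then show False using x by blast
    qed
    then show "i \<in> (\<Union>x\<in>B. {i. wproj i x \<noteq> 0})" by blast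
  qed
  then show ?thesis using B(1) fin finite_subset by blast
qed

text \<open>Coactions are meaningful on \<open>V\<close> only; a projection onto \<open>V\<close> extends the operators to linear maps
  on the ambient space.\<close>

definition q :: "'m \<Rightarrow> 'm" where
  "q = (SOME q. (\<forall>x y. q (x + y) = q x + q y) \<and> (\<forall>c x. q (sm c x) = sm c (q x)) \<and> range q \<subseteq> V \<and> (\<forall>w\<in>V. q w = w))"

lemma q: "q (x + y) = q x + q y" "q (sm c x) = sm c (q x)" "q x \<in> V" "w \<in> V \<Longrightarrow> q w = w"
proof -
  have "(\<forall>x y. q (x + y) = q x + q y) \<and> (\<forall>c x. q (sm c x) = sm c (q x)) \<and> range q \<subseteq> V \<and> (\<forall>w\<in>V. q w = w)"
    unfolding q_def by (rule someI_ex[OF M.projection_exists[OF VS]])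
  then show "q (x + y) = q x + q y" "q (sm c x) = sm c (q x)" "q x \<in> V" "w \<in> V \<Longrightarrow> q w = w" by blast+
qed

definition opp :: "int \<Rightarrow> 'm \<Rightarrow> 'm" where "opp i x = wproj i (q x)"
definition ops :: "'m \<Rightarrow> 'm" where "ops x = D fun_s (q x)"
definition opX :: "'m \<Rightarrow> 'm" where "opX x = D fun_X (q x)"
definition opY :: "'m \<Rightarrow> 'm" where "opY x = D fun_Y (q x)"

lemma op_V: "x \<in> V \<Longrightarrow> opp i x = wproj i x" "x \<in> V \<Longrightarrow> ops x = D fun_s x" "x \<in> V \<Longrightarrow> opX x = D fun_X x" "x \<in> V \<Longrightarrow> opY x = D fun_Y x"
  by (simp_all add: opp_def ops_def opX_def opY_def q)

lemma O2rep_comodule: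
  assumes char: "(2 :: 'k) \<noteq> 0" and K: "weights \<subseteq> {- int K..int K}"
  shows "O2rep sm V opp ops opX opY K"
proof -
  have out: "wproj i x = 0" if "x \<in> V" "\<bar>i\<bar> > int K" for i x
    using that K unfolding weights_def by fastforce
  have sum: "x = (\<Sum>i\<in>{- int K..int K}. wproj i x)" if x: "x \<in> V" for x
  proof -
    obtain F where F: "finite F" "\<And>c. D c x = (\<Sum>b\<in>F. sm (c b) (D (dirac b) x))" "\<And>b. b \<notin> F \<Longrightarrow> D (dirac b) x = 0"
      using cact_finite[of \<rho> x] by blast
    let ?i = "\<lambda>i. (L1, True, i)"
    have "x = (\<Sum>b\<in>F. sm (conv_unit b) (D (dirac b) x))" using D_unit[OF x] F(2) by metis
    also have "\<dots> = (\<Sum>b\<in>?i ` {- int K..int K}. sm (conv_unit b) (D (dirac b) x))"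
    proof (rule sum.mono_neutral_cong[OF _ F(1)])
      fix b assume b: "b \<in> F - ?i ` {- int K..int K}"
      show "sm (conv_unit b) (D (dirac b) x) = 0"
      proof (cases "\<exists>i. b = ?i i")
        case True
        then obtain i where i: "b = ?i i" by blast
        then have "i \<notin> {- int K..int K}" using b by blast
        then have "\<bar>i\<bar> > int K" by auto
        then show ?thesis using out[OF x] i by (simp add: wproj_def)
      next
        case False
        then have "conv_unit b = (0 :: 'k)" by (cases b) (auto simp: conv_unit_def)
        then show ?thesis by simp
      qed
    qed (use F(3) in auto)
    also have "\<dots> = (\<Sum>i\<in>{- int K..int K}. wproj i x)"
      by (subst sum.reindex) (simp_all add: inj_on_def conv_unit_def wproj_def)
    finally show ?thesis .
  qed
  have wproj_in: "wproj i x \<in> V" if "x \<in> V" for i x using D_in[OF that] by (simp add: wproj_def)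
  have lin: "opp i (x + y) = opp i x + opp i y" "opp i (sm c x) = sm c (opp i x)"
    "ops (x + y) = ops x + ops y" "ops (sm c x) = sm c (ops x)"
    "opX (x + y) = opX x + opX y" "opX (sm c x) = sm c (opX x)"
    "opY (x + y) = opY x + opY y" "opY (sm c x) = sm c (opY x)" for i c x y
    by (simp_all add: opp_def ops_def opX_def opY_def wproj_def q D_add D_scale)
  have sum': "x = (\<Sum>i\<in>{- int K..int K}. opp i x)" if "x \<in> V" for x
    using sum[OF that] by (simp only: op_V[OF that])
  show ?thesis
    by (rule O2rep.intro[OF M.vector_space_axioms O2rep_axioms.intro])
      (fact char VS lin sum' | simp add: op_V wproj_in D_in out relations(1) relations(2) relations(3)
        relations(4) relations(5) relations(6) relations(7) relations(8) relations(9))+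
qed

lemma stable_subcomodule:
  assumes O2: "O2rep sm V opp ops opX opY K" and N: "O2rep.stable sm V opp ops opX opY N"
  shows "subcomodule H_scale sm (V, \<rho>) N"
proof -
  interpret O: O2rep sm V opp ops opX opY K by fact
  have N': "M.subspace N" "N \<subseteq> V" "\<And>x i. x \<in> N \<Longrightarrow> opp i x \<in> N" "\<And>x. x \<in> N \<Longrightarrow> ops x \<in> N"
    "\<And>x. x \<in> N \<Longrightarrow> opX x \<in> N" "\<And>x. x \<in> N \<Longrightarrow> opY x \<in> N"
    using N by (auto simp: O.stable_def)
  have cl: "wproj i x \<in> N" "D fun_s x \<in> N" "D fun_X x \<in> N" "D fun_Y x \<in> N" if "x \<in> N" for x i
    using N'(3-6)[OF that] op_V[OF subsetD[OF N'(2) that]] by auto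
  show ?thesis
  proof (rule subcomoduleI[OF N'(1,2)])
    fix x b assume x: "x \<in> N"
    then have "x \<in> V" using N'(2) by blast
    then show "D (dirac b) x \<in> N"
      by (cases b rule: idx_cases; cases "fst (snd b)") (simp_all add: D_dirac cl x)
  qed
qed

end

section \<open>Counting indecomposable comodules\<close>

type_synonym entry = "(bool \<times> nat) option"

text \<open>An entry describes one column of a matrix: zero, or a basis vector with a sign.\<close>

fun decode :: "'m::ab_group_add list \<Rightarrow> entry \<Rightarrow> 'm" where
  "decode xs None = 0" | "decode xs (Some (t, k)) = (if t then xs ! k else - (xs ! k))"

definition entries :: "nat \<Rightarrow> entry set" where "entries n = insert None (Some ` (UNIV \<times> {..<n}))"

lemma finite_entries: "finite (entries n)" by (simp add: entries_def)

text \<open>For each basis vector, its weight and its images under \<open>s\<close>, \<open>X\<close> and \<open>Y\<close>.\<close>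

type_synonym code = "(int \<times> entry \<times> entry \<times> entry) list"

definition codes :: "nat \<Rightarrow> nat \<Rightarrow> code set" where
  "codes K N = {cs. set cs \<subseteq> {- int K..int K} \<times> entries N \<times> entries N \<times> entries N \<and> length cs \<le> N}"

lemma finite_codes: "finite (codes K N)"
  unfolding codes_def by (intro finite_lists_length_le finite_cartesian_product finite_entries) simp

context O2rep
begin

definition coded :: "'m list \<Rightarrow> code \<Rightarrow> bool" where
  "coded xs cs \<longleftrightarrow> distinct xs \<and> independent (set xs) \<and> span (set xs) = V \<and> length cs = length xs \<and>
     (\<forall>j<length xs. case cs ! j of (w, a, b, c) \<Rightarrow> p w (xs ! j) = xs ! j \<and>
        s (xs ! j) = decode xs a \<and> X (xs ! j) = decode xs b \<and> Y (xs ! j) = decode xs c \<and>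
        {a, b, c} \<subseteq> entries (length xs))"

lemma sclosed_decode: "sclosed (set xs) x \<Longrightarrow> \<exists>a\<in>entries (length xs). x = decode xs a"
proof -
  assume "sclosed (set xs) x"
  then consider "x = 0" | k where "k < length xs" "x = xs ! k" | k where "k < length xs" "x = - (xs ! k)"
    by (auto simp: sclosed_def in_set_conv_nth minus_equation_iff eq_commute[of "- _"])
  then show ?thesis
  proof cases
    case 1
    then show ?thesis by (intro bexI[of _ None]) (simp_all add: entries_def)
  next
    case 2
    then show ?thesis by (intro bexI[of _ "Some (True, k)"]) (simp_all add: entries_def)
  next
    case 3
    then show ?thesis by (intro bexI[of _ "Some (False, k)"]) (simp_all add: entries_def)
  qed
qed

lemma monomial_basis_coded:
  assumes "monomial_basis N B" shows "\<exists>cs\<in>codes K N. \<exists>xs. coded xs cs"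
proof -
  have B: "independent B" "span B = V" "monomial B" "finite B" "card B \<le> N"
    using assms by (auto simp: monomial_basis_def)
  obtain xs where xs: "set xs = B" "distinct xs" using finite_distinct_list[OF B(4)] by blast
  have len: "length xs \<le> N" using xs B(5) distinct_card by metis
  define good where "good j t \<longleftrightarrow> t \<in> {- int K..int K} \<times> entries (length xs) \<times> entries (length xs) \<times> entries (length xs) \<and>
     (case t of (w, a, b, c) \<Rightarrow> p w (xs ! j) = xs ! j \<and> s (xs ! j) = decode xs a \<and> X (xs ! j) = decode xs b \<and>
        Y (xs ! j) = decode xs c)" for j t
  have "\<exists>t. good j t" if j: "j < length xs" for j
  proof -
    let ?b = "xs ! j"
    have b: "?b \<in> B" using j xs(1) nth_mem by blast
    have "?b \<noteq> 0" using b B(1) dependent_zero by metis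
    moreover have "?b \<in> V" using b B(2) span_base by blast
    moreover obtain w where w: "p w ?b = ?b" using B(3) b by (auto simp: monomial_def)
    ultimately have "w \<in> {- int K..int K}" using p_out[of ?b w] by fastforce
    moreover have "sclosed (set xs) (s ?b)" "sclosed (set xs) (X ?b)" "sclosed (set xs) (Y ?b)"
      using B(3) b xs(1) by (auto simp: monomial_def)
    then obtain a b' c where "a \<in> entries (length xs)" "s ?b = decode xs a" "b' \<in> entries (length xs)" "X ?b = decode xs b'"
      "c \<in> entries (length xs)" "Y ?b = decode xs c"
      using sclosed_decode[of xs] by meson
    ultimately have "good j (w, a, b', c)" using w by (simp add: good_def)
    then show ?thesis by blast
  qed
  then obtain t where t: "\<And>j. j < length xs \<Longrightarrow> good j (t j)" by metis
  define cs where "cs = map t [0..<length xs]"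
  have "coded xs cs"
    unfolding coded_def
  proof (intro conjI allI impI)
    fix j assume j: "j < length xs"
    then have "cs ! j = t j" by (simp add: cs_def)
    then show "case cs ! j of (w, a, b, c) \<Rightarrow> p w (xs ! j) = xs ! j \<and>
        s (xs ! j) = decode xs a \<and> X (xs ! j) = decode xs b \<and> Y (xs ! j) = decode xs c \<and>
        {a, b, c} \<subseteq> entries (length xs)"
      using t[OF j] by (auto simp: good_def)
  qed (use xs B in \<open>auto simp: cs_def\<close>)
  moreover have "entries (length xs) \<subseteq> entries N" using len by (auto simp: entries_def)
  then have "set cs \<subseteq> {- int K..int K} \<times> entries N \<times> entries N \<times> entries N"
    using t by (fastforce simp: cs_def good_def)
  then have "cs \<in> codes K N" using len by (simp add: codes_def cs_def)
  ultimately show ?thesis by blast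
qed

end

text \<open>The map that sends one basis to the other intertwines the operators, since both sides are given by
  the same matrices.\<close>

lemma coded_hom:
  assumes A: "O2rep sm V p s X Y K" and B: "O2rep sm V' p' s' X' Y' K'"
    and ca: "O2rep.coded sm V p s X Y xs cs" and cb: "O2rep.coded sm V' p' s' X' Y' xs' cs"
  shows "\<exists>f. (\<forall>x y. f (x + y) = f x + f y) \<and> (\<forall>c x. f (sm c x) = sm c (f x)) \<and> f ` V \<subseteq> V' \<and>
    (\<forall>j<length xs. f (xs ! j) = xs' ! j) \<and>
    (\<forall>v\<in>V. (\<forall>i. f (p i v) = p' i (f v)) \<and> f (s v) = s' (f v) \<and> f (X v) = X' (f v) \<and> f (Y v) = Y' (f v))"
proof -
  interpret A: O2rep sm V p s X Y K by fact
  interpret B: O2rep sm V' p' s' X' Y' K' by fact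
  interpret vp: vector_space_pair sm sm by (intro vector_space_pair.intro A.vector_space_axioms)
  have xs: "distinct xs" "A.independent (set xs)" "A.span (set xs) = V" "length cs = length xs"
    and cA: "\<And>j w a b c. j < length xs \<Longrightarrow> cs ! j = (w, a, b, c) \<Longrightarrow> p w (xs ! j) = xs ! j \<and>
        s (xs ! j) = decode xs a \<and> X (xs ! j) = decode xs b \<and> Y (xs ! j) = decode xs c \<and>
        {a, b, c} \<subseteq> entries (length xs)"
    using ca unfolding A.coded_def by fastforce+
  have xs': "A.span (set xs') = V'" "length cs = length xs'"
    and cB: "\<And>j w a b c. j < length xs' \<Longrightarrow> cs ! j = (w, a, b, c) \<Longrightarrow> p' w (xs' ! j) = xs' ! j \<and>
        s' (xs' ! j) = decode xs' a \<and> X' (xs' ! j) = decode xs' b \<and> Y' (xs' ! j) = decode xs' c"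
    using cb unfolding B.coded_def by fastforce+
  have len: "length xs' = length xs" using xs(4) xs'(2) by simp
  define ix where "ix x = (THE j. j < length xs \<and> xs ! j = x)" for x
  have ix: "ix (xs ! j) = j" if "j < length xs" for j
    unfolding ix_def using that xs(1) by (auto simp: nth_eq_iff_index_eq intro!: the_equality)
  obtain f where f: "Vector_Spaces.linear sm sm f" "\<forall>x\<in>set xs. f x = xs' ! ix x"
    using vp.linear_independent_extend[OF xs(2), of "\<lambda>x. xs' ! ix x"] by blast
  have lin: "f (x + y) = f x + f y" "f (sm c x) = sm c (f x)" for x y c
    using f(1) by (simp_all add: Vector_Spaces.linear_iff)
  have f0: "f 0 = 0" using lin(2)[of 0 0] by simp
  have fneg: "f (- x) = - f x" for x using lin(1)[of x "- x"] f0 by (simp add: eq_neg_iff_add_eq_0 add.commute)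
  have fx: "f (xs ! j) = xs' ! j" if "j < length xs" for j using f(2) ix that by simp
  have fd: "f (decode xs a) = decode xs' a" if "a \<in> entries (length xs)" for a
    using that by (auto simp: entries_def f0 fneg fx)
  have ext: "f (T v) = T' (f v)" if v: "v \<in> V" and T: "\<And>j. j < length xs \<Longrightarrow> f (T (xs ! j)) = T' (xs' ! j)"
    "\<And>x y. T (x + y) = T x + T y" "\<And>c x. T (sm c x) = sm c (T x)"
    "\<And>x y. T' (x + y) = T' x + T' y" "\<And>c x. T' (sm c x) = sm c (T' x)" for T T' v
    using v unfolding xs(3)[symmetric]
  proof (induction rule: A.span_induct_alt)
    case base
    have "T 0 = 0" "T' 0 = 0" using T(3)[of 0 0] T(5)[of 0 0] by simp_all
    then show ?case by (simp add: f0)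
  next
    case (step c x y)
    then obtain j where "j < length xs" "x = xs ! j" by (metis in_set_conv_nth)
    then show ?case using step by (simp add: T lin fx)
  qed
  have V: "xs ! j \<in> V" if "j < length xs" for j using that xs(3) A.span_base nth_mem by blast
  have V': "xs' ! j \<in> V'" if "j < length xs" for j using that xs'(1) A.span_base nth_mem len by metis
  have "f v \<in> V'" if "v \<in> V" for v
    using that unfolding xs(3)[symmetric]
  proof (induction rule: A.span_induct_alt)
    case (step c x y)
    then obtain j where "j < length xs" "x = xs ! j" by (metis in_set_conv_nth)
    then show ?case using step V' B.in_V by (simp add: lin fx)
  qed (use f0 B.in_V in auto)
  moreover have "f (p i v) = p' i (f v) \<and> f (s v) = s' (f v) \<and> f (X v) = X' (f v) \<and> f (Y v) = Y' (f v)" if v: "v \<in> V" for v i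
  proof -
    have e: "f (p i (xs ! j)) = p' i (xs' ! j) \<and> f (s (xs ! j)) = s' (xs' ! j) \<and>
        f (X (xs ! j)) = X' (xs' ! j) \<and> f (Y (xs ! j)) = Y' (xs' ! j)" if j: "j < length xs" for j
    proof -
      obtain w a b c where cs: "cs ! j = (w, a, b, c)" by (metis prod_cases4)
      note a = cA[OF j cs] and b = cB[OF j[folded len] cs]
      have "p i (xs ! j) = (if i = w then xs ! j else 0)" using A.pp[OF V[OF j], of i w] a by auto
      moreover have "p' i (xs' ! j) = (if i = w then xs' ! j else 0)" using B.pp[OF V'[OF j], of i w] b by auto
      ultimately show ?thesis using a b fd fx[OF j] f0 by auto
    qed
    show ?thesis
      using ext[of v "p i" "p' i", OF v] ext[of v s s', OF v] ext[of v X X', OF v] ext[of v Y Y', OF v] e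
      by (simp add: A.lin B.lin)
  qed
  ultimately show ?thesis using lin fx by (intro exI[of _ f]) auto
qed

lemma comodule_iso_coded:
  assumes A: "H_comodule \<Delta> \<epsilon> S sm V \<rho>" and B: "H_comodule \<Delta> \<epsilon> S sm V' \<rho>'"
    and OA: "O2rep sm V (H_comodule.opp sm V \<rho>) (H_comodule.ops sm V \<rho>) (H_comodule.opX sm V \<rho>) (H_comodule.opY sm V \<rho>) K"
    and OB: "O2rep sm V' (H_comodule.opp sm V' \<rho>') (H_comodule.ops sm V' \<rho>') (H_comodule.opX sm V' \<rho>') (H_comodule.opY sm V' \<rho>') K"
    and ca: "O2rep.coded sm V (H_comodule.opp sm V \<rho>) (H_comodule.ops sm V \<rho>) (H_comodule.opX sm V \<rho>) (H_comodule.opY sm V \<rho>) xs cs"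
    and cb: "O2rep.coded sm V' (H_comodule.opp sm V' \<rho>') (H_comodule.ops sm V' \<rho>') (H_comodule.opX sm V' \<rho>') (H_comodule.opY sm V' \<rho>') xs' cs"
  shows "comodule_iso H_scale sm (V, \<rho>) (V', \<rho>')"
proof -
  interpret A: H_comodule \<Delta> \<epsilon> S sm V \<rho> by fact
  interpret B: H_comodule \<Delta> \<epsilon> S sm V' \<rho>' by fact
  interpret OA: O2rep sm V A.opp A.ops A.opX A.opY K by fact
  interpret OB: O2rep sm V' B.opp B.ops B.opX B.opY K by fact
  obtain f where f: "\<And>x y. f (x + y) = f x + f y" "\<And>c x. f (sm c x) = sm c (f x)" "f ` V \<subseteq> V'"
    "\<And>j. j < length xs \<Longrightarrow> f (xs ! j) = xs' ! j"
    and comm: "\<And>v i. v \<in> V \<Longrightarrow> f (A.opp i v) = B.opp i (f v)" "\<And>v. v \<in> V \<Longrightarrow> f (A.ops v) = B.ops (f v)"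
      "\<And>v. v \<in> V \<Longrightarrow> f (A.opX v) = B.opX (f v)" "\<And>v. v \<in> V \<Longrightarrow> f (A.opY v) = B.opY (f v)"
    using coded_hom[OF OA OB ca cb] by metis
  obtain g where g: "\<And>x y. g (x + y) = g x + g y" "\<And>c x. g (sm c x) = sm c (g x)" "g ` V' \<subseteq> V"
    "\<And>j. j < length xs' \<Longrightarrow> g (xs' ! j) = xs ! j"
    using coded_hom[OF OB OA cb ca] by metis
  have len: "length xs' = length xs" using ca cb by (simp add: OA.coded_def OB.coded_def)
  have span: "A.M.span (set xs) = V" "A.M.span (set xs') = V'" using ca cb by (simp_all add: OA.coded_def OB.coded_def)
  have inv: "h (k v) = v" if "v \<in> A.M.span (set ys)" "\<And>j. j < length ys \<Longrightarrow> h (k (ys ! j)) = ys ! j"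
    "\<And>x y. h (x + y) = h x + h y" "\<And>c x. h (sm c x) = sm c (h x)"
    "\<And>x y. k (x + y) = k x + k y" "\<And>c x. k (sm c x) = sm c (k x)" for h k v ys
    using that(1)
  proof (induction rule: A.M.span_induct_alt)
    case base
    show ?case using that(4)[of 0 0] that(6)[of 0 0] by simp
  next
    case (step c x y)
    then obtain j where "j < length ys" "x = ys ! j" by (metis in_set_conv_nth)
    then show ?case using step by (simp add: that)
  qed
  have "bij_betw f V V'"
  proof (rule bij_betw_byWitness[where f' = g])
    show "\<forall>v\<in>V. g (f v) = v" using inv[of _ xs g f] span f g len by auto
    show "\<forall>v\<in>V'. f (g v) = v" using inv[of _ xs' f g] span f g len by auto
  qed (fact f g)+
  moreover have "comodule_hom H_scale sm (V, \<rho>) (V', \<rho>') f"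
  proof (rule A.comodule_homI[OF A.VS A.keys B.VS B.keys f(3) f(1) f(2)])
    fix b x assume x: "x \<in> V"
    have fx: "f x \<in> V'" if "x \<in> V" for x using f(3) that by blast
    have c: "f (A.wproj i v) = B.wproj i (f v)" "f (A.D A.fun_s v) = B.D A.fun_s (f v)"
       "f (A.D A.fun_X v) = B.D A.fun_X (f v)" "f (A.D A.fun_Y v) = B.D A.fun_Y (f v)" if "v \<in> V" for i v
      using comm[OF that] A.op_V[OF that] B.op_V[OF fx[OF that]] by simp_all
    show "f (A.D (dirac b) x) = B.D (dirac b) (f x)"
      by (cases b rule: idx_cases; cases "fst (snd b)")
        (simp_all add: A.D_dirac x B.D_dirac fx c A.D_in)
  qed
  ultimately show ?thesis unfolding comodule_iso_def by auto
qed

context H_space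
begin

lemma comodule_iso_trans:
  assumes M: "comodule H_scale \<Delta> \<epsilon> sm M" and N: "comodule H_scale \<Delta> \<epsilon> sm N" and L: "comodule H_scale \<Delta> \<epsilon> sm L"
    and MN: "comodule_iso H_scale sm M N" and NL: "comodule_iso H_scale sm N L"
  shows "comodule_iso H_scale sm M L"
proof -
  obtain V \<rho> W \<sigma> U \<tau> where eq: "M = (V, \<rho>)" "N = (W, \<sigma>)" "L = (U, \<tau>)" by (metis prod.exhaust)
  obtain f g where f: "comodule_hom H_scale sm (V, \<rho>) (W, \<sigma>) f" "bij_betw f V W"
    and g: "comodule_hom H_scale sm (W, \<sigma>) (U, \<tau>) g" "bij_betw g W U"
    using MN NL by (auto simp: comodule_iso_def eq)
  have sub: "M.subspace V" "M.subspace W" "M.subspace U"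
    and keys: "\<And>x. x \<in> V \<Longrightarrow> Poly_Mapping.keys (\<rho> x) \<subseteq> V \<times> UNIV" "\<And>x. x \<in> W \<Longrightarrow> Poly_Mapping.keys (\<sigma> x) \<subseteq> W \<times> UNIV"
      "\<And>x. x \<in> U \<Longrightarrow> Poly_Mapping.keys (\<tau> x) \<subseteq> U \<times> UNIV"
    using M N L by (simp_all add: comodule_def eq)
  have fW: "f x \<in> W" if "x \<in> V" for x using f(1) that by (auto simp: comodule_hom_def)
  have gU: "g x \<in> U" if "x \<in> W" for x using g(1) that by (auto simp: comodule_hom_def)
  have "comodule_hom H_scale sm (V, \<rho>) (U, \<tau>) (\<lambda>x. g (f x))"
  proof (rule comodule_homI[OF sub(1) keys(1) sub(3) keys(3)])
    show "g (f (cact sm \<rho> (dirac b) x)) = cact sm \<tau> (dirac b) (g (f x))" if "x \<in> V" for b x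
      using comodule_hom_cact[OF sub(1) keys(1) f(1) that] comodule_hom_cact[OF sub(2) keys(2) g(1) fW[OF that]] by simp
  qed (use f(1) g(1) fW gU in \<open>auto simp: comodule_hom_def\<close>)
  moreover have "bij_betw (\<lambda>x. g (f x)) V U" using bij_betw_trans[OF f(2) g(2)] by (simp add: o_def)
  ultimately show ?thesis unfolding comodule_iso_def eq by auto
qed

end

context H_comodule
begin

text \<open>Homomorphisms commute with the weight projections, so a weight that occurs in \<open>V\<close> occurs in the
  first member of a Jordan-Hoelder series that contains a vector of this weight, and survives in the
  factor; conversely the weights of a factor lift.  The right-hand side depends on \<open>d\<close> only.\<close>

lemma weights_dimension_vector:
  assumes dv: "has_dimension_vector H_scale \<Delta> \<epsilon> sm (V, \<rho>) d"
  shows "weights = {i. \<exists>T. simple_comodule H_scale \<Delta> \<epsilon> sm T \<and> d T > 0 \<and>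
    (\<exists>x\<in>fst T. cact sm (snd T) (dirac (L1, True, i)) x \<noteq> 0)}"
proof -
  obtain n N where N: "N 0 = {0}" "N n = V" "\<And>i. i \<le> n \<Longrightarrow> subcomodule H_scale sm (V, \<rho>) (N i)"
      "\<And>i. i < n \<Longrightarrow> \<exists>T. simple_comodule H_scale \<Delta> \<epsilon> sm T \<and> factor_iso H_scale sm (V, \<rho>) (N (Suc i)) (N i) T"
    and d: "\<And>T. simple_comodule H_scale \<Delta> \<epsilon> sm T \<Longrightarrow> d T = card {i. i < n \<and> factor_iso H_scale sm (V, \<rho>) (N (Suc i)) (N i) T}"
    using dv unfolding has_dimension_vector_def jordan_hoelder_series_def by auto
  have NV: "N i \<subseteq> V" if "i \<le> n" for i using N(3)[OF that] by (simp add: subcomodule_def)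
  have factor: "\<exists>f. f ` N (Suc j) = fst T \<and> {x \<in> N (Suc j). f x = 0} = N j \<and>
      (\<forall>x\<in>N (Suc j). \<forall>c. f (D c x) = cact sm (snd T) c (f x))"
    if j: "j < n" and F: "factor_iso H_scale sm (V, \<rho>) (N (Suc j)) (N j) T" for j T
  proof -
    define \<rho>' where "\<rho>' x = (SOME y. Poly_Mapping.keys y \<subseteq> N (Suc j) \<times> UNIV \<and> tensor_eq sm V H_scale UNIV y (\<rho> x))" for x
    have sub: "subcomodule H_scale sm (V, \<rho>) (N (Suc j))" using N(3)[of "Suc j"] j by simp
    have \<rho>': "Poly_Mapping.keys (\<rho>' x) \<subseteq> N (Suc j) \<times> UNIV \<and> tensor_eq sm V H_scale UNIV (\<rho>' x) (\<rho> x)"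
      if "x \<in> N (Suc j)" for x
    proof -
      have "\<exists>y. Poly_Mapping.keys y \<subseteq> N (Suc j) \<times> UNIV \<and> tensor_eq sm V H_scale UNIV y (\<rho> x)"
        using sub that unfolding subcomodule_def prod.case by blast
      then show ?thesis unfolding \<rho>'_def by (rule someI_ex)
    qed
    obtain f where f: "comodule_hom H_scale sm (N (Suc j), \<rho>') (fst T, snd T) f" "f ` N (Suc j) = fst T"
      "{x \<in> N (Suc j). f x = 0} = N j"
      using F unfolding factor_iso_def restrict_comodule_def \<rho>'_def[abs_def] by auto
    have "f (D c x) = cact sm (snd T) c (f x)" if x: "x \<in> N (Suc j)" for x c
    proof -
      have "cact sm \<rho>' c x = D c x"
        unfolding cact_def using lin_ext_contract_cong[OF conjunct2[OF \<rho>'[OF x]]] by blast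
      moreover have "f (cact sm \<rho>' c x) = cact sm (snd T) c (f x)"
        using sub \<rho>' by (intro comodule_hom_cact[OF _ _ f(1) x]) (auto simp: subcomodule_def)
      ultimately show ?thesis by simp
    qed
    then show ?thesis using f(2,3) by blast
  qed
  show ?thesis
  proof (intro set_eqI iffI; (unfold mem_Collect_eq)?)
    fix i assume "i \<in> weights"
    then have "\<exists>j\<le>n. \<exists>x\<in>N j. wproj i x \<noteq> 0" using N(2) by (auto simp: weights_def)
    then have ex: "\<exists>j. j \<le> n \<and> (\<exists>x\<in>N j. wproj i x \<noteq> 0)" by blast
    define j where "j = (LEAST j. j \<le> n \<and> (\<exists>x\<in>N j. wproj i x \<noteq> 0))"
    have j: "j \<le> n" "\<exists>x\<in>N j. wproj i x \<noteq> 0" unfolding j_def using LeastI_ex[OF ex] by auto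
    have "wproj i 0 = 0" using D_scale[OF M.subspace_0[OF VS], of _ 0] by (simp add: wproj_def)
    then obtain k where k: "j = Suc k" using j(2) N(1) by (cases j) auto
    have no: "wproj i x = 0" if "x \<in> N k" for x
      using not_less_Least[of k "\<lambda>j. j \<le> n \<and> (\<exists>x\<in>N j. wproj i x \<noteq> 0)"] that j(1) k unfolding j_def[symmetric] by auto
    obtain x where x: "x \<in> N (Suc k)" "wproj i x \<noteq> 0" using j(2) k by blast
    have kn: "k < n" using j(1) k by simp
    obtain T where T: "simple_comodule H_scale \<Delta> \<epsilon> sm T" "factor_iso H_scale sm (V, \<rho>) (N (Suc k)) (N k) T"
      using N(4)[OF kn] by blast
    obtain f where f: "f ` N (Suc k) = fst T" "{x \<in> N (Suc k). f x = 0} = N k"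
      "\<And>x c. x \<in> N (Suc k) \<Longrightarrow> f (D c x) = cact sm (snd T) c (f x)"
      using factor[OF kn T(2)] by blast
    have xV: "x \<in> V" using x(1) NV[of "Suc k"] kn by auto
    have px: "wproj i x \<in> N (Suc k)"
      unfolding wproj_def by (rule subcomodule_D[OF N(3) x(1)]) (use kn in simp)
    have "f (wproj i x) \<noteq> 0"
    proof
      assume "f (wproj i x) = 0"
      then have "wproj i x \<in> N k" using f(2) px by blast
      then have "wproj i (wproj i x) = 0" by (rule no)
      then show False using relations(1)[OF xV, of i i] x(2) by simp
    qed
    then have "cact sm (snd T) (dirac (L1, True, i)) (f x) \<noteq> 0" using f(3)[OF x(1)] by (simp add: wproj_def)
    moreover have "f x \<in> fst T" using f(1) x(1) by blast
    moreover have "k \<in> {i. i < n \<and> factor_iso H_scale sm (V, \<rho>) (N (Suc i)) (N i) T}" using T(2) kn by simp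
    then have "d T > 0" unfolding d[OF T(1)] by (subst card_gt_0_iff) auto
    ultimately show "\<exists>T. simple_comodule H_scale \<Delta> \<epsilon> sm T \<and> d T > 0 \<and>
      (\<exists>x\<in>fst T. cact sm (snd T) (dirac (L1, True, i)) x \<noteq> 0)" using T(1) by blast
  next
    fix i assume "\<exists>T. simple_comodule H_scale \<Delta> \<epsilon> sm T \<and> d T > 0 \<and>
      (\<exists>x\<in>fst T. cact sm (snd T) (dirac (L1, True, i)) x \<noteq> 0)"
    then obtain T y where T: "simple_comodule H_scale \<Delta> \<epsilon> sm T" "d T > 0"
      and y: "y \<in> fst T" "cact sm (snd T) (dirac (L1, True, i)) y \<noteq> 0" by blast
    then obtain k where k: "k < n" "factor_iso H_scale sm (V, \<rho>) (N (Suc k)) (N k) T"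
      unfolding d[OF T(1)] by (auto simp: card_gt_0_iff)
    obtain f where f: "f ` N (Suc k) = fst T" "{x \<in> N (Suc k). f x = 0} = N k"
      "\<And>x c. x \<in> N (Suc k) \<Longrightarrow> f (D c x) = cact sm (snd T) c (f x)"
      using factor[OF k] by blast
    obtain x where x: "x \<in> N (Suc k)" "y = f x" using y(1) f(1) by blast
    have "f 0 = 0" using f(2) M.subspace_0 N(3)[of k] k(1) by (auto simp: subcomodule_def)
    then have "wproj i x \<noteq> 0" using f(3)[OF x(1), of "dirac (L1, True, i)"] y(2) x(2) by (auto simp: wproj_def)
    then show "i \<in> weights" using NV[of "Suc k"] k(1) x(1) by (auto simp: weights_def)
  qed
qed

lemma indecomposable_O2rep:
  assumes ind: "indecomposable_comodule H_scale \<Delta> \<epsilon> sm (V, \<rho>)" and O2: "O2rep sm V opp ops opX opY K"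
  shows "O2rep.indecomposable sm V opp ops opX opY"
proof -
  interpret O: O2rep sm V opp ops opX opY K by fact
  show ?thesis
    unfolding O.indecomposable_def
    using ind stable_subcomodule[OF O2] unfolding indecomposable_comodule_def by auto
qed

end

text \<open>All indecomposables with dimension vector \<open>d\<close> have the same weights as one of them, hence weights
  in a common interval.  Their monomial bases have codes in a finite set, and equal codes mean
  isomorphic comodules.\<close>

theorem (in H_structure) discrete_corepresentation:
  fixes sm :: "'k \<Rightarrow> 'm::ab_group_add \<Rightarrow> 'm"
  assumes sm: "vector_space sm" and char: "(2 :: 'k) \<noteq> 0"
  shows "discrete_corepresentation_type H_scale \<Delta> \<epsilon> sm"
  unfolding discrete_corepresentation_type_def Let_def
proof
  fix d
  define Xs where "Xs = indecomposables_of_dimension_vector H_scale \<Delta> \<epsilon> sm d"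
  define r where "r = {(M, M'). M \<in> Xs \<and> M' \<in> Xs \<and> comodule_iso H_scale sm M M'}"
  interpret sp: H_space sm by (simp add: H_space_def sm)
  have com: "comodule H_scale \<Delta> \<epsilon> sm M" "indecomposable_comodule H_scale \<Delta> \<epsilon> sm M"
    "has_dimension_vector H_scale \<Delta> \<epsilon> sm M d" if "M \<in> Xs" for M
    using that by (auto simp: Xs_def indecomposables_of_dimension_vector_def indecomposable_comodule_def)
  have HC: "H_comodule \<Delta> \<epsilon> S sm (fst M) (snd M)" if "M \<in> Xs" for M
    using com(1)[OF that] by unfold_locales simp
  have "finite (Xs // r)"
  proof (cases "Xs = {}")
    case True
    then show ?thesis by (simp add: quotient_def)
  next
    case False
    then obtain M0 where M0: "M0 \<in> Xs" by blast
    interpret C0: H_comodule \<Delta> \<epsilon> S sm "fst M0" "snd M0" by (rule HC[OF M0])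
    have "finite C0.weights"
      using com(3)[OF M0] by (intro C0.finite_weights) (simp add: has_dimension_vector_def)
    then obtain K where K: "C0.weights \<subseteq> {- int K..int K}"
    proof -
      assume *: "\<And>K. C0.weights \<subseteq> {- int K..int K} \<Longrightarrow> thesis" and fin: "finite C0.weights"
      define k where "k = (\<Sum>i\<in>C0.weights. nat \<bar>i\<bar>)"
      have "C0.weights \<subseteq> {- int k..int k}"
      proof
        fix i assume "i \<in> C0.weights"
        then have "nat \<bar>i\<bar> \<le> k" unfolding k_def using fin by (intro member_le_sum) auto
        then show "i \<in> {- int k..int k}" by auto
      qed
      then show thesis by (rule *)
    qed
    let ?N = "4 * (K + 2)"
    define has_code where "has_code M cs \<longleftrightarrow> (let V = fst M; \<rho> = snd M in
        O2rep sm V (H_comodule.opp sm V \<rho>) (H_comodule.ops sm V \<rho>) (H_comodule.opX sm V \<rho>) (H_comodule.opY sm V \<rho>) K \<and>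
        (\<exists>xs. O2rep.coded sm V (H_comodule.opp sm V \<rho>) (H_comodule.ops sm V \<rho>) (H_comodule.opX sm V \<rho>) (H_comodule.opY sm V \<rho>) xs cs))"
      for M cs
    have "\<exists>cs\<in>codes K ?N. has_code M cs" if M: "M \<in> Xs" for M
    proof -
      interpret C: H_comodule \<Delta> \<epsilon> S sm "fst M" "snd M" by (rule HC[OF M])
      have "C.weights = C0.weights"
        using C.weights_dimension_vector[of d] C0.weights_dimension_vector[of d] com(3)[OF M] com(3)[OF M0] by simp
      then have O2: "O2rep sm (fst M) C.opp C.ops C.opX C.opY K"
        using C.O2rep_comodule[OF char] K by simp
      interpret O: O2rep sm "fst M" C.opp C.ops C.opX C.opY K by (rule O2)
      have "O.indecomposable" using C.indecomposable_O2rep[OF _ O2] com(2)[OF M] by simp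
      then obtain B where "O.monomial_basis ?N B" using O.indecomposable_monomial_basis by blast
      then show ?thesis using O.monomial_basis_coded O2 by (fastforce simp: has_code_def Let_def)
    qed
    then obtain c where c: "\<And>M. M \<in> Xs \<Longrightarrow> c M \<in> codes K ?N \<and> has_code M (c M)" by metis
    have iso: "comodule_iso H_scale sm M M'" if "M \<in> Xs" "M' \<in> Xs" "c M = c M'" for M M'
    proof -
      have "has_code M (c M)" "has_code M' (c M)" using c that by metis+
      then have "comodule_iso H_scale sm (fst M, snd M) (fst M', snd M')"
        unfolding has_code_def Let_def using comodule_iso_coded[OF HC[OF that(1)] HC[OF that(2)]] by blast
      then show ?thesis by simp
    qed
    have cls: "r `` {M} = r `` {M'}" if "M \<in> Xs" "M' \<in> Xs" "c M = c M'" for M M'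
    proof -
      have "r `` {M} \<subseteq> r `` {M'}" if "M \<in> Xs" "M' \<in> Xs" "c M = c M'" for M M'
        using iso[of M' M] that sp.comodule_iso_trans com(1) unfolding r_def by (auto; metis)
      then show ?thesis using that by (metis subset_antisym)
    qed
    define h where "h y = r `` {SOME M. M \<in> Xs \<and> c M = y}" for y
    have "Xs // r \<subseteq> h ` codes K ?N"
    proof
      fix C assume "C \<in> Xs // r"
      then obtain M where M: "M \<in> Xs" "C = r `` {M}" by (auto simp: quotient_def)
      define M1 where "M1 = (SOME M'. M' \<in> Xs \<and> c M' = c M)"
      have "M1 \<in> Xs \<and> c M1 = c M" unfolding M1_def by (rule someI[of _ M]) (simp add: M)
      then have "C = r `` {M1}" using cls[of M M1] M by simp
      then have "C = h (c M)" by (simp add: h_def M1_def)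
      then show "C \<in> h ` codes K ?N" using c[OF M(1)] by blast
    qed
    then show ?thesis by (rule finite_surj[OF finite_codes])
  qed
  then show "finite (indecomposables_of_dimension_vector H_scale \<Delta> \<epsilon> sm d //
      {(M, M'). M \<in> indecomposables_of_dimension_vector H_scale \<Delta> \<epsilon> sm d \<and>
        M' \<in> indecomposables_of_dimension_vector H_scale \<Delta> \<epsilon> sm d \<and> comodule_iso H_scale sm M M'})"
    unfolding Xs_def r_def .
qed

theorem proposition5p4:
  fixes sm :: "'k::{alg_closed_field, field_char_0} \<Rightarrow> 'm::ab_group_add \<Rightarrow> 'm"
  assumes "vector_space sm"
  shows "(\<exists>(\<Delta> :: 'k hopf_efuv \<Rightarrow> _) \<epsilon> S. H_hopf_structure \<Delta> \<epsilon> S) \<and>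
    (\<forall>(\<Delta> :: 'k hopf_efuv \<Rightarrow> _) \<epsilon> S. H_hopf_structure \<Delta> \<epsilon> S \<longrightarrow>
       dual_chevalley_property H_scale \<Delta> S \<and>
       discrete_corepresentation_type H_scale \<Delta> \<epsilon> sm)"
proof (intro conjI allI impI)
  show "\<exists>(\<Delta> :: 'k hopf_efuv \<Rightarrow> _) \<epsilon> S. H_hopf_structure \<Delta> \<epsilon> S"
    using H_hopf_structure_exists by blast
  fix \<Delta> :: "'k hopf_efuv \<Rightarrow> ('k hopf_efuv \<times> 'k hopf_efuv \<Rightarrow>\<^sub>0 'k)" and \<epsilon> S
  assume "H_hopf_structure \<Delta> \<epsilon> S"
  then interpret H_structure \<Delta> \<epsilon> S by unfold_locales
  have char: "(2 :: 'k) \<noteq> 0" by simp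
  show "dual_chevalley_property H_scale \<Delta> S" by (rule dual_chevalley[OF char])
  show "discrete_corepresentation_type H_scale \<Delta> \<epsilon> sm" by (rule discrete_corepresentation[OF assms char])
qed

end
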